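(* (1) Let $\lambda,\kappa,\theta$ be cardinals and let $S^\ast$ be a set of ordinals such that (a) $\lambda=\mathrm{cf}(\lambda)>\kappa=\mathrm{cf}(\kappa)>\theta=\mathrm{cf}(\theta)\ge\aleph_1$; (b) $S^\ast\subseteq S^{\lambda^+}_\theta$ is stationary in $\lambda^+$, and moreover the set $$S_1=\{\delta<\lambda^+ : \mathrm{cf}(\delta)=\kappa \text{ and } S^\ast\cap\delta \text{ is stationary in } \delta\}$$ is stationary in $\lambda^+$. Then there are a stationary (in $\lambda^+$) set $S'\subseteq S^\ast$ and a sequence $\langle E_\delta : \delta\in S'\rangle$ such that (i) for each $\delta\in S'$, $E_\delta$ is a club of $\delta$ with $\mathrm{otp}(E_\delta)<\lambda^\omega\cdot\kappa$; (ii) for every unbounded subset $A$ of $\lambda^+$ with $A\subseteq S^{\lambda^+}_\lambda$, there are stationarily many $\delta\in S'$ (i.e. the set of such $\delta$ is stationary in $\lambda^+$) such that $$\delta=\sup(A\cap\mathrm{nacc}(E_\delta)).$$ (2) If in (1) we allow $\theta=\aleph_0$ (that is, in (a) we only require $\lambda=\mathrm{cf}(\lambda)>\kappa=\mathrm{cf}(\kappa)>\theta=\mathrm{cf}(\theta)\ge\aleph_0$), but additionally require $\lambda\ge 2^{\aleph_0}$, then, under the same assumption (b), the conclusion of (1) remains true: there are a stationary $S'\subseteq S^\ast$ and a sequence $\langle E_\delta:\delta\in S'\rangle$ satisfying (i) and (ii).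
   Context: The setting is ZFC. For an ordinal $\delta$ and a regular cardinal $\kappa<\delta$, $S^\delta_\kappa=\{\alpha<\delta : \mathrm{cf}(\alpha)=\kappa\}$. For a set of ordinals $C\subseteq\alpha$, $\mathrm{acc}(C)=\{\beta\in C : \beta=\sup(C\cap\beta)\}$ and $\mathrm{nacc}(C)=C\setminus\mathrm{acc}(C)$. $\mathrm{otp}(C)$ denotes the order type of $C$. A club of $\delta$ is a closed unbounded subset of $\delta$. The expression $\lambda^\omega\cdot\kappa$ is in the sense of ordinal exponentiation and ordinal multiplication. *)

theory Defs
  imports Main
begin

unbundle cardinal_syntax

text \<open>
  An ordinal is represented by a well-order relation \<open>r\<close>, up to order isomorphism \<open>=o\<close>.
  As a von Neumann ordinal is the set of its predecessors, the elements of \<open>Field r\<close> stand for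
  the ordinals below \<open>r\<close>, and \<open>\<delta> \<in> Field r\<close> is itself the ordinal \<open>seg r \<delta>\<close> whose field is
  \<open>underS r \<delta>\<close>. Cardinals are the relations satisfying \<open>Card_order\<close> (initial ordinals), and
  the order type of \<open>C \<subseteq> Field r\<close> is that of the relation \<open>Restr r C\<close>.
\<close>

definition seg :: "'a rel \<Rightarrow> 'a \<Rightarrow> 'a rel" where
  "seg r \<delta> = Restr r (underS r \<delta>)"

text \<open>
  The inequality is weak (unlike in \<^const>\<open>cofinal\<close>), so that \<open>cof\<close> below also gives the right
  value on successor ordinals. On limit ordinals this makes no difference.
\<close>

definition unbounded_in :: "'a rel \<Rightarrow> 'a set \<Rightarrow> bool" where
  "unbounded_in r X \<longleftrightarrow> X \<subseteq> Field r \<and> (\<forall>a \<in> Field r. \<exists>b \<in> X. (a, b) \<in> r)"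

definition cof :: "'a rel \<Rightarrow> 'a rel" where
  "cof r = |SOME X. unbounded_in r X \<and> (\<forall>Y. unbounded_in r Y \<longrightarrow> |X| \<le>o |Y| )|"

lemma cof_witness:
  assumes "Well_order r"
  obtains X where "unbounded_in r X" "cof r = |X|" "\<And>Y. unbounded_in r Y \<Longrightarrow> |X| \<le>o |Y|"
proof -
  have "unbounded_in r (Field r)"
    using assms unfolding unbounded_in_def order_on_defs refl_on_def by blast
  then have "\<exists>R \<in> {|X| |X. unbounded_in r X}. \<forall>R' \<in> {|X| |X. unbounded_in r X}. R \<le>o R'"
    by (intro exists_minim_Card_order) (auto simp: card_of_Card_order)
  then have "\<exists>X. unbounded_in r X \<and> (\<forall>Y. unbounded_in r Y \<longrightarrow> |X| \<le>o |Y| )"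
    by blast
  from someI_ex[OF this] show thesis
    using that unfolding cof_def by blast
qed

lemma cof_eq_iff_regularCard:
  assumes r: "Card_order r" and inf: "\<not> finite (Field r)"
  shows "cof r =o r \<longleftrightarrow> regularCard r"
proof -
  have wo: "Well_order r" using r card_order_on_well_order_on by blast
  have unb: "unbounded_in r X \<longleftrightarrow> X \<subseteq> Field r \<and> cofinal X r" for X
  proof -
    have "\<exists>c \<in> X. a \<noteq> c \<and> (a, c) \<in> r"
      if X: "unbounded_in r X" and a: "a \<in> Field r" for a
    proof -
      obtain b where b: "a \<noteq> b" "(a, b) \<in> r"
        using infinite_Card_order_limit[OF r inf a] by blast
      then obtain c where c: "c \<in> X" "(b, c) \<in> r"
        using X unfolding unbounded_in_def by (meson FieldI2)
      with b wo show ?thesis unfolding order_on_defs trans_def antisym_def by metis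
    qed
    then show ?thesis unfolding unbounded_in_def cofinal_def by blast
  qed
  obtain X where X: "unbounded_in r X" "cof r = |X|"
    "\<And>Y. unbounded_in r Y \<Longrightarrow> |X| \<le>o |Y|" using cof_witness[OF wo] by metis
  have le: "|Y| \<le>o r" if "Y \<subseteq> Field r" for Y
    using card_of_mono1[OF that] card_of_Field_ordIso[OF r] ordLeq_ordIso_trans by blast
  show ?thesis
  proof
    assume "cof r =o r"
    then have "r \<le>o |Y|" if "unbounded_in r Y" for Y
      using X that by (metis ordIso_symmetric ordIso_ordLeq_trans)
    then show "regularCard r"
      unfolding regularCard_def using unb le by (simp add: ordIso_iff_ordLeq)
  next
    assume "regularCard r"
    then show "cof r =o r" unfolding X(2) regularCard_def using X(1) unb by blast
  qed
qed

definition cof_set :: "'a rel \<Rightarrow> 'b rel \<Rightarrow> 'a set" where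
  "cof_set r \<kappa> = {\<alpha> \<in> Field r. cof (seg r \<alpha>) =o \<kappa>}"

text \<open>
  \<^term>\<open>wo_rel.supr r X\<close> is the least element of \<^term>\<open>Above r X\<close>; it is meaningful when \<open>X\<close>
  is bounded in \<open>r\<close>. In particular the supremum of the empty set is the least element.
\<close>

definition club_in :: "'a rel \<Rightarrow> 'a set \<Rightarrow> bool" where
  "club_in r C \<longleftrightarrow> unbounded_in r C \<and>
     (\<forall>X. X \<subseteq> C \<and> X \<noteq> {} \<and> Above r X \<noteq> {} \<longrightarrow> wo_rel.supr r X \<in> C)"

definition stationary_in :: "'a rel \<Rightarrow> 'a set \<Rightarrow> bool" where
  "stationary_in r S \<longleftrightarrow> S \<subseteq> Field r \<and> (\<forall>C. club_in r C \<longrightarrow> S \<inter> C \<noteq> {})"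

definition acc :: "'a rel \<Rightarrow> 'a set \<Rightarrow> 'a set" where
  "acc r C = {\<beta> \<in> C. \<beta> = wo_rel.supr r (C \<inter> underS r \<beta>)}"

definition nacc :: "'a rel \<Rightarrow> 'a set \<Rightarrow> 'a set" where
  "nacc r C = C - acc r C"

text \<open>Ordinal product \<open>r \<cdot> s\<close>: \<open>s\<close> many copies of \<open>r\<close>, the second component being the more
  significant one.\<close>

definition ord_prod :: "'a rel \<Rightarrow> 'b rel \<Rightarrow> ('a \<times> 'b) rel" where
  "ord_prod r s = {((a, b), (a', b')). a \<in> Field r \<and> a' \<in> Field r \<and> b \<in> Field s \<and> b' \<in> Field s \<and>
     (b \<noteq> b' \<and> (b, b') \<in> s \<or> b = b' \<and> (a, a') \<in> r)}"

text \<open>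
  Ordinal exponentiation \<open>r\<^sup>s\<close> for \<open>r > 0\<close>: the functions from \<open>s\<close> to \<open>r\<close> of finite support
  (the exponents and digits of Cantor normal forms to base \<open>r\<close>), compared at the largest
  argument where they differ. \<^const>\<open>Func\<close> makes the functions \<open>undefined\<close> outside \<open>Field s\<close>.
\<close>

definition ord_exp :: "'a rel \<Rightarrow> 'b rel \<Rightarrow> ('b \<Rightarrow> 'a) rel" where
  "ord_exp r s =
     (let F = {f \<in> Func (Field s) (Field r).
                 finite {x \<in> Field s. f x \<noteq> wo_rel.minim r (Field r)}}
      in {(f, g). f \<in> F \<and> g \<in> F \<and>
            (f = g \<or> (\<exists>m \<in> Field s. f m \<noteq> g m \<and> (f m, g m) \<in> r \<and>
                        (\<forall>x. x \<noteq> m \<and> (m, x) \<in> s \<longrightarrow> f x = g x)))})"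

text \<open>
  The sequence \<open>E\<close> is a total function of which only the values on \<open>S'\<close> matter;
  \<^const>\<open>natLeq\<close> is the ordinal \<open>\<omega>\<close>.
\<close>

definition club_guessing :: "'a rel \<Rightarrow> 'b rel \<Rightarrow> 'a set set \<Rightarrow> bool" where
  "club_guessing lam \<kappa> Sstar \<longleftrightarrow>
     (let r = cardSuc lam in
      \<exists>S' E. S' \<subseteq> Sstar \<and> stationary_in r S' \<and>
        (\<forall>\<delta> \<in> S'. club_in (seg r \<delta>) (E \<delta>) \<and>
                   Restr r (E \<delta>) <o ord_prod (ord_exp lam natLeq) \<kappa>) \<and>
        (\<forall>A. unbounded_in r A \<and> A \<subseteq> cof_set r lam \<longrightarrow>
             stationary_in r {\<delta> \<in> S'. \<delta> = wo_rel.supr r (A \<inter> nacc r (E \<delta>))}))"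

end

theory Submission
  imports Defs
begin

text \<open>
  Write \<open>\<lambda>\<close> for \<open>lam\<close> and fix a ladder system on \<open>\<lambda>\<^sup>+\<close>: a club \<open>e \<gamma>\<close> in every \<open>\<gamma> < \<lambda>\<^sup>+\<close> all
  of whose proper initial segments have fewer than \<open>\<lambda>\<close> elements. The minimal walk from \<open>\<gamma>\<close> to
  \<open>\<beta> < \<gamma>\<close> steps from \<open>\<gamma>\<close> to the least element of \<open>e \<gamma>\<close> that is not below \<open>\<beta>\<close>, and so on until it
  arrives at \<open>\<beta>\<close>. For \<open>E \<alpha>\<close> take the set of all \<open>\<beta> < \<alpha>\<close> that are reached from \<open>\<alpha>\<close> in at most \<open>n\<close>
  steps, where \<open>n \<ge> 1\<close>. It is a club in \<open>\<alpha>\<close>, and recording the positions of the steps in their ladders embeds it into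
  a finite power of \<open>\<lambda>\<close>, so its order type is below \<open>\<lambda>\<^sup>\<omega>\<close>.

  Let \<open>A\<close> be a set of points of cofinality \<open>\<lambda>\<close>, unbounded in some \<open>\<delta>\<close> of cofinality \<open>\<kappa>\<close>. Every
  \<open>\<beta> \<in> A \<inter> \<delta>\<close> is reached from \<open>\<delta>\<close> in finitely many steps, and since \<open>\<kappa>\<close> is uncountable one number
  \<open>n\<close> of steps occurs for unboundedly many \<open>\<beta>\<close> (\<open>one_length_suffices\<close>). These \<open>\<beta>\<close> are not limits of
  the set of points reached in at most \<open>n\<close> steps: the elements below \<open>\<beta>\<close> of a ladder on the way are
  fewer than \<open>\<lambda>\<close>, hence bounded below \<open>\<beta>\<close> (\<open>walk_isolated\<close>). So that set guesses \<open>A\<close> at \<open>\<delta>\<close>, and by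
  restriction the corresponding set at \<open>\<alpha>\<close> guesses \<open>A\<close> at every \<open>\<alpha> < \<delta>\<close> which is a limit of the
  chosen \<open>\<beta>\<close> and satisfies \<open>e \<alpha> = e \<delta> \<inter> \<alpha>\<close>.

  The number \<open>n\<close> depends on \<open>A\<close>, whereas \<open>E \<alpha>\<close> may not. This is where reflection enters. If the
  points of \<open>S\<^sup>*\<close> are coloured with the natural numbers so that every colour class is stationary in
  \<open>\<delta>\<close>, and points of colour \<open>k\<close> use walks of \<open>k + 1\<close> steps, then whatever \<open>n\<close> the set \<open>A\<close> asks for at
  \<open>\<delta>\<close>, some \<open>\<alpha> \<in> S\<^sup>* \<inter> \<delta>\<close> in any prescribed club of \<open>\<delta>\<close> has the right colour. Two things are
  therefore needed for stationarily many \<open>\<delta>\<close> at once, and \<open>guessing_core\<close> puts them together.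

  Coherence (\<open>coherent_ladders\<close>): \<open>e \<alpha> = e \<delta> \<inter> \<alpha>\<close> for club many \<open>\<alpha> < \<delta>\<close>. Fix injections of every
  \<open>\<gamma> < \<lambda>\<^sup>+\<close> into \<open>\<lambda>\<close>. For a club \<open>C\<close> of \<open>\<delta>\<close> of size \<open>\<kappa> < \<lambda>\<close>, closing off yields an \<open>i < \<lambda>\<close> such
  that the points with index below \<open>i\<close> under the injection of \<open>\<alpha> \<in> C\<close> are exactly those below
  \<open>\<alpha>\<close> with index below \<open>i\<close> under the injection of \<open>\<delta>\<close>. The nonstationary ideal of \<open>\<lambda>\<^sup>+\<close> being
  \<open>\<lambda>\<^sup>+\<close>-complete, one \<open>i\<close> serves stationarily many \<open>\<delta>\<close>; the ladders are closures of these sets.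

  Colouring (\<open>uniform_colouring\<close>): choose a cofinal \<open>\<theta>\<close>-sequence \<open>c \<alpha>\<close> in every \<open>\<alpha> \<in> S\<^sup>*\<close>. Inside
  \<open>\<delta>\<close>, Fodor's lemma gives \<open>\<zeta> < \<theta>\<close> and a monotone \<open>G\<close> such that for every \<open>x < \<delta>\<close> the interval
  from \<open>x\<close> to \<open>G x\<close> contains \<open>c \<alpha> \<zeta>\<close> for stationarily many \<open>\<alpha> \<in> S\<^sup>* \<inter> \<delta>\<close>. Given a sequence with
  \<open>G (\<gamma>\<^sub>k) \<le> \<gamma>\<^sub>k\<^sub>+\<^sub>1\<close>, colour \<open>\<alpha>\<close> by the \<open>k\<close> whose interval contains \<open>c \<alpha> \<zeta>\<close>. By Fodor's lemma on \<open>\<lambda>\<^sup>+\<close>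
  the same sequence works for stationarily many \<open>\<delta>\<close>, as soon as it can be found in a list indexed
  by some \<open>\<epsilon> < \<delta>\<close> and by at most \<open>\<lambda>\<close> parameters. If \<open>2\<close> to the power \<open>\<aleph>\<^sub>0\<close> is at most \<open>\<lambda>\<close>, the
  subsequences of one ladder of type \<open>\<omega>\<close> at \<open>\<epsilon>\<close> form such a list
  (\<open>ladder_subsequence_guess\<close>). If \<open>\<theta> \<ge> \<aleph>\<^sub>1\<close>, then \<open>\<kappa> \<ge> \<aleph>\<^sub>2\<close> and Shelah's club guessing
  (\<open>club_guessing_sequences\<close>) provides one, after transport along the order types of the coherent
  sets (\<open>coherent_position_guess\<close>).

  The combinatorics is done for a well-ordered type, ordinals being represented by initial segments.
  The relation of the theorem is finally extended to a well-order of its whole type.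
\<close>

section \<open>Clubs, stationary sets and Fodor's lemma\<close>

context wellorder
begin

text \<open>
  The point \<open>d\<close> lies strictly between \<open>y\<close> and \<open>x\<close>, so that successors are not limits; the first
  conjunct excludes the least element.
\<close>
definition limit_of :: "'a set \<Rightarrow> 'a \<Rightarrow> bool" where
  "limit_of C x \<longleftrightarrow> (\<exists>y. y < x) \<and> (\<forall>y<x. \<exists>d\<in>C. y < d \<and> d < x)"

text \<open>
  Here and below \<open>I\<close> is a down-closed set standing for an ordinal. It is \<open>{..<\<delta>}\<close> for the points
  \<open>\<delta>\<close>, and the field of the given relation for \<open>\<lambda>\<^sup>+\<close> itself, which need not have a supremum in the
  type.
\<close>
definition cofinal_in :: "'a set \<Rightarrow> 'a set \<Rightarrow> bool" where
  "cofinal_in I C \<longleftrightarrow> C \<subseteq> I \<and> (\<forall>x\<in>I. \<exists>c\<in>C. x \<le> c)"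

definition club :: "'a set \<Rightarrow> 'a set \<Rightarrow> bool" where
  "club I C \<longleftrightarrow> cofinal_in I C \<and> (\<forall>x\<in>I. limit_of C x \<longrightarrow> x \<in> C)"

definition stationary :: "'a set \<Rightarrow> 'a set \<Rightarrow> bool" where
  "stationary I S \<longleftrightarrow> S \<subseteq> I \<and> (\<forall>C. club I C \<longrightarrow> S \<inter> C \<noteq> {})"

definition initial :: "'a set \<Rightarrow> bool" where
  "initial I \<longleftrightarrow> (\<forall>x\<in>I. \<forall>y<x. y \<in> I)"

text \<open>
  The bounds are strict, so that \<open>I\<close> has no maximum when \<open>\<mu>\<close> is infinite.
\<close>
definition cof_ge :: "'a set \<Rightarrow> 'b rel \<Rightarrow> bool" where
  "cof_ge I \<mu> \<longleftrightarrow> (\<forall>X. X \<subseteq> I \<and> |X| <o \<mu> \<longrightarrow> (\<exists>b\<in>I. \<forall>x\<in>X. x < b))"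

lemma limit_of_mono: "limit_of C x \<Longrightarrow> C \<subseteq> D \<Longrightarrow> limit_of D x"
  unfolding limit_of_def by blast

lemma limit_of_cong:
  "(\<And>y. y < x \<Longrightarrow> y \<in> C \<longleftrightarrow> y \<in> D) \<Longrightarrow> limit_of C x \<longleftrightarrow> limit_of D x"
  unfolding limit_of_def by blast

lemma initial_lessThan [simp]: "initial {..<\<delta>}"
  unfolding initial_def by auto

lemma initialD: "initial I \<Longrightarrow> x \<in> I \<Longrightarrow> y \<le> x \<Longrightarrow> y \<in> I"
  unfolding initial_def by (cases "y = x") auto

lemma cof_geD:
  "cof_ge I \<mu> \<Longrightarrow> X \<subseteq> I \<Longrightarrow> |X| <o \<mu> \<Longrightarrow> \<exists>b\<in>I. \<forall>x\<in>X. x < b"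
  unfolding cof_ge_def by blast

lemma card_less_subset: "A \<subseteq> B \<Longrightarrow> |B| <o \<mu> \<Longrightarrow> |A| <o \<mu>"
  by (rule ordLeq_ordLess_trans[OF card_of_mono1])

lemma card_less_image: "|B| <o \<mu> \<Longrightarrow> |h ` B| <o \<mu>"
  by (rule ordLeq_ordLess_trans[OF card_of_image])

lemma countable_image_ordLess: "natLeq <o \<mu> \<Longrightarrow> |f ` (A :: nat set)| <o \<mu>"
  by (meson card_of_image card_of_mono1 card_of_nat ordIso_ordLess_trans ordLeq_ordLess_trans
      ordLeq_transitive subset_UNIV)

lemma singleton_ordLess: "natLeq <o \<mu> \<Longrightarrow> |{x}| <o \<mu>"
  using countable_image_ordLess[of \<mu> "\<lambda>_. x" "{0}"] by simp

lemma no_max: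
  assumes "cof_ge I \<mu>" "natLeq <o \<mu>" "x \<in> I"
  shows "\<exists>y\<in>I. x < y"
  using cof_geD[OF assms(1), of "{x}"] singleton_ordLess[OF assms(2), of x] assms(3) by auto

lemma cofinal_strict:
  assumes "cof_ge I \<mu>" "natLeq <o \<mu>" "cofinal_in I C" "x \<in> I"
  shows "\<exists>c\<in>C. x < c"
proof -
  obtain y where "y \<in> I" "x < y" using no_max[OF assms(1,2,4)] by blast
  then show ?thesis using assms(3) unfolding cofinal_in_def by (meson less_le_trans)
qed

text \<open>
  The closing-off argument behind all constructions of clubs: iterate a step \<open>\<omega>\<close> times and take
  the supremum, which stays in \<open>I\<close> because the cofinality is uncountable.
\<close>
lemma omega_chain:
  assumes I: "initial I" "cof_ge I \<mu>" and \<mu>: "natLeq <o \<mu>"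
    and step: "\<And>x. x \<in> I \<Longrightarrow> \<exists>y\<in>I. x < y \<and> Q x y"
    and x0: "x0 \<in> I"
  obtains s x where "s \<in> I" "x 0 = x0" "\<And>k. x k < x (Suc k)" "\<And>k. Q (x k) (x (Suc k))"
    "\<And>k::nat. x k < s" "\<And>y. y < s \<Longrightarrow> \<exists>k. y < x k"
proof -
  have "\<exists>x. \<forall>n::nat. (x n \<in> I \<and> (n = 0 \<longrightarrow> x n = x0)) \<and> (x n < x (Suc n) \<and> Q (x n) (x (Suc n)))"
    by (rule dependent_nat_choice) (use step x0 in blast)+
  then obtain x where x: "\<And>n::nat. x n \<in> I" "x 0 = x0" "\<And>n. x n < x (Suc n)"
    "\<And>n. Q (x n) (x (Suc n))" by blast
  obtain b where b: "b \<in> I" "\<And>n. x n < b"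
    using cof_geD[OF I(2), of "range x"] countable_image_ordLess[OF \<mu>, of x UNIV] x(1) by blast
  define s where "s = (LEAST s. \<forall>n. x n < s)"
  have s: "x n < s" for n unfolding s_def using LeastI[of "\<lambda>s. \<forall>n. x n < s" b] b by blast
  have "s \<le> b" unfolding s_def by (rule Least_le) (use b in blast)
  then have "s \<in> I" using initialD I(1) b(1) by blast
  moreover have "\<exists>k. y < x k" if "y < s" for y
  proof -
    have "\<not> (\<forall>n. x n < y)" using not_less_Least that unfolding s_def by blast
    then obtain n where "y \<le> x n" using not_less by blast
    then have "y < x (Suc n)" using x(3)[of n] le_less_trans by blast
    then show ?thesis by blast
  qed
  ultimately show thesis using that x s by blast
qed

lemma limit_of_chain:
  assumes "\<And>k::nat. x k < s" "\<And>y. y < s \<Longrightarrow> \<exists>k. y < x k" "\<And>k. \<exists>d\<in>C. x k < d \<and> d \<le> x (Suc k)"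
  shows "limit_of C s"
  unfolding limit_of_def
proof (intro conjI allI impI)
  show "\<exists>y. y < s" using assms(1) by blast
next
  fix y assume "y < s"
  then obtain k where "y < x k" using assms(2) by blast
  moreover obtain d where "d \<in> C" "x k < d" "d \<le> x (Suc k)" using assms(3) by blast
  ultimately show "\<exists>d\<in>C. y < d \<and> d < s" using assms(1)[of "Suc k"]
    by (meson le_less_trans less_trans)
qed

text \<open>
  Diagonal intersections. The club \<open>D j\<close> becomes active above the point \<open>b j\<close>; a closing-off step
  at \<open>x\<close> has to serve only the fewer than \<open>\<mu>\<close> many \<open>j\<close> active at \<open>x\<close>, and their witnesses have a
  common upper bound. Constant \<open>b\<close> gives ordinary intersections of fewer than \<open>\<mu>\<close> clubs.
\<close>
lemma club_diagonal:
  assumes I: "initial I" "cof_ge I \<mu>" and \<mu>: "natLeq <o \<mu>"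
    and D: "\<And>j. j \<in> J \<Longrightarrow> club I (D j)"
    and few: "\<And>x. x \<in> I \<Longrightarrow> |{j\<in>J. b j \<le> x}| <o \<mu>"
  shows "club I {x\<in>I. \<forall>j\<in>J. b j < x \<longrightarrow> x \<in> D j}" (is "club I ?D")
  unfolding club_def cofinal_in_def
proof (intro conjI ballI impI)
  show "?D \<subseteq> I" by blast
next
  fix x0 assume x0: "x0 \<in> I"
  define Q where "Q x y \<longleftrightarrow> (\<forall>j\<in>J. b j \<le> x \<longrightarrow> (\<exists>d\<in>D j. x < d \<and> d \<le> y))" for x y
  have step: "\<exists>y\<in>I. x < y \<and> Q x y" if x: "x \<in> I" for x
  proof -
    let ?J = "{j\<in>J. b j \<le> x}"
    have "\<forall>j\<in>?J. \<exists>d. d \<in> D j \<and> x < d"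
      using cofinal_strict[OF I(2) \<mu> _ x] D unfolding club_def by blast
    then obtain h where h: "\<And>j. j \<in> ?J \<Longrightarrow> h j \<in> D j \<and> x < h j" by metis
    have "h ` ?J \<subseteq> I" using h D unfolding club_def cofinal_in_def by blast
    moreover have "|h ` ?J| <o \<mu>" using few[OF x] by (rule card_less_image)
    ultimately have "\<exists>y\<in>I. \<forall>z\<in>h ` ?J. z < y" by (rule cof_geD[OF I(2)])
    then obtain y where y: "y \<in> I" "\<And>j. j \<in> ?J \<Longrightarrow> h j < y" by auto
    obtain z where z: "z \<in> I" "x < z" using no_max[OF I(2) \<mu> x] by blast
    have "max y z \<in> I" using y z by (simp add: max_def)
    moreover have "x < max y z" using z by (simp add: less_max_iff_disj)
    moreover have "Q x (max y z)" unfolding Q_def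
      using h y by (metis (mono_tags, lifting) less_imp_le max.coboundedI1 mem_Collect_eq)
    ultimately show ?thesis by blast
  qed
  obtain s x where s: "s \<in> I" "x 0 = x0" "\<And>k. x k < x (Suc k)" "\<And>k. Q (x k) (x (Suc k))"
    "\<And>k::nat. x k < s" "\<And>y. y < s \<Longrightarrow> \<exists>k. y < x k"
    by (rule omega_chain[OF I \<mu> step x0]) (assumption, rule that, assumption+)
  have incr: "x k \<le> x (k + m)" for k m
    by (induction m) (auto intro: order.trans less_imp_le[OF s(3)])
  have "s \<in> D j" if j: "j \<in> J" "b j < s" for j
  proof -
    obtain k where k: "b j < x k" using s(6) j(2) by blast
    have "limit_of (D j) s"
    proof (rule limit_of_chain[of "\<lambda>m. x (k + m)"])
      fix y assume "y < s"
      then obtain k' where "y < x k'" using s(6) by blast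
      then have "y < x (k + k')" using incr[of k' k] by (simp add: add.commute)
      then show "\<exists>m. y < x (k + m)" by blast
    next
      fix m
      have "b j \<le> x (k + m)" using k incr[of k m] by (meson less_imp_le order.trans)
      then show "\<exists>d\<in>D j. x (k + m) < d \<and> d \<le> x (k + Suc m)"
        using s(4)[of "k + m"] j(1) unfolding Q_def by simp
    qed (use s in auto)
    then show ?thesis using D[OF j(1)] s(1) unfolding club_def by blast
  qed
  then have "s \<in> ?D" using s(1) by blast
  moreover have "x0 \<le> s" using s(2,5) by (metis less_imp_le)
  ultimately show "\<exists>c\<in>?D. x0 \<le> c" by blast
next
  fix x assume x: "x \<in> I" "limit_of ?D x"
  have "x \<in> D j" if j: "j \<in> J" "b j < x" for j
  proof -
    have "limit_of (D j) x" unfolding limit_of_def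
    proof (intro conjI allI impI)
      show "\<exists>y. y < x" using j by blast
    next
      fix y assume "y < x"
      then have "max y (b j) < x" using j by simp
      then obtain d where "d \<in> ?D" "max y (b j) < d" "d < x"
        using x(2) unfolding limit_of_def by blast
      then show "\<exists>d\<in>D j. y < d \<and> d < x" using j by auto
    qed
    then show ?thesis using D[OF j(1)] x(1) unfolding club_def by blast
  qed
  then show "x \<in> ?D" using x by blast
qed

lemma club_limits:
  assumes I: "initial I" "cof_ge I \<mu>" and \<mu>: "natLeq <o \<mu>" and B: "cofinal_in I B"
  shows "club I {x\<in>I. limit_of B x}" (is "club I ?D")
  unfolding club_def cofinal_in_def
proof (intro conjI ballI impI)
  show "?D \<subseteq> I" by blast
next
  fix x0 assume x0: "x0 \<in> I"
  have step: "\<exists>y\<in>I. x < y \<and> y \<in> B" if "x \<in> I" for x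
    using cofinal_strict[OF I(2) \<mu> B that] B unfolding cofinal_in_def by blast
  obtain s x where s: "s \<in> I" "x 0 = x0" "\<And>k. x k < x (Suc k)" "\<And>k. x (Suc k) \<in> B"
    "\<And>k::nat. x k < s" "\<And>y. y < s \<Longrightarrow> \<exists>k. y < x k"
    by (rule omega_chain[OF I \<mu> step x0]) (assumption, rule that, assumption+)
  have "limit_of B s" using limit_of_chain[of x s B] s by blast
  moreover have "x0 \<le> s" using s(2,5) by (metis less_imp_le)
  ultimately show "\<exists>c\<in>?D. x0 \<le> c" using s(1) by blast
next
  fix x assume x: "x \<in> I" "limit_of ?D x"
  have "limit_of B x" unfolding limit_of_def
  proof (intro conjI allI impI)
    show "\<exists>y. y < x" using x unfolding limit_of_def by blast
  next
    fix y assume "y < x"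
    then obtain d where d: "limit_of B d" "y < d" "d < x" using x(2) unfolding limit_of_def by blast
    then show "\<exists>d\<in>B. y < d \<and> d < x" unfolding limit_of_def by (meson less_trans)
  qed
  then show "x \<in> ?D" using x by blast
qed

lemma club_INT:
  assumes I: "initial I" "cof_ge I \<mu>" and \<mu>: "natLeq <o \<mu>"
    and D: "\<And>j. j \<in> J \<Longrightarrow> club I (D j)" and J: "|J| <o \<mu>"
  shows "club I {x\<in>I. \<forall>j\<in>J. x \<in> D j}"
  unfolding club_def cofinal_in_def
proof (intro conjI ballI impI)
  fix x0 assume x0: "x0 \<in> I"
  have "{j\<in>J. x0 \<le> x} \<subseteq> J" for x by blast
  then have *: "|{j\<in>J. x0 \<le> x}| <o \<mu>" for x using J by (rule card_less_subset)
  obtain x1 where x1: "x1 \<in> I" "x0 < x1" using no_max[OF I(2) \<mu> x0] by blast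
  have "club I {x\<in>I. \<forall>j\<in>J. x0 < x \<longrightarrow> x \<in> D j}" by (rule club_diagonal[OF I \<mu> D *])
  then obtain c where "c \<in> I" "\<forall>j\<in>J. x0 < c \<longrightarrow> c \<in> D j" "x1 \<le> c"
    using x1 unfolding club_def cofinal_in_def by blast
  then show "\<exists>c\<in>{x\<in>I. \<forall>j\<in>J. x \<in> D j}. x0 \<le> c"
    using less_le_trans[OF x1(2) \<open>x1 \<le> c\<close>] by (auto intro: less_imp_le)
next
  fix x assume x: "x \<in> I" "limit_of {x\<in>I. \<forall>j\<in>J. x \<in> D j} x"
  have "limit_of (D j) x" if "j \<in> J" for j by (rule limit_of_mono[OF x(2)]) (use that in blast)
  then show "x \<in> {x\<in>I. \<forall>j\<in>J. x \<in> D j}" using x(1) D unfolding club_def by auto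
qed auto

lemma club_self: "initial I \<Longrightarrow> club I I"
  unfolding club_def cofinal_in_def by auto

lemma club_Int:
  assumes I: "initial I" "cof_ge I \<mu>" and \<mu>: "natLeq <o \<mu>" and "club I C" "club I D"
  shows "club I (C \<inter> D)"
proof -
  have "|{True,False}| <o \<mu>"
    using countable_image_ordLess[OF \<mu>, of "\<lambda>n. n = 0" "{0,1}"]
    by (auto simp: insert_commute)
  then have "club I {x\<in>I. \<forall>j\<in>{True,False}. x \<in> (if j then C else D)}"
    by (intro club_INT[OF I \<mu>]) (use assms in auto)
  moreover have "{x\<in>I. \<forall>j\<in>{True,False}. x \<in> (if j then C else D)} = C \<inter> D"
    using assms(4,5) unfolding club_def cofinal_in_def by auto
  ultimately show ?thesis by simp
qed

lemma stationary_mono: "stationary I S \<Longrightarrow> S \<subseteq> T \<Longrightarrow> T \<subseteq> I \<Longrightarrow> stationary I T"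
  unfolding stationary_def by blast

lemma stationary_Int_club:
  assumes I: "initial I" "cof_ge I \<mu>" and \<mu>: "natLeq <o \<mu>" and "stationary I S" "club I C"
  shows "stationary I (S \<inter> C)"
  unfolding stationary_def
proof (intro conjI allI impI)
  show "S \<inter> C \<subseteq> I" using assms(4) unfolding stationary_def by blast
  fix D assume "club I D"
  then have "club I (C \<inter> D)" by (rule club_Int[OF I \<mu> assms(5)])
  then show "S \<inter> C \<inter> D \<noteq> {}" using assms(4) unfolding stationary_def by (simp add: Int_assoc)
qed

lemma not_stationary: "X \<subseteq> I \<Longrightarrow> \<not> stationary I X \<Longrightarrow> \<exists>D. club I D \<and> X \<inter> D = {}"
  unfolding stationary_def by blast

lemma stationary_meets: "stationary I S \<Longrightarrow> club I C \<Longrightarrow> \<exists>x\<in>S. x \<in> C"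
  unfolding stationary_def by blast

text \<open>
  Completeness of the nonstationary ideal. The cover is given by a relation, so that the index of
  a point need not be chosen beforehand.
\<close>
lemma stationary_UN:
  assumes I: "initial I" "cof_ge I \<mu>" and \<mu>: "natLeq <o \<mu>"
    and S: "stationary I S" and J: "|J| <o \<mu>" and cov: "\<And>x. x \<in> S \<Longrightarrow> \<exists>j\<in>J. R j x"
  shows "\<exists>j\<in>J. stationary I {x\<in>S. R j x}"
proof (rule ccontr)
  assume "\<not> ?thesis"
  moreover have "{x\<in>S. R j x} \<subseteq> I" for j using S unfolding stationary_def by auto
  ultimately have "\<forall>j\<in>J. \<exists>D. club I D \<and> {x\<in>S. R j x} \<inter> D = {}" by (simp add: not_stationary)
  then obtain D where D: "\<And>j. j \<in> J \<Longrightarrow> club I (D j) \<and> {x\<in>S. R j x} \<inter> D j = {}" by metis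
  have "club I {x\<in>I. \<forall>j\<in>J. x \<in> D j}" by (rule club_INT[OF I \<mu> _ J]) (use D in blast)
  from stationary_meets[OF S this] obtain x where "x \<in> S" "\<forall>j\<in>J. x \<in> D j" by auto
  then show False using cov D by blast
qed

text \<open>
  Fodor's lemma, with a bound for the regressive value in place of a constant value. On an ordinal
  that is larger than its cofinality this is the form that holds: the diagonal intersection runs
  over a cofinal set \<open>B\<close> of order type the cofinality, and a value below \<open>x\<close> is below some \<open>b \<in> B\<close>
  with \<open>b < x\<close> once \<open>x\<close> is a limit of \<open>B\<close>.
\<close>
lemma fodor_bounded:
  assumes I: "initial I" "cof_ge I \<mu>" and \<mu>: "natLeq <o \<mu>"
    and B: "cofinal_in I B" "\<And>x. x \<in> I \<Longrightarrow> |B \<inter> {..<x}| <o \<mu>"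
    and S: "stationary I S" and g: "\<And>x. x \<in> S \<Longrightarrow> \<exists>y<x. R y x"
  shows "\<exists>b\<in>I. stationary I {x\<in>S. \<exists>y<b. R y x}"
proof (rule ccontr)
  assume "\<not> ?thesis"
  moreover have "{x\<in>S. \<exists>y<b. R y x} \<subseteq> I" for b using S unfolding stationary_def by auto
  ultimately have "\<forall>b\<in>I. \<exists>D. club I D \<and> {x\<in>S. \<exists>y<b. R y x} \<inter> D = {}"
    by (simp add: not_stationary)
  then obtain D where D: "\<And>b. b \<in> I \<Longrightarrow> club I (D b) \<and> {x\<in>S. \<exists>y<b. R y x} \<inter> D b = {}" by metis
  have BI: "B \<subseteq> I" using B(1) unfolding cofinal_in_def by blast
  have "|{j\<in>B. j \<le> x}| <o \<mu>" if xI: "x \<in> I" for x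
  proof -
    obtain z where z: "z \<in> I" "x < z" using no_max[OF I(2) \<mu> xI] by blast
    then have "{j\<in>B. j \<le> x} \<subseteq> B \<inter> {..<z}" by auto
    then show ?thesis using B(2)[OF z(1)] by (rule card_less_subset)
  qed
  then have "club I {x\<in>I. \<forall>b\<in>B. b < x \<longrightarrow> x \<in> D b}"
    by (intro club_diagonal[OF I \<mu>]) (use D BI in auto)
  then have "club I ({x\<in>I. \<forall>b\<in>B. b < x \<longrightarrow> x \<in> D b} \<inter> {x\<in>I. limit_of B x})"
    by (intro club_Int[OF I \<mu>] club_limits[OF I \<mu> B(1)])
  from stationary_meets[OF S this]
  obtain x where x: "x \<in> S" "\<forall>b\<in>B. b < x \<longrightarrow> x \<in> D b" "limit_of B x" by auto
  obtain y where "y < x" "R y x" using g x(1) by blast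
  then obtain b where "b \<in> B" "y < b" "b < x" using x(3) unfolding limit_of_def by blast
  then show False using D x BI \<open>R y x\<close> by blast
qed

section \<open>Thin cofinal sets, order types and closures\<close>

text \<open>
  Enumerate \<open>X\<close> injectively by \<open>\<rho>\<close> and keep the records, that is, the elements larger than
  everything enumerated before them. The least index of an element above \<open>x\<close> belongs to a record,
  and the records below a record \<open>c\<close> are enumerated before \<open>c\<close>, hence are few.
\<close>
lemma cofinal_records:
  fixes \<rho> :: "'b rel"
  assumes \<rho>: "Card_order \<rho>" and X: "cofinal_in I X" "|X| \<le>o \<rho>"
  shows "\<exists>B\<subseteq>X. cofinal_in I B \<and> (\<forall>x\<in>I. |B \<inter> {..<x}| <o \<rho>)"
proof -
  have wo: "wo_rel \<rho>" using \<rho> card_order_on_well_order_on wo_rel_def by blast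
  have "|X| \<le>o |Field \<rho>|"
    using X(2) card_of_Field_ordIso[OF \<rho>] ordIso_symmetric ordLeq_ordIso_trans by blast
  then obtain h where h: "inj_on h X" "h ` X \<subseteq> Field \<rho>" using card_of_ordLeq[of X "Field \<rho>"] by blast
  define B where "B = {b\<in>X. \<forall>b'\<in>X. (h b', h b) \<in> \<rho> \<and> h b' \<noteq> h b \<longrightarrow> b' < b}"
  have "\<exists>c\<in>B. x \<le> c" if x: "x \<in> I" for x
  proof -
    let ?Y = "h ` {b\<in>X. x \<le> b}"
    have Y: "?Y \<subseteq> Field \<rho>" "?Y \<noteq> {}" using h(2) X(1) x unfolding cofinal_in_def by auto
    obtain b where b: "b \<in> X" "x \<le> b" "h b = wo_rel.minim \<rho> ?Y"
      using wo_rel.minim_in[OF wo Y] by force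
    have "b' < b" if b': "b' \<in> X" "(h b', h b) \<in> \<rho>" "h b' \<noteq> h b" for b'
    proof (rule ccontr)
      assume "\<not> b' < b"
      then have "x \<le> b'" using b(2) by simp
      then have "(h b, h b') \<in> \<rho>"
        using wo_rel.minim_least[OF wo Y(1), of "h b'"] b' b(3) by auto
      then show False using b' wo_rel.ANTISYM[OF wo] unfolding antisym_def by blast
    qed
    then show ?thesis using b(1,2) unfolding B_def by blast
  qed
  moreover have "B \<subseteq> X" unfolding B_def by blast
  moreover have "|B \<inter> {..<x}| <o \<rho>" if x: "x \<in> I" for x
  proof -
    obtain c where c: "c \<in> B" "x \<le> c" using calculation(1)[OF x] by blast
    have "h y \<in> underS \<rho> (h c)" if y: "y \<in> B" "y < x" for y
    proof -
      have "y < c" using y c by (meson less_le_trans)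
      have Xs: "y \<in> X" "c \<in> X" using y c unfolding B_def by auto
      then have ne: "h y \<noteq> h c" using h(1) \<open>y < c\<close> unfolding inj_on_def by blast
      have "\<not> c < y" using \<open>y < c\<close> by simp
      then have "(h c, h y) \<notin> \<rho>" using y(1) Xs ne unfolding B_def by auto
      then have "(h y, h c) \<in> \<rho>" using wo_rel.TOTALS[OF wo] Xs h(2) by blast
      then show ?thesis using ne unfolding underS_def by blast
    qed
    then have "h ` (B \<inter> {..<x}) \<subseteq> underS \<rho> (h c)" by blast
    moreover have "inj_on h (B \<inter> {..<x})"
      using h(1) \<open>B \<subseteq> X\<close> by (meson Int_lower1 inj_on_subset subset_trans)
    ultimately have "|B \<inter> {..<x}| \<le>o |underS \<rho> (h c)|" using card_of_ordLeq by blast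
    moreover have "h c \<in> Field \<rho>" using h(2) c(1) \<open>B \<subseteq> X\<close> by blast
    then have "|underS \<rho> (h c)| <o \<rho>" by (rule card_of_underS[OF \<rho>])
    ultimately show ?thesis by (rule ordLeq_ordLess_trans)
  qed
  ultimately show ?thesis using X(1) unfolding cofinal_in_def by (intro exI[of _ B]) auto
qed

definition le_on :: "'a set \<Rightarrow> 'a rel" where
  "le_on X = {(x, y). x \<in> X \<and> y \<in> X \<and> x \<le> y}"

lemma Field_le_on [simp]: "Field (le_on X) = X"
  unfolding le_on_def Field_def by auto

lemma wf_less: "wf {(x, y). x < y}"
  unfolding wf_def using less_induct by auto

lemma Well_order_le_on: "Well_order (le_on X)"
proof -
  have "wf (le_on X - Id)" by (rule wf_subset[OF wf_less]) (auto simp: le_on_def)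
  moreover have "trans (le_on X)" unfolding trans_def le_on_def by auto
  moreover have "antisym (le_on X)" unfolding antisym_def le_on_def by auto
  moreover have "refl_on X (le_on X)" unfolding refl_on_def le_on_def by auto
  moreover have "total_on X (le_on X)" unfolding total_on_def le_on_def by auto
  moreover have "le_on X \<subseteq> X \<times> X" unfolding le_on_def by auto
  ultimately show ?thesis
    by (simp add: well_order_on_def linear_order_on_def partial_order_on_def preorder_on_def)
qed

lemma underS_le_on: "x \<in> X \<Longrightarrow> underS (le_on X) x = X \<inter> {..<x}"
  unfolding underS_def le_on_def by auto

lemma Restr_le_on: "Restr (le_on X) A = le_on (X \<inter> A)"
  unfolding le_on_def by auto

lemma le_on_initial_ordLess: "x \<in> X \<Longrightarrow> le_on (X \<inter> {..<x}) <o le_on X"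
  using underS_Restr_ordLess[OF Well_order_le_on, of X x] underS_le_on[of x X]
  by (auto simp: Restr_le_on)

lemma ordLess_le_on_iff: "r <o le_on X \<longleftrightarrow> Well_order r \<and> (\<exists>x\<in>X. r =o le_on (X \<inter> {..<x}))"
proof (cases "Well_order r")
  case True
  show ?thesis using ordLess_iff_ordIso_Restr[OF Well_order_le_on True, of X] True
    by (auto simp: underS_le_on Restr_le_on Int_absorb1)
next
  case False
  then show ?thesis unfolding ordLess_def by auto
qed

lemma le_on_less_iff: "le_on {..<y} <o le_on {..<z} \<longleftrightarrow> y < z"
proof -
  have *: "le_on {..<y} <o le_on {..<z}" if "y < z" for y z
  proof -
    have "{..<z} \<inter> {..<y} = {..<y}" using that by auto
    then show ?thesis using le_on_initial_ordLess[of y "{..<z}"] that by simp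
  qed
  have "\<not> le_on {..<y} <o le_on {..<z}" if "\<not> y < z"
  proof (cases "y = z")
    case True then show ?thesis using ordLess_irreflexive by blast
  next
    case False
    then have "z < y" using that by simp
    then show ?thesis using * not_ordLess_ordLeq ordLess_imp_ordLeq by blast
  qed
  then show ?thesis using * by blast
qed

text \<open>
  The order type of \<open>X\<close>, as the point whose set of predecessors is isomorphic to \<open>X\<close>. It exists
  when \<open>X\<close> has smaller cardinality than some initial segment.
\<close>
definition otp :: "'a set \<Rightarrow> 'a" where
  "otp X = (SOME y. le_on X =o le_on {..<y})"

lemma otp:
  assumes "|X| <o |{..<L}|"
  shows "otp X < L" "le_on X =o le_on {..<otp X}"
proof -
  have "le_on X <o le_on {..<L}"
  proof (rule ccontr)
    assume "\<not> ?thesis"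
    then have "le_on {..<L} \<le>o le_on X" using Well_order_le_on not_ordLess_iff_ordLeq by blast
    then have "|{..<L}| \<le>o |X|" using card_of_mono2 by fastforce
    then show False using assms not_ordLess_ordLeq by blast
  qed
  then have "\<exists>y\<in>{..<L}. le_on X =o le_on ({..<L} \<inter> {..<y})" by (simp only: ordLess_le_on_iff)
  then obtain y where y: "y < L" "le_on X =o le_on ({..<L} \<inter> {..<y})" by auto
  moreover have "{..<L} \<inter> {..<y} = {..<y}" using y by auto
  ultimately have "le_on X =o le_on {..<y}" by simp
  then show iso: "le_on X =o le_on {..<otp X}" unfolding otp_def by (rule someI)
  have "le_on {..<otp X} <o le_on {..<L}"
    using iso \<open>le_on X <o le_on {..<L}\<close> ordIso_ordLess_trans ordIso_symmetric by blast
  then show "otp X < L" using le_on_less_iff by blast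
qed

lemma otp_less_iff:
  assumes "|X| <o |{..<L}|" "|Y| <o |{..<L}|"
  shows "otp X < otp Y \<longleftrightarrow> le_on X <o le_on Y"
  using otp(2)[OF assms(1)] otp(2)[OF assms(2)] le_on_less_iff
  by (meson ordIso_ordLess_trans ordIso_symmetric ordLess_ordIso_trans)

lemma otp_mono:
  assumes X: "|X \<inter> {..<y}| <o |{..<L}|" and "x \<in> X" "x < y"
  shows "otp (X \<inter> {..<x}) < otp (X \<inter> {..<y})"
proof -
  have *: "X \<inter> {..<y} \<inter> {..<x} = X \<inter> {..<x}" using assms(3) by auto
  have "|X \<inter> {..<x}| <o |{..<L}|" by (rule card_less_subset[OF _ X]) (use * in blast)
  moreover have "le_on (X \<inter> {..<x}) <o le_on (X \<inter> {..<y})"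
    using le_on_initial_ordLess[of x "X \<inter> {..<y}"] assms(2,3) unfolding * by simp
  ultimately show ?thesis using otp_less_iff[OF _ X] by blast
qed

text \<open>
  The transitive collapse of \<open>X\<close>. The image of \<open>x\<close> depends only on the part of \<open>X\<close> below \<open>x\<close>,
  which is what makes positions in coherent sets agree.
\<close>
lemma otp_bij:
  assumes X: "|X| <o |{..<L}|"
  shows "bij_betw (\<lambda>x. otp (X \<inter> {..<x})) X {..<otp X}"
    and "\<And>x y. x \<in> X \<Longrightarrow> y \<in> X \<Longrightarrow> x < y \<longleftrightarrow> otp (X \<inter> {..<x}) < otp (X \<inter> {..<y})"
proof -
  have small: "|X \<inter> {..<x}| <o |{..<L}|" for x by (rule card_less_subset[OF _ X]) blast
  have mono: "otp (X \<inter> {..<x}) < otp (X \<inter> {..<y})" if "x \<in> X" "x < y" for x y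
    using otp_mono[OF small that] .
  show iff: "x < y \<longleftrightarrow> otp (X \<inter> {..<x}) < otp (X \<inter> {..<y})" if "x \<in> X" "y \<in> X" for x y
    using mono that by (metis less_asym neqE)
  have "inj_on (\<lambda>x. otp (X \<inter> {..<x})) X"
    by (rule inj_onI) (metis iff neqE less_irrefl)
  moreover have "otp (X \<inter> {..<x}) < otp X" if "x \<in> X" for x
    using otp_less_iff[OF small X] le_on_initial_ordLess[OF that] by blast
  moreover have "\<exists>x\<in>X. z = otp (X \<inter> {..<x})" if z: "z < otp X" for z
  proof -
    have "le_on {..<z} <o le_on X"
      using z le_on_less_iff otp(2)[OF X] ordIso_symmetric ordLess_ordIso_trans by blast
    then obtain x where x: "x \<in> X" "le_on {..<z} =o le_on (X \<inter> {..<x})" using ordLess_le_on_iff by blast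
    have "le_on {..<z} =o le_on {..<otp (X \<inter> {..<x})}"
      using x(2) otp(2)[OF small] ordIso_transitive by blast
    then have "z = otp (X \<inter> {..<x})"
      using le_on_less_iff not_ordLess_ordIso ordIso_symmetric by (metis neqE)
    then show ?thesis using x by blast
  qed
  ultimately show "bij_betw (\<lambda>x. otp (X \<inter> {..<x})) X {..<otp X}"
    unfolding bij_betw_def by auto
qed

definition lim_closure :: "'a \<Rightarrow> 'a set \<Rightarrow> 'a set" where
  "lim_closure \<gamma> X = {b. b < \<gamma> \<and> (b \<in> X \<or> limit_of X b)}"

lemma limit_of_closure: "limit_of (lim_closure \<gamma> X) b \<Longrightarrow> limit_of X b"
  unfolding limit_of_def[of "lim_closure \<gamma> X"] limit_of_def[of X b]
proof (elim conjE, intro conjI allI impI)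
  fix y assume *: "\<forall>y<b. \<exists>d\<in>lim_closure \<gamma> X. y < d \<and> d < b" "y < b"
  then obtain d where d: "d \<in> lim_closure \<gamma> X" "y < d" "d < b" by blast
  show "\<exists>d\<in>X. y < d \<and> d < b"
  proof (cases "d \<in> X")
    case False
    then obtain d' where "d' \<in> X" "y < d'" "d' < d"
      using d unfolding lim_closure_def limit_of_def by blast
    then show ?thesis using d(3) less_trans by blast
  qed (use d in blast)
qed

lemma club_lim_closure:
  assumes "cofinal_in {..<\<gamma>} X"
  shows "club {..<\<gamma>} (lim_closure \<gamma> X)"
  unfolding club_def
proof (intro conjI ballI impI)
  show "cofinal_in {..<\<gamma>} (lim_closure \<gamma> X)"
    using assms unfolding cofinal_in_def lim_closure_def by blast
  fix x assume "x \<in> {..<\<gamma>}" "limit_of (lim_closure \<gamma> X) x"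
  then show "x \<in> lim_closure \<gamma> X" using limit_of_closure[of \<gamma> X x] by (simp add: lim_closure_def)
qed

lemma lim_closure_restrict:
  assumes "\<alpha> \<le> \<delta>" "Y = X \<inter> {..<\<alpha>}"
  shows "lim_closure \<alpha> Y = lim_closure \<delta> X \<inter> {..<\<alpha>}"
proof -
  have "limit_of Y b \<longleftrightarrow> limit_of X b" if "b < \<alpha>" for b
    by (rule limit_of_cong) (use that assms(2) in auto)
  moreover have "b < \<delta>" if "b < \<alpha>" for b using that assms(1) by (rule less_le_trans)
  ultimately show ?thesis using assms(2) unfolding lim_closure_def by auto
qed

lemma card_less_insert:
  assumes \<mu>: "Card_order \<mu>" "natLeq <o \<mu>" and X: "|X| <o \<mu>"
  shows "|insert b X| <o \<mu>"
proof -
  have "Cinfinite \<mu>"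
    using cinfinite_mono[OF ordLess_imp_ordLeq[OF \<mu>(2)] natLeq_cinfinite] \<mu>(1) by blast
  then have "|{b} \<union> X| <o \<mu>"
    by (intro Un_Cinfinite_bound_strict singleton_ordLess \<mu> X)
  then show ?thesis by simp
qed

text \<open>
  Sending a point of the closure to the next larger element of \<open>X\<close> is injective, because between
  two points of the closure, the second one possibly included, there is an element of \<open>X\<close>. So
  taking limits does not increase cardinalities.
\<close>
lemma lim_closure_small:
  assumes \<mu>: "Card_order \<mu>" "natLeq <o \<mu>"
    and X: "cofinal_in {..<\<gamma>} X" "\<And>b. b < \<gamma> \<Longrightarrow> |X \<inter> {..<b}| <o \<mu>" and b: "b < \<gamma>"
  shows "|lim_closure \<gamma> X \<inter> {..<b}| <o \<mu>"
proof -
  obtain c where c: "c \<in> X" "b \<le> c" "c < \<gamma>" using X(1) b unfolding cofinal_in_def by blast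
  define h where "h x = (LEAST y. y \<in> X \<and> x < y)" for x
  have h: "h x \<in> X \<and> x < h x" if "x < b" for x
    unfolding h_def by (rule LeastI[of _ c]) (use that c in auto)
  have h_le: "h x \<le> y" if "y \<in> X" "x < y" for x y
    unfolding h_def by (rule Least_le) (use that in auto)
  have lt: "h x < h y" if xy: "x < y" "y < b" "y \<in> lim_closure \<gamma> X" for x y
  proof -
    obtain d where d: "d \<in> X" "x < d" "d \<le> y"
    proof (cases "y \<in> X")
      case False
      then have "limit_of X y" using xy(3) unfolding lim_closure_def by simp
      then obtain d where "d \<in> X" "x < d" "d < y" using xy(1) unfolding limit_of_def by blast
      then show thesis using that less_imp_le by blast
    qed (use xy that in auto)
    have "y < h y" using h[OF xy(2)] by blast
    then show ?thesis using le_less_trans[OF order.trans[OF h_le[OF d(1,2)] d(3)]] by blast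
  qed
  have "inj_on h (lim_closure \<gamma> X \<inter> {..<b})"
  proof (rule inj_onI)
    fix x y assume a: "x \<in> lim_closure \<gamma> X \<inter> {..<b}" "y \<in> lim_closure \<gamma> X \<inter> {..<b}" "h x = h y"
    show "x = y"
    proof (rule ccontr)
      assume "x \<noteq> y"
      then have "x < y \<or> y < x" by auto
      then show False using lt[of x y] lt[of y x] a by auto
    qed
  qed
  moreover have "h ` (lim_closure \<gamma> X \<inter> {..<b}) \<subseteq> insert c (X \<inter> {..<c})"
  proof (rule image_subsetI)
    fix x assume "x \<in> lim_closure \<gamma> X \<inter> {..<b}"
    then have "x < b" by simp
    then have "h x \<le> c" using h_le[OF c(1), of x] c(2) by (meson less_le_trans)
    then show "h x \<in> insert c (X \<inter> {..<c})" using h[OF \<open>x < b\<close>] by auto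
  qed
  ultimately have "|lim_closure \<gamma> X \<inter> {..<b}| \<le>o |insert c (X \<inter> {..<c})|"
    using card_of_ordLeq by blast
  also have "|insert c (X \<inter> {..<c})| <o \<mu>"
    by (rule card_less_insert[OF \<mu> X(2)[OF c(3)]])
  finally show ?thesis .
qed

text \<open>
  A club whose initial segments are small, obtained as the closure of a thin cofinal set. The set
  \<open>a\<close> is used for it whenever it is cofinal; this is how coherent sets are turned into coherent
  ladders.
\<close>
lemma ladder_exists:
  fixes L :: 'a
  assumes \<mu>: "natLeq <o |{..<L}|"
    and \<gamma>: "|{..<\<gamma>}| \<le>o |{..<L}|" and a: "a \<subseteq> {..<\<gamma>}" "|a| <o |{..<L}|"
  shows "\<exists>E. club {..<\<gamma>} E \<and> (\<forall>b<\<gamma>. |E \<inter> {..<b}| <o |{..<L}| ) \<and>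
    (cofinal_in {..<\<gamma>} a \<longrightarrow> E = lim_closure \<gamma> a)"
proof -
  have "\<exists>X. cofinal_in {..<\<gamma>} X \<and> (\<forall>b<\<gamma>. |X \<inter> {..<b}| <o |{..<L}| ) \<and>
    (cofinal_in {..<\<gamma>} a \<longrightarrow> X = a)"
  proof (cases "cofinal_in {..<\<gamma>} a")
    case True
    have "|a \<inter> {..<b}| <o |{..<L}|" for b by (rule card_less_subset[OF _ a(2)]) blast
    then show ?thesis using True by blast
  next
    case False
    have "cofinal_in {..<\<gamma>} {..<\<gamma>}" unfolding cofinal_in_def by auto
    from cofinal_records[OF card_of_Card_order this \<gamma>] False show ?thesis by auto
  qed
  then obtain X where X: "cofinal_in {..<\<gamma>} X" "\<And>b. b < \<gamma> \<Longrightarrow> |X \<inter> {..<b}| <o |{..<L}|"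
    "cofinal_in {..<\<gamma>} a \<Longrightarrow> X = a" by blast
  have "|lim_closure \<gamma> X \<inter> {..<b}| <o |{..<L}|" if "b < \<gamma>" for b
    by (rule lim_closure_small[OF card_of_Card_order \<mu> X(1,2) that])
  moreover have "cofinal_in {..<\<gamma>} a \<longrightarrow> lim_closure \<gamma> X = lim_closure \<gamma> a" using X(3) by simp
  ultimately show ?thesis using club_lim_closure[OF X(1)] by (intro exI[of _ "lim_closure \<gamma> X"]) simp
qed

section \<open>Minimal walks along a ladder system\<close>

text \<open>
  The first step of the minimal walk from \<open>\<gamma>\<close> to \<open>\<beta>\<close>.
\<close>
definition nxt :: "('a \<Rightarrow> 'a set) \<Rightarrow> 'a \<Rightarrow> 'a \<Rightarrow> 'a" where
  "nxt e \<gamma> \<beta> = (LEAST x. x \<in> e \<gamma> \<and> \<beta> \<le> x)"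

text \<open>
  The points reached from \<open>\<gamma>\<close> by a minimal walk of at most \<open>n\<close> steps, \<open>\<gamma>\<close> itself included.
\<close>
primrec walk :: "('a \<Rightarrow> 'a set) \<Rightarrow> nat \<Rightarrow> 'a \<Rightarrow> 'a set" where
  "walk e 0 \<gamma> = {\<gamma>}"
| "walk e (Suc n) \<gamma> = {\<beta>. \<beta> = \<gamma> \<or> \<beta> < \<gamma> \<and> \<beta> \<in> walk e n (nxt e \<gamma> \<beta>)}"

definition is_ladder :: "'a set \<Rightarrow> ('a \<Rightarrow> 'a set) \<Rightarrow> bool" where
  "is_ladder K e \<longleftrightarrow> initial K \<and> (\<forall>\<gamma>\<in>K. club {..<\<gamma>} (e \<gamma>))"

lemma ladder_sub: "is_ladder K e \<Longrightarrow> \<gamma> \<in> K \<Longrightarrow> x \<in> e \<gamma> \<Longrightarrow> x < \<gamma> \<and> x \<in> K"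
  unfolding is_ladder_def club_def cofinal_in_def initial_def by blast

lemma nxt_le: "x \<in> e \<gamma> \<Longrightarrow> \<beta> \<le> x \<Longrightarrow> nxt e \<gamma> \<beta> \<le> x"
  unfolding nxt_def by (rule Least_le) simp

lemma nxt_eqI:
  assumes "x \<in> e \<gamma>" "\<beta> \<le> x" "\<And>y. y \<in> e \<gamma> \<Longrightarrow> \<beta> \<le> y \<Longrightarrow> x \<le> y"
  shows "nxt e \<gamma> \<beta> = x"
  unfolding nxt_def by (rule Least_equality) (use assms in auto)

lemma nxt:
  assumes "is_ladder K e" "\<gamma> \<in> K" "\<beta> < \<gamma>"
  shows "nxt e \<gamma> \<beta> \<in> e \<gamma>" "\<beta> \<le> nxt e \<gamma> \<beta>" "nxt e \<gamma> \<beta> < \<gamma>" "nxt e \<gamma> \<beta> \<in> K"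
proof -
  obtain c where "c \<in> e \<gamma>" "\<beta> \<le> c"
    using assms unfolding is_ladder_def club_def cofinal_in_def by blast
  then have "nxt e \<gamma> \<beta> \<in> e \<gamma> \<and> \<beta> \<le> nxt e \<gamma> \<beta>"
    unfolding nxt_def by (intro LeastI[of "\<lambda>x. x \<in> e \<gamma> \<and> \<beta> \<le> x"] conjI)
  then show "nxt e \<gamma> \<beta> \<in> e \<gamma>" "\<beta> \<le> nxt e \<gamma> \<beta>" "nxt e \<gamma> \<beta> < \<gamma>" "nxt e \<gamma> \<beta> \<in> K"
    using ladder_sub[OF assms(1,2)] by blast+
qed

lemma walk_le: "\<beta> \<in> walk e n \<gamma> \<Longrightarrow> \<beta> \<le> \<gamma>"
  by (cases n) auto

lemma walk_self [simp]: "\<gamma> \<in> walk e n \<gamma>"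
  by (cases n) auto

lemma nxt_eq_of_gap:
  assumes lad: "is_ladder K e" "\<gamma> \<in> K" and "y \<le> x" "x < \<gamma>" and gap: "\<And>z. z \<in> e \<gamma> \<Longrightarrow> y \<le> z \<Longrightarrow> \<not> z < x"
  shows "nxt e \<gamma> y = nxt e \<gamma> x"
proof (rule nxt_eqI)
  show "nxt e \<gamma> x \<in> e \<gamma>" "y \<le> nxt e \<gamma> x" using nxt[OF lad assms(4)] assms(3) by auto
  fix z assume "z \<in> e \<gamma>" "y \<le> z"
  then show "nxt e \<gamma> x \<le> z" using gap nxt_le by (simp add: not_less)
qed

text \<open>
  If \<open>x\<close> is a limit of the ladder at \<open>\<gamma>\<close>, then it belongs to the ladder and one step leads there.
  Otherwise no element of the ladder lies in some interval below \<open>x\<close>; then all walks to points of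
  this interval have the same first step as the walk to \<open>x\<close>, and induction applies.
\<close>
lemma walk_closed:
  assumes lad: "is_ladder K e"
  shows "\<gamma> \<in> K \<Longrightarrow> x \<le> \<gamma> \<Longrightarrow> limit_of (walk e n \<gamma>) x \<Longrightarrow> x \<in> walk e n \<gamma>"
proof (induction n arbitrary: \<gamma>)
  case 0
  then show ?case unfolding limit_of_def by auto
next
  case (Suc n)
  show ?case
  proof (cases "x = \<gamma>")
    case False
    then have x: "x < \<gamma>" using Suc.prems(2) by simp
    note nx = nxt[OF lad Suc.prems(1) x]
    show ?thesis
    proof (cases "limit_of (e \<gamma>) x")
      case True
      then have "x \<in> e \<gamma>" using lad Suc.prems(1) x unfolding is_ladder_def club_def by auto
      then have "nxt e \<gamma> x = x" by (intro nxt_eqI) auto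
      then show ?thesis using x by simp
    next
      case False
      then obtain y where y: "y < x" "\<And>d. d \<in> e \<gamma> \<Longrightarrow> y < d \<Longrightarrow> \<not> d < x"
        using Suc.prems(3) unfolding limit_of_def by blast
      have "limit_of (walk e n (nxt e \<gamma> x)) x"
        unfolding limit_of_def
      proof (intro conjI allI impI)
        show "\<exists>y. y < x" using y by blast
        fix z assume "z < x"
        then have "max y z < x" using y by simp
        then obtain d where d: "d \<in> walk e (Suc n) \<gamma>" "max y z < d" "d < x"
          using Suc.prems(3) unfolding limit_of_def by blast
        have "nxt e \<gamma> d = nxt e \<gamma> x"
          by (rule nxt_eq_of_gap[OF lad Suc.prems(1) _ x]) (use d y in auto)
        then have "d \<in> walk e n (nxt e \<gamma> x)" using d x by auto
        then show "\<exists>d\<in>walk e n (nxt e \<gamma> x). z < d \<and> d < x" using d by auto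
      qed
      then have "x \<in> walk e n (nxt e \<gamma> x)" using Suc.IH nx by blast
      then show ?thesis using x by simp
    qed
  qed simp
qed

text \<open>
  Walks descend, hence terminate.
\<close>
lemma walk_reaches:
  assumes lad: "is_ladder K e"
  shows "\<gamma> \<in> K \<Longrightarrow> \<beta> \<le> \<gamma> \<Longrightarrow> \<exists>n. \<beta> \<in> walk e n \<gamma>"
proof (induction \<gamma> rule: less_induct)
  case (less \<gamma>)
  show ?case
  proof (cases "\<beta> = \<gamma>")
    case False
    then have b: "\<beta> < \<gamma>" using less.prems by simp
    note nx = nxt[OF lad less.prems(1) b]
    obtain n where "\<beta> \<in> walk e n (nxt e \<gamma> \<beta>)" using less.IH[OF nx(3,4,2)] by blast
    then have "\<beta> \<in> walk e (Suc n) \<gamma>" using b by simp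
    then show ?thesis by blast
  qed (use walk_self in blast)
qed

text \<open>
  Fewer than \<open>\<mu>\<close> elements of the ladder at \<open>\<gamma>\<close> lie below \<open>\<beta>\<close>, so they are bounded below \<open>\<beta>\<close>. If
  \<open>\<beta>\<close> is in the ladder, these are the only other points near \<open>\<beta>\<close> that one step can reach; if not,
  all walks to points near \<open>\<beta>\<close> start with the same step, and induction applies to the remaining
  walks. Minimality of the length matters: one more step would spread a whole ladder below \<open>\<beta>\<close>.
\<close>
lemma walk_isolated:
  assumes lad: "is_ladder K e" and small: "\<And>\<gamma> b. \<gamma> \<in> K \<Longrightarrow> b < \<gamma> \<Longrightarrow> |e \<gamma> \<inter> {..<b}| <o \<mu>"
    and \<beta>: "cof_ge {..<\<beta>} \<mu>"
  shows "\<gamma> \<in> K \<Longrightarrow> \<beta> \<in> walk e (Suc n) \<gamma> \<Longrightarrow> \<beta> \<notin> walk e n \<gamma> \<Longrightarrow>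
    \<exists>\<eta><\<beta>. \<forall>x\<in>walk e (Suc n) \<gamma>. \<not> (\<eta> < x \<and> x < \<beta>)"
proof (induction n arbitrary: \<gamma>)
  case (0 \<gamma>)
  then have b: "\<beta> < \<gamma>" "nxt e \<gamma> \<beta> = \<beta>" by auto
  have "|e \<gamma> \<inter> {..<\<beta>}| <o \<mu>" using small 0 b by blast
  then obtain \<eta> where \<eta>: "\<eta> < \<beta>" "\<And>x. x \<in> e \<gamma> \<Longrightarrow> x < \<beta> \<Longrightarrow> x < \<eta>"
    using cof_geD[OF \<beta>, of "e \<gamma> \<inter> {..<\<beta>}"] by auto
  have "\<not> (\<eta> < x \<and> x < \<beta>)" if x: "x \<in> walk e (Suc 0) \<gamma>" for x
  proof
    assume a: "\<eta> < x \<and> x < \<beta>"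
    then have "x < \<gamma>" using b less_trans by blast
    then have "x \<in> e \<gamma>" using x nxt(1)[OF lad 0(1), of x] by auto
    then show False using \<eta>(2) a less_asym by blast
  qed
  then show ?case using \<eta>(1) by blast
next
  case (Suc n \<gamma>)
  then have b: "\<beta> < \<gamma>" "\<beta> \<in> walk e (Suc n) (nxt e \<gamma> \<beta>)" by auto
  have b': "\<beta> \<notin> walk e n (nxt e \<gamma> \<beta>)" using Suc.prems(3) b(1) by simp
  note nx = nxt[OF lad Suc.prems(1) b(1)]
  have "\<beta> \<notin> e \<gamma>"
  proof
    assume "\<beta> \<in> e \<gamma>"
    then have "nxt e \<gamma> \<beta> = \<beta>" by (intro nxt_eqI) auto
    then show False using b' by simp
  qed
  have "|e \<gamma> \<inter> {..<\<beta>}| <o \<mu>" using small Suc.prems(1) b by blast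
  then obtain \<eta> where \<eta>: "\<eta> < \<beta>" "\<And>x. x \<in> e \<gamma> \<Longrightarrow> x < \<beta> \<Longrightarrow> x < \<eta>"
    using cof_geD[OF \<beta>, of "e \<gamma> \<inter> {..<\<beta>}"] by auto
  obtain \<eta>' where \<eta>': "\<eta>' < \<beta>" "\<And>x. x \<in> walk e (Suc n) (nxt e \<gamma> \<beta>) \<Longrightarrow> \<not> (\<eta>' < x \<and> x < \<beta>)"
    using Suc.IH[OF nx(4) b(2) b'] by blast
  have "\<not> (max \<eta> \<eta>' < x \<and> x < \<beta>)" if x: "x \<in> walk e (Suc (Suc n)) \<gamma>" for x
  proof
    assume a: "max \<eta> \<eta>' < x \<and> x < \<beta>"
    then have "x < \<gamma>" using b less_trans by blast
    have "nxt e \<gamma> x = nxt e \<gamma> \<beta>"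
    proof (rule nxt_eq_of_gap[OF lad Suc.prems(1) _ b(1)])
      fix z assume z: "z \<in> e \<gamma>" "x \<le> z"
      show "\<not> z < \<beta>"
      proof
        assume "z < \<beta>"
        then have "z < \<eta>" using \<eta>(2) z(1) by blast
        then show False using z(2) a by auto
      qed
    qed (use a in auto)
    then have "x \<in> walk e (Suc n) (nxt e \<gamma> \<beta>)" using x \<open>x < \<gamma>\<close> by auto
    then show False using \<eta>'(2) a by auto
  qed
  moreover have "max \<eta> \<eta>' < \<beta>" using \<eta>(1) \<eta>'(1) by simp
  ultimately show ?case by blast
qed

lemma walk_coherent:
  assumes lad: "is_ladder K e" and "\<alpha> \<in> K" "\<delta> \<in> K" "\<alpha> < \<delta>"
    and e: "e \<alpha> = e \<delta> \<inter> {..<\<alpha>}" and "\<beta> < \<alpha>"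
  shows "\<beta> \<in> walk e (Suc n) \<alpha> \<longleftrightarrow> \<beta> \<in> walk e (Suc n) \<delta>"
proof -
  note nx = nxt[OF lad assms(2) assms(6)]
  have "nxt e \<delta> \<beta> = nxt e \<alpha> \<beta>"
  proof (rule nxt_eqI)
    fix y assume y: "y \<in> e \<delta>" "\<beta> \<le> y"
    show "nxt e \<alpha> \<beta> \<le> y"
    proof (cases "y < \<alpha>")
      case True
      then show ?thesis using y e by (intro nxt_le) auto
    next
      case False
      then show ?thesis using nx(3) by (meson less_imp_le less_le_trans not_le)
    qed
  qed (use nx e in auto)
  moreover have "\<beta> < \<delta>" using assms(4,6) less_trans by blast
  ultimately show ?thesis using assms(6) by auto
qed

section \<open>The order type of the points reached by short walks\<close>

definition lexless :: "(nat \<Rightarrow> 'a) \<Rightarrow> (nat \<Rightarrow> 'a) \<Rightarrow> bool" where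
  "lexless f g \<longleftrightarrow> (\<exists>m. f m < g m \<and> (\<forall>x>m. f x = g x))"

text \<open>
  The record of a walk of at most \<open>n\<close> steps as an expansion with \<open>2 * n\<close> digits, the first step
  giving the two leading digits. The lower one of them is the position of the step in its ladder.
  The upper one is \<open>u\<close> if the walk has already arrived and \<open>z\<close> otherwise: \<open>\<gamma>\<close> comes after all
  points that are reached from it, and no position in the ladder is left to express this.
\<close>
primrec digit_code :: "('a \<Rightarrow> 'a set) \<Rightarrow> 'a \<Rightarrow> 'a \<Rightarrow> nat \<Rightarrow> 'a \<Rightarrow> 'a \<Rightarrow> nat \<Rightarrow> 'a" where
  "digit_code e z u 0 \<gamma> \<beta> = (\<lambda>_. z)"
| "digit_code e z u (Suc n) \<gamma> \<beta> =
    (if \<beta> = \<gamma> then (\<lambda>_. z)(Suc (2 * n) := u)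
     else (digit_code e z u n (nxt e \<gamma> \<beta>) \<beta>)(2 * n := otp (e \<gamma> \<inter> {..<nxt e \<gamma> \<beta>})))"

lemma digit_code_high: "2 * n \<le> m \<Longrightarrow> digit_code e z u n \<gamma> \<beta> m = z"
  by (induction n arbitrary: \<gamma>) auto

lemma digit_code_range:
  assumes lad: "is_ladder K e" and small: "\<And>\<gamma> b. \<gamma> \<in> K \<Longrightarrow> b < \<gamma> \<Longrightarrow> |e \<gamma> \<inter> {..<b}| <o |{..<L}|"
    and z: "z < L" "u < L"
  shows "\<gamma> \<in> K \<Longrightarrow> \<beta> \<in> walk e n \<gamma> \<Longrightarrow> digit_code e z u n \<gamma> \<beta> m < L"
proof (induction n arbitrary: \<gamma>)
  case (Suc n)
  show ?case
  proof (cases "\<beta> = \<gamma>")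
    case False
    then have b: "\<beta> < \<gamma>" "\<beta> \<in> walk e n (nxt e \<gamma> \<beta>)" using Suc.prems by auto
    note nx = nxt[OF lad Suc.prems(1) b(1)]
    have "otp (e \<gamma> \<inter> {..<nxt e \<gamma> \<beta>}) < L" using otp(1) small[OF Suc.prems(1) nx(3)] by blast
    then show ?thesis using False Suc.IH[OF nx(4) b(2)] by simp
  qed (use z in simp)
qed (use z in simp)

lemma digit_code_mono:
  assumes lad: "is_ladder K e" and small: "\<And>\<gamma> b. \<gamma> \<in> K \<Longrightarrow> b < \<gamma> \<Longrightarrow> |e \<gamma> \<inter> {..<b}| <o |{..<L}|"
    and z: "z < u"
  shows "\<gamma> \<in> K \<Longrightarrow> \<beta> \<in> walk e n \<gamma> \<Longrightarrow> \<beta>' \<in> walk e n \<gamma> \<Longrightarrow> \<beta> < \<beta>' \<Longrightarrow>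
    lexless (digit_code e z u n \<gamma> \<beta>) (digit_code e z u n \<gamma> \<beta>')"
proof (induction n arbitrary: \<gamma>)
  case (Suc n)
  then have "\<beta>' \<le> \<gamma>" using walk_le by blast
  then have b: "\<beta> < \<gamma>" "\<beta> \<in> walk e n (nxt e \<gamma> \<beta>)" using Suc.prems by auto
  note nx = nxt[OF lad Suc.prems(1) b(1)]
  show ?case
  proof (cases "\<beta>' = \<gamma>")
    case True
    then show ?thesis unfolding lexless_def
      by (intro exI[of _ "Suc (2 * n)"]) (use b z in \<open>auto simp: digit_code_high\<close>)
  next
    case False
    then have b': "\<beta>' < \<gamma>" "\<beta>' \<in> walk e n (nxt e \<gamma> \<beta>')" using Suc.prems by auto
    note nx' = nxt[OF lad Suc.prems(1) b'(1)]
    show ?thesis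
    proof (cases "nxt e \<gamma> \<beta> = nxt e \<gamma> \<beta>'")
      case True
      then have "lexless (digit_code e z u n (nxt e \<gamma> \<beta>) \<beta>) (digit_code e z u n (nxt e \<gamma> \<beta>) \<beta>')"
        using Suc.IH[OF nx(4) b(2)] b'(2) Suc.prems(4) by simp
      then obtain m where m: "digit_code e z u n (nxt e \<gamma> \<beta>) \<beta> m < digit_code e z u n (nxt e \<gamma> \<beta>) \<beta>' m"
        "\<forall>x>m. digit_code e z u n (nxt e \<gamma> \<beta>) \<beta> x = digit_code e z u n (nxt e \<gamma> \<beta>) \<beta>' x"
        unfolding lexless_def by blast
      have "m < 2 * n"
      proof (rule ccontr)
        assume "\<not> m < 2 * n"
        then show False using m(1) by (simp add: digit_code_high)
      qed
      then show ?thesis unfolding lexless_def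
        by (intro exI[of _ m]) (use m True b(1) b'(1) in auto)
    next
      case ne: False
      have "nxt e \<gamma> \<beta> \<le> nxt e \<gamma> \<beta>'" using nx' Suc.prems(4) by (intro nxt_le) auto
      then have "nxt e \<gamma> \<beta> < nxt e \<gamma> \<beta>'" using ne by simp
      then have "otp (e \<gamma> \<inter> {..<nxt e \<gamma> \<beta>}) < otp (e \<gamma> \<inter> {..<nxt e \<gamma> \<beta>'})"
        by (intro otp_mono[OF small[OF Suc.prems(1) nx'(3)] nx(1)])
      then show ?thesis unfolding lexless_def
        by (intro exI[of _ "2 * n"]) (use b b' in \<open>auto simp: digit_code_high\<close>)
    qed
  qed
qed simp

lemma digit_code_bound:
  assumes "z < u"
  shows "lexless (digit_code e z u n \<gamma> \<beta>) ((\<lambda>_. z)(2 * n := u))"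
  unfolding lexless_def by (intro exI[of _ "2 * n"]) (use assms in \<open>auto simp: digit_code_high\<close>)

section \<open>Guessing sequences of type omega\<close>

definition omega_seq :: "(nat \<Rightarrow> 'a) \<Rightarrow> 'a \<Rightarrow> bool" where
  "omega_seq x s \<longleftrightarrow> (\<forall>k. x k < x (Suc k)) \<and> (\<forall>k. x k < s) \<and> (\<forall>y<s. \<exists>k. y < x k)"

definition ladder :: "'a \<Rightarrow> nat \<Rightarrow> 'a" where
  "ladder s = (SOME x. omega_seq x s)"

lemma ladder: "omega_seq x s \<Longrightarrow> omega_seq (ladder s) s"
  unfolding ladder_def by (rule someI[of "\<lambda>x. omega_seq x s"])

definition mono_self :: "'a set \<Rightarrow> ('a \<Rightarrow> 'a) \<Rightarrow> bool" where
  "mono_self I F \<longleftrightarrow> (\<forall>x\<in>I. F x \<in> I) \<and> (\<forall>x\<in>I. \<forall>y\<in>I. x \<le> y \<longrightarrow> F x \<le> F y)"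

definition last_below :: "'a set \<Rightarrow> 'a \<Rightarrow> 'a" where
  "last_below D \<gamma> = (LEAST x. \<forall>d\<in>D. d \<le> \<gamma> \<longrightarrow> d \<le> x)"

text \<open>
  The supremum of the elements of \<open>D\<close> up to \<open>\<gamma>\<close> is one of them or a limit of \<open>D\<close>; there are such
  elements because of \<open>b\<close>.
\<close>
lemma last_below:
  assumes I: "initial I" and D: "club I D" "b \<in> D" "\<And>x. b \<le> x" and \<gamma>: "\<gamma> \<in> I"
  shows "last_below D \<gamma> \<in> D" "last_below D \<gamma> \<le> \<gamma>" "\<And>d. d \<in> D \<Longrightarrow> d \<le> \<gamma> \<Longrightarrow> d \<le> last_below D \<gamma>"
proof -
  show le: "last_below D \<gamma> \<le> \<gamma>" unfolding last_below_def by (rule Least_le) simp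
  have ub: "\<forall>d\<in>D. d \<le> \<gamma> \<longrightarrow> d \<le> last_below D \<gamma>"
    unfolding last_below_def by (rule LeastI[of "\<lambda>x. \<forall>d\<in>D. d \<le> \<gamma> \<longrightarrow> d \<le> x" \<gamma>]) simp
  then show "\<And>d. d \<in> D \<Longrightarrow> d \<le> \<gamma> \<Longrightarrow> d \<le> last_below D \<gamma>" by blast
  show "last_below D \<gamma> \<in> D"
  proof (rule ccontr)
    assume n: "last_below D \<gamma> \<notin> D"
    have "limit_of D (last_below D \<gamma>)"
      unfolding limit_of_def
    proof (intro conjI allI impI)
      have "b \<noteq> last_below D \<gamma>" using n D(2) by blast
      then show "\<exists>y. y < last_below D \<gamma>" using D(3)[of "last_below D \<gamma>"] by (intro exI[of _ b]) simp
      fix y assume "y < last_below D \<gamma>"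
      then have "\<not> (\<forall>d\<in>D. d \<le> \<gamma> \<longrightarrow> d \<le> y)" unfolding last_below_def by (rule not_less_Least)
      then obtain d where d: "d \<in> D" "d \<le> \<gamma>" "y < d" by auto
      then have "d \<le> last_below D \<gamma>" "d \<noteq> last_below D \<gamma>" using ub n by auto
      then show "\<exists>d\<in>D. y < d \<and> d < last_below D \<gamma>" using d by (intro bexI[of _ d]) auto
    qed
    then show False using n D(1) initialD[OF I \<gamma> le] unfolding club_def by blast
  qed
qed

lemma card_le_aleph1:
  assumes "\<And>x. x \<in> J \<Longrightarrow> |J \<inter> {..<x}| \<le>o natLeq"
  shows "|J| \<le>o cardSuc natLeq"
proof (rule ccontr)
  assume "\<not> ?thesis"
  then have "cardSuc natLeq <o |J|"
    using card_of_Well_order cardSuc_Well_order[OF natLeq_Card_order] not_ordLeq_iff_ordLess by blast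
  also have "|J| \<le>o le_on J" by (rule card_of_least) (use Well_order_le_on[of J] in simp)
  finally have "\<exists>x\<in>J. cardSuc natLeq =o le_on (J \<inter> {..<x})" by (simp add: ordLess_le_on_iff)
  then obtain x where x: "x \<in> J" "cardSuc natLeq =o le_on (J \<inter> {..<x})" by blast
  have "cardSuc natLeq =o |Field (cardSuc natLeq)|"
    using card_of_Field_ordIso[OF cardSuc_Card_order[OF natLeq_Card_order]] ordIso_symmetric by blast
  also have "|Field (cardSuc natLeq)| =o |Field (le_on (J \<inter> {..<x}))|" by (rule card_of_cong[OF x(2)])
  also have "|Field (le_on (J \<inter> {..<x}))| \<le>o natLeq" using assms[OF x(1)] by simp
  finally have "cardSuc natLeq \<le>o natLeq" .
  then show False using cardSuc_greater[OF natLeq_Card_order] not_ordLeq_ordLess by blast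
qed

text \<open>
  The first point with uncountably many predecessors is a copy of \<open>\<omega>\<^sub>1\<close> inside the well-order; it
  indexes the recursion in the proof of club guessing.
\<close>
lemma omega1_exists:
  assumes I: "cof_ge I \<mu>" and \<mu>: "cardSuc natLeq <o \<mu>"
  shows "\<exists>w. |{..<w}| \<le>o cardSuc natLeq \<and> (\<forall>v<w. |{..<v}| \<le>o natLeq) \<and>
    (\<forall>X\<subseteq>{..<w}. |X| \<le>o natLeq \<longrightarrow> (\<exists>b<w. \<forall>x\<in>X. x < b))"
proof -
  have "\<exists>w. \<not> |{..<w}| \<le>o natLeq"
  proof (rule ccontr)
    assume "\<not> ?thesis"
    then have "|I \<inter> {..<x}| \<le>o natLeq" for x
      using ordLeq_transitive[OF card_of_mono1[of "I \<inter> {..<x}" "{..<x}"]] by blast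
    then have "|I| \<le>o cardSuc natLeq" by (rule card_le_aleph1)
    then have "|I| <o \<mu>" using \<mu> by (rule ordLeq_ordLess_trans)
    then show False using cof_geD[OF I, of I] by blast
  qed
  then obtain w' where w': "\<not> |{..<w'}| \<le>o natLeq" by blast
  define w where "w = (LEAST w. \<not> |{..<w}| \<le>o natLeq)"
  have w: "\<not> |{..<w}| \<le>o natLeq" unfolding w_def by (rule LeastI[of _ w']) (rule w')
  have below: "|{..<v}| \<le>o natLeq" if "v < w" for v
    using not_less_Least[OF that[unfolded w_def]] by blast
  have "|{..<w}| \<le>o cardSuc natLeq"
  proof (rule card_le_aleph1)
    fix x assume "x \<in> {..<w}"
    then have "{..<w} \<inter> {..<x} = {..<x}" by auto
    then show "|{..<w} \<inter> {..<x}| \<le>o natLeq" using below[of x] \<open>x \<in> {..<w}\<close> by simp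
  qed
  moreover have "\<exists>b<w. \<forall>x\<in>X. x < b" if X: "X \<subseteq> {..<w}" "|X| \<le>o natLeq" for X
  proof (rule ccontr)
    assume n: "\<not> ?thesis"
    have "|insert x {..<x}| \<le>o natLeq" if "x \<in> X" for x
    proof -
      have "|{x}| \<le>o natLeq"
        using finite_iff_ordLess_natLeq[of "{x}"] ordLess_imp_ordLeq by blast
      moreover have "|{..<x}| \<le>o natLeq" using below that X(1) by blast
      ultimately have "|{x} \<union> {..<x}| \<le>o natLeq"
        using Un_Cinfinite_bound[OF _ _ natLeq_Cinfinite] by blast
      then show ?thesis by simp
    qed
    then have "|\<Union>x\<in>X. insert x {..<x}| \<le>o natLeq"
      by (intro UNION_Cinfinite_bound[OF X(2) _ natLeq_Cinfinite]) blast
    moreover have "{..<w} \<subseteq> (\<Union>x\<in>X. insert x {..<x})"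
    proof
      fix b assume "b \<in> {..<w}"
      then obtain x where "x \<in> X" "\<not> x < b" using n by auto
      then show "b \<in> (\<Union>x\<in>X. insert x {..<x})" by (auto simp: not_less le_less)
    qed
    ultimately have "|{..<w}| \<le>o natLeq" by (rule ordLeq_transitive[OF card_of_mono1, rotated])
    then show False using w by contradiction
  qed
  ultimately show ?thesis using below by blast
qed

text \<open>
  Shelah's club guessing in cofinality \<open>\<omega>\<close>, on an ordinal of cofinality at least \<open>\<aleph>\<^sub>2\<close>. A club \<open>D\<close>
  turns the ladder of a limit \<open>s\<close> of \<open>D\<close> into a sequence in \<open>D\<close>, by moving each of its points down
  to the last element of \<open>D\<close>. If no club \<open>D\<close> were good enough, every \<open>D\<close> would have a
  counterexample \<open>B D\<close>, and one could shrink \<open>D\<close> to its counterexamples \<open>\<omega>\<^sub>1\<close> times. At a limit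
  \<open>s\<close> of the resulting intersection, each of the countably many points moves down only finitely
  often, so from some countable stage on none of them moves; but then the sequence at that stage
  lies in the next club, hence in the counterexample.
\<close>
lemma exists_guessing_club:
  assumes I: "initial I" "cof_ge I \<mu>" and \<mu>: "cardSuc natLeq <o \<mu>" and b: "b \<in> I" "\<And>x. b \<le> x"
  shows "\<exists>D. club I D \<and> b \<in> D \<and> (\<forall>D'. club I D' \<and> b \<in> D' \<longrightarrow>
    (\<exists>s\<in>I. omega_seq (ladder s) s \<and> limit_of D s \<and> (\<forall>k. last_below D (ladder s k) \<in> D')))"
proof (rule ccontr)
  assume n: "\<not> ?thesis"
  define hit where "hit D D' \<longleftrightarrow> (\<exists>s\<in>I. omega_seq (ladder s) s \<and> limit_of D s \<and>
    (\<forall>k. last_below D (ladder s k) \<in> D'))" for D D'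
  have n': "\<not> (\<exists>D. club I D \<and> b \<in> D \<and> (\<forall>D'. club I D' \<and> b \<in> D' \<longrightarrow> hit D D'))"
    using n unfolding hit_def .
  define B where "B D = (SOME D'. club I D' \<and> b \<in> D' \<and> \<not> hit D D')" for D
  have B: "club I (B D) \<and> b \<in> B D \<and> \<not> hit D (B D)" if D: "club I D" "b \<in> D" for D
  proof -
    have "\<exists>D'. club I D' \<and> b \<in> D' \<and> \<not> hit D D'" using n' D by metis
    then show ?thesis unfolding B_def by (rule someI_ex)
  qed
  have \<mu>0: "natLeq <o \<mu>" using cardSuc_greater[OF natLeq_Card_order] \<mu> by (rule ordLess_transitive)
  obtain w where w: "|{..<w}| \<le>o cardSuc natLeq" "\<And>v. v < w \<Longrightarrow> |{..<v}| \<le>o natLeq"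
    "\<And>X. X \<subseteq> {..<w} \<Longrightarrow> |X| \<le>o natLeq \<Longrightarrow> \<exists>b<w. \<forall>x\<in>X. x < b"
    using omega1_exists[OF I(2) \<mu>] by blast
  have "\<exists>D. \<forall>v. D v = {x\<in>I. \<forall>u<v. x \<in> B (D u)}"
    by (rule dependent_wf_choice[OF wf_less, of "\<lambda>D v r. r = {x\<in>I. \<forall>u<v. x \<in> B (D u)}"]) auto
  then obtain D where D: "\<And>v. D v = {x\<in>I. \<forall>u<v. x \<in> B (D u)}" by blast
  have D_anti: "D v \<subseteq> D u" if "u \<le> v" for u v
    unfolding D[of u] D[of v] using that less_le_trans by blast
  have D_club: "v < w \<Longrightarrow> club I (D v) \<and> b \<in> D v" for v
  proof (induction v rule: less_induct)
    case (less v)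
    have *: "club I (B (D u)) \<and> b \<in> B (D u)" if "u < v" for u
      using B less.IH[OF that] less_trans[OF that less.prems] by blast
    have "club I {x\<in>I. \<forall>u\<in>{..<v}. x \<in> B (D u)}"
      by (rule club_INT[OF I \<mu>0]) (use * ordLeq_ordLess_trans[OF w(2)[OF less.prems] \<mu>0] in auto)
    moreover have "{x\<in>I. \<forall>u\<in>{..<v}. x \<in> B (D u)} = D v" unfolding D[of v] by auto
    ultimately show ?case using * b(1) D[of v] by simp
  qed
  have "club I {x\<in>I. \<forall>v\<in>{..<w}. x \<in> D v}"
    by (rule club_INT[OF I \<mu>0]) (use D_club ordLeq_ordLess_trans[OF w(1) \<mu>] in auto)
  then have Ds: "cofinal_in I {x\<in>I. \<forall>v\<in>{..<w}. x \<in> D v}" unfolding club_def by blast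
  have step: "\<exists>y\<in>I. x < y \<and> (\<forall>v\<in>{..<w}. y \<in> D v)" if "x \<in> I" for x
    using cofinal_strict[OF I(2) \<mu>0 Ds that] by blast
  obtain s x where s: "s \<in> I" "x 0 = b" "\<And>k. x k < x (Suc k)" "\<And>k. \<forall>v\<in>{..<w}. x (Suc k) \<in> D v"
    "\<And>k::nat. x k < s" "\<And>y. y < s \<Longrightarrow> \<exists>k. y < x k"
    by (rule omega_chain[OF I \<mu>0 step b(1)]) (assumption, rule that, assumption+)
  have ls: "omega_seq (ladder s) s" by (rule ladder[of x]) (use s in \<open>auto simp: omega_seq_def\<close>)
  have lk: "ladder s k < s" for k using ls unfolding omega_seq_def by blast
  have lI: "ladder s k \<in> I" for k by (rule initialD[OF I(1) s(1) less_imp_le[OF lk]])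
  \<comment> \<open>The point \<open>s\<close> is a limit of every stage. Along the stages, the image of each point of its
    ladder decreases, hence becomes constant.\<close>
  have lim: "limit_of (D v) s" if "v < w" for v
    by (rule limit_of_chain[of x]) (use s that in auto)
  have "|{} :: 'a set| \<le>o natLeq"
    using finite_iff_ordLess_natLeq[of "{} :: 'a set"] ordLess_imp_ordLeq by blast
  from w(3)[OF empty_subsetI this] obtain v0 where v0: "v0 < w" by blast
  have "\<exists>v<w. \<forall>u. u < w \<longrightarrow> v \<le> u \<longrightarrow> last_below (D u) (ladder s k) = last_below (D v) (ladder s k)" for k
  proof -
    define m where "m = (LEAST z. \<exists>v<w. z = last_below (D v) (ladder s k))"
    have "\<exists>v<w. m = last_below (D v) (ladder s k)"
      unfolding m_def by (rule LeastI_ex) (use v0 in blast)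
    then obtain v where v: "v < w" "m = last_below (D v) (ladder s k)" by blast
    have "last_below (D u) (ladder s k) = m" if u: "u < w" "v \<le> u" for u
    proof (rule order.antisym)
      note pu = last_below[OF I(1) conjunct1[OF D_club[OF u(1)]] conjunct2[OF D_club[OF u(1)]] b(2) lI[of k]]
      note pv = last_below[OF I(1) conjunct1[OF D_club[OF v(1)]] conjunct2[OF D_club[OF v(1)]] b(2) lI[of k]]
      show "last_below (D u) (ladder s k) \<le> m"
        unfolding v(2) by (rule pv(3)) (use pu(1,2) D_anti[OF u(2)] in auto)
      show "m \<le> last_below (D u) (ladder s k)" unfolding m_def by (rule Least_le) (use u in blast)
    qed
    then show ?thesis using v by blast
  qed
  then obtain v where v: "\<And>k. v k < w"
    "\<And>k u. u < w \<Longrightarrow> v k \<le> u \<Longrightarrow> last_below (D u) (ladder s k) = last_below (D (v k)) (ladder s k)" by metis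
  have ctbl: "|range h| \<le>o natLeq" for h :: "nat \<Rightarrow> 'a"
    using card_of_image[of h UNIV] card_of_nat ordLeq_ordIso_trans by blast
  \<comment> \<open>Countably many points become constant before a common stage \<open>v1\<close>, and a later stage \<open>v2\<close> is
    contained in the counterexample for \<open>v1\<close>.\<close>
  obtain v1 where v1: "v1 < w" "\<And>k. v k < v1" using w(3)[of "range v"] ctbl[of v] v(1) by auto
  obtain v2 where v2: "v2 < w" "v1 < v2"
    using w(3)[of "range (\<lambda>_. v1)"] ctbl[of "\<lambda>_. v1"] v1(1) by auto
  have "last_below (D v1) (ladder s k) \<in> B (D v1)" for k
  proof -
    have "last_below (D v1) (ladder s k) = last_below (D v2) (ladder s k)"
      using v(2)[OF v1(1), of k] v(2)[OF v2(1), of k] v1(2)[of k] v2(2) by simp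
    also have "\<dots> \<in> D v2"
      using last_below(1)[OF I(1) conjunct1[OF D_club[OF v2(1)]] conjunct2[OF D_club[OF v2(1)]] b(2) lI] .
    finally show ?thesis using v2(2) unfolding D[of v2] by simp
  qed
  then have "hit (D v1) (B (D v1))" using s(1) ls lim[OF v1(1)] unfolding hit_def by (intro bexI[of _ s]) simp_all
  then show False using B D_club[OF v1(1)] by simp
qed

text \<open>
  Club guessing in the form used later: the clubs are those of closure points of monotone
  functions \<open>F\<close>, and the guessing sequences are thinned out to be strictly increasing.
\<close>
lemma club_guessing_sequences:
  assumes I: "initial I" "cof_ge I \<mu>" and \<mu>: "cardSuc natLeq <o \<mu>"
  shows "\<exists>g :: 'a \<Rightarrow> nat \<Rightarrow> 'a. \<forall>F. mono_self I F \<longrightarrow>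
    (\<exists>\<epsilon>\<in>I. \<forall>k. g \<epsilon> k \<in> I \<and> F (g \<epsilon> k) \<le> g \<epsilon> (Suc k))"
proof -
  have \<mu>0: "natLeq <o \<mu>" using cardSuc_greater[OF natLeq_Card_order] \<mu> by (rule ordLess_transitive)
  obtain b0 where "b0 \<in> I" using cof_geD[OF I(2), of "{}"] countable_image_ordLess[OF \<mu>0, of "\<lambda>_. undefined" "{}"] by auto
  define b where "b = (LEAST x::'a. True)"
  have b_le: "b \<le> x" for x unfolding b_def by (rule Least_le) simp
  have bI: "b \<in> I" using initialD[OF I(1) \<open>b0 \<in> I\<close> b_le] .
  obtain D where D: "club I D" "b \<in> D" and guess: "\<And>D'. club I D' \<Longrightarrow> b \<in> D' \<Longrightarrow>
    \<exists>s\<in>I. omega_seq (ladder s) s \<and> limit_of D s \<and> (\<forall>k. last_below D (ladder s k) \<in> D')"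
    using exists_guessing_club[OF I \<mu> bI b_le] by blast
  define good where "good s \<longleftrightarrow> s \<in> I \<and> omega_seq (ladder s) s \<and> limit_of D s" for s
  have "\<exists>x. \<forall>k. x k \<in> range (\<lambda>k. last_below D (ladder s k)) \<and> x k < x (Suc k)" if s: "good s" for s
  proof -
    let ?R = "range (\<lambda>k. last_below D (ladder s k))"
    have sI: "s \<in> I" and ls: "omega_seq (ladder s) s" and lim: "limit_of D s"
      using s unfolding good_def by auto
    have lk: "ladder s k < s" for k using ls unfolding omega_seq_def by blast
    have lI: "ladder s k \<in> I" for k by (rule initialD[OF I(1) sI less_imp_le[OF lk]])
    have ex: "\<exists>z\<in>?R. y < z" if ys: "y < s" for y
    proof -
      obtain d where d: "d \<in> D" "y < d" "d < s" using lim ys unfolding limit_of_def by blast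
      obtain k where "d < ladder s k" using ls d(3) unfolding omega_seq_def by blast
      then have "d \<le> last_below D (ladder s k)" using last_below(3)[OF I(1) D b_le lI[of k] d(1)] by simp
      then show ?thesis using d(2) less_le_trans by blast
    qed
    have Rs: "z < s" if "z \<in> ?R" for z
      using that last_below(2)[OF I(1) D b_le lI] lk le_less_trans by blast
    have "\<exists>x. \<forall>n::nat. x n \<in> ?R \<and> x n < x (Suc n)"
    proof (rule dependent_nat_choice)
      show "\<exists>x. x \<in> ?R" by blast
      fix x assume "x \<in> ?R"
      then show "\<exists>y. y \<in> ?R \<and> x < y" using ex Rs by blast
    qed
    then show ?thesis .
  qed
  then obtain g where g: "\<And>s k. good s \<Longrightarrow> g s k \<in> range (\<lambda>k. last_below D (ladder s k))"
    "\<And>s k. good s \<Longrightarrow> g s k < g s (Suc k)" by metis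
  have "\<exists>\<epsilon>\<in>I. \<forall>k. g \<epsilon> k \<in> I \<and> F (g \<epsilon> k) \<le> g \<epsilon> (Suc k)" if F: "mono_self I F" for F
  proof -
    define DF where "DF = {x\<in>I. \<forall>y<x. F y < x}"
    have "club I DF"
      unfolding club_def cofinal_in_def
    proof (intro conjI ballI impI)
      show "DF \<subseteq> I" unfolding DF_def by blast
      fix x0 assume x0: "x0 \<in> I"
      have step: "\<exists>y\<in>I. x < y \<and> F x < y" if "x \<in> I" for x
      proof -
        have "F x \<in> I" using F that unfolding mono_self_def by blast
        then have "max x (F x) \<in> I" using that by (simp add: max_def)
        then obtain y where "y \<in> I" "max x (F x) < y" using no_max[OF I(2) \<mu>0] by blast
        then show ?thesis by auto
      qed
      obtain s x where s: "s \<in> I" "x 0 = x0" "\<And>k. x k < x (Suc k)" "\<And>k. F (x k) < x (Suc k)"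
        "\<And>k::nat. x k < s" "\<And>y. y < s \<Longrightarrow> \<exists>k. y < x k"
        by (rule omega_chain[OF I \<mu>0 step x0]) (assumption, rule that, assumption+)
      have "F y < s" if "y < s" for y
      proof -
        obtain k where k: "y < x k" using s(6) \<open>y < s\<close> by blast
        have "x k \<in> I" "y \<in> I"
          using initialD[OF I(1) s(1) less_imp_le[OF s(5)]] initialD[OF I(1) s(1) less_imp_le[OF that]] by auto
        then have "F y \<le> F (x k)" using F k unfolding mono_self_def by simp
        then show ?thesis using s(4)[of k] s(5)[of "Suc k"] by (meson le_less_trans less_trans)
      qed
      then have "s \<in> DF" using s(1) unfolding DF_def by blast
      then show "\<exists>c\<in>DF. x0 \<le> c" using s(2) s(5)[of 0] by (intro bexI[of _ s]) auto
    next
      fix x assume x: "x \<in> I" "limit_of DF x"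
      have "F y < x" if yx: "y < x" for y
      proof -
        obtain d where d: "d \<in> DF" "y < d" "d < x" using x(2) yx unfolding limit_of_def by blast
        then have "F y < d" unfolding DF_def by blast
        then show ?thesis using d(3) by (rule less_trans)
      qed
      then show "x \<in> DF" using x(1) unfolding DF_def by blast
    qed
    moreover have "b \<in> DF" using bI b_le unfolding DF_def by (auto simp: not_less[symmetric])
    ultimately obtain s where s: "good s" "\<And>k. last_below D (ladder s k) \<in> DF"
      using guess unfolding good_def by blast
    have gDF: "g s k \<in> DF" for k using g(1)[OF s(1), of k] s(2) by auto
    have "F (g s k) < g s (Suc k)" for k using gDF[of "Suc k"] g(2)[OF s(1), of k] unfolding DF_def by blast
    then have "g s k \<in> I \<and> F (g s k) \<le> g s (Suc k)" for k
      using gDF[of k] unfolding DF_def by (simp add: less_imp_le)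
    then show ?thesis using s(1) unfolding good_def by blast
  qed
  then show ?thesis by blast
qed

text \<open>
  Closing off under \<open>G\<close> gives \<open>\<epsilon> < \<delta>\<close> of cofinality \<open>\<omega>\<close> that is closed under \<open>G\<close>. The ladder at
  \<open>\<epsilon>\<close> then has a subsequence along which \<open>G\<close> does not overtake the next point. There are as many
  subsequences to consider as functions on the natural numbers.
\<close>
lemma ladder_subsequence_guess:
  assumes \<delta>: "cof_ge {..<\<delta>} \<kappa>" "natLeq <o \<kappa>" and G: "mono_self {..<\<delta>} G"
  shows "\<exists>\<epsilon><\<delta>. \<exists>h::nat\<Rightarrow>nat. \<forall>k. ladder \<epsilon> (h k) < \<delta> \<and> G (ladder \<epsilon> (h k)) \<le> ladder \<epsilon> (h (Suc k))"
proof -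
  obtain x0 where x0: "x0 \<in> {..<\<delta>}"
    using cof_geD[OF \<delta>(1), of "{}"] countable_image_ordLess[OF \<delta>(2), of "\<lambda>_. undefined" "{}"] by auto
  have step: "\<exists>y\<in>{..<\<delta>}. x < y \<and> G x \<le> y" if "x \<in> {..<\<delta>}" for x
  proof -
    have "G x \<in> {..<\<delta>}" using G that unfolding mono_self_def by blast
    then have "max x (G x) \<in> {..<\<delta>}" using that by (simp add: max_def)
    then obtain y where "y \<in> {..<\<delta>}" "max x (G x) < y" using no_max[OF \<delta>] by blast
    then show ?thesis by (auto intro: less_imp_le)
  qed
  obtain s x where s: "s \<in> {..<\<delta>}" "x 0 = x0" "\<And>k. x k < x (Suc k)" "\<And>k. G (x k) \<le> x (Suc k)"
    "\<And>k::nat. x k < s" "\<And>y. y < s \<Longrightarrow> \<exists>k. y < x k"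
    by (rule omega_chain[OF initial_lessThan \<delta> step x0]) (assumption, rule that, assumption+)
  have ls: "omega_seq (ladder s) s" by (rule ladder[of x]) (use s in \<open>auto simp: omega_seq_def\<close>)
  have lk: "ladder s m < s" for m using ls unfolding omega_seq_def by blast
  have "\<exists>m'. G (ladder s m) \<le> ladder s m'" for m
  proof -
    obtain k where k: "ladder s m < x k" using s(6)[OF lk[of m]] by blast
    have "ladder s m < \<delta>" "x k < \<delta>" using lk[of m] s(5)[of k] s(1) less_trans by auto
    then have "G (ladder s m) \<le> G (x k)" using G k unfolding mono_self_def by simp
    then have 1: "G (ladder s m) \<le> x (Suc k)" using s(4) order.trans by blast
    obtain m' where "x (Suc k) < ladder s m'" using ls s(5) unfolding omega_seq_def by blast
    then have "G (ladder s m) \<le> ladder s m'" using 1 by simp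
    then show ?thesis by blast
  qed
  then obtain nx where nx: "\<And>m. G (ladder s m) \<le> ladder s (nx m)" by metis
  have "ladder s m < \<delta>" for m using lk[of m] s(1) less_trans by auto
  then show ?thesis using s(1) nx
    by (intro exI[of _ s] conjI exI[of _ "\<lambda>k. (nx ^^ k) 0"]) auto
qed

text \<open>
  Guessing for all \<open>\<delta>\<close> at once with few sequences at each point. The collapse of \<open>a \<delta>\<close> has an
  order type \<open>\<eta> < L\<close>, and the family of sequences that guesses on \<open>\<eta>\<close> is fixed once for every \<open>\<eta>\<close>.
  A good sequence for \<open>\<delta>\<close>, pulled back from \<open>\<eta>\<close>, is bounded by some \<open>\<epsilon> \<in> C\<close>; because \<open>a \<epsilon>\<close> is an
  initial segment of \<open>a \<delta>\<close>, it can be decoded from \<open>\<epsilon>\<close>, the type \<open>\<eta>\<close> and the index \<open>\<epsilon>'\<close> of the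
  sequence in the family.
\<close>
lemma coherent_position_guess:
  fixes a :: "'a \<Rightarrow> 'a set"
  assumes \<kappa>: "cardSuc natLeq <o \<kappa>"
  shows "\<exists>P :: 'a \<Rightarrow> 'a \<times> 'a \<Rightarrow> nat \<Rightarrow> 'a. \<forall>\<delta> C G. cof_ge {..<\<delta>} \<kappa> \<longrightarrow> |a \<delta>| <o |{..<L}| \<longrightarrow>
    cofinal_in {..<\<delta>} (a \<delta>) \<longrightarrow> cofinal_in {..<\<delta>} C \<longrightarrow> (\<forall>\<alpha>\<in>C. a \<alpha> = a \<delta> \<inter> {..<\<alpha>}) \<longrightarrow>
    mono_self {..<\<delta>} G \<longrightarrow>
    (\<exists>\<epsilon><\<delta>. \<exists>j\<in>{..<L}\<times>{..<L}. \<forall>k. P \<epsilon> j k < \<delta> \<and> G (P \<epsilon> j k) \<le> P \<epsilon> j (Suc k))"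
proof -
  have \<kappa>0: "natLeq <o \<kappa>" using cardSuc_greater[OF natLeq_Card_order] \<kappa> by (rule ordLess_transitive)
  have "\<forall>\<eta>. \<exists>g :: 'a \<Rightarrow> nat \<Rightarrow> 'a. cof_ge {..<\<eta>} \<kappa> \<longrightarrow> (\<forall>F. mono_self {..<\<eta>} F \<longrightarrow>
    (\<exists>\<epsilon>\<in>{..<\<eta>}. \<forall>k. g \<epsilon> k \<in> {..<\<eta>} \<and> F (g \<epsilon> k) \<le> g \<epsilon> (Suc k)))"
    using club_guessing_sequences[OF initial_lessThan _ \<kappa>] by blast
  then obtain g :: "'a \<Rightarrow> 'a \<Rightarrow> nat \<Rightarrow> 'a" where g: "\<And>\<eta> F. cof_ge {..<\<eta>} \<kappa> \<Longrightarrow> mono_self {..<\<eta>} F \<Longrightarrow>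
    \<exists>\<epsilon>\<in>{..<\<eta>}. \<forall>k. g \<eta> \<epsilon> k \<in> {..<\<eta>} \<and> F (g \<eta> \<epsilon> k) \<le> g \<eta> \<epsilon> (Suc k)" by metis
  define P where "P \<epsilon> j k = (THE x. x \<in> a \<epsilon> \<and> otp (a \<epsilon> \<inter> {..<x}) = g (fst j) (snd j) k)" for \<epsilon> j k
  have main: "\<exists>\<epsilon><\<delta>. \<exists>j\<in>{..<L}\<times>{..<L}. \<forall>k. P \<epsilon> j k < \<delta> \<and> G (P \<epsilon> j k) \<le> P \<epsilon> j (Suc k)"
    if \<delta>: "cof_ge {..<\<delta>} \<kappa>" and a: "|a \<delta>| <o |{..<L}|" "cofinal_in {..<\<delta>} (a \<delta>)"
      and C: "cofinal_in {..<\<delta>} C" "\<And>\<alpha>. \<alpha> \<in> C \<Longrightarrow> a \<alpha> = a \<delta> \<inter> {..<\<alpha>}"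
      and G: "mono_self {..<\<delta>} G" for \<delta> C G
  proof -
    \<comment> \<open>Below, \<open>p\<close> is the collapse of \<open>a \<delta>\<close> onto \<open>\<eta>\<close>, \<open>q\<close> its inverse, and \<open>F\<close> is \<open>G\<close> transported to \<open>\<eta>\<close>
      after rounding up its values to elements of \<open>a \<delta>\<close>.\<close>
    define \<eta> where "\<eta> = otp (a \<delta>)"
    define p where "p x = otp (a \<delta> \<inter> {..<x})" for x
    have \<eta>: "\<eta> < L" unfolding \<eta>_def by (rule otp(1)[OF a(1)])
    have p: "bij_betw p (a \<delta>) {..<\<eta>}" unfolding p_def \<eta>_def by (rule otp_bij(1)[OF a(1)])
    have p_iff: "p x < p y \<longleftrightarrow> x < y" if "x \<in> a \<delta>" "y \<in> a \<delta>" for x y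
      unfolding p_def using otp_bij(2)[OF a(1) that] by blast
    have p_le: "p x \<le> p y \<longleftrightarrow> x \<le> y" if "x \<in> a \<delta>" "y \<in> a \<delta>" for x y
      using p_iff[OF that(2,1)] by (meson not_less)
    define q where "q = inv_into (a \<delta>) p"
    have q: "q z \<in> a \<delta>" "p (q z) = z" if "z < \<eta>" for z
      using that p unfolding q_def bij_betw_def by (auto intro: inv_into_into f_inv_into_f)
    have a_sub: "x < \<delta>" if "x \<in> a \<delta>" for x using a(2) that unfolding cofinal_in_def by auto
    have p_less: "p x < \<eta>" if "x \<in> a \<delta>" for x using p that unfolding bij_betw_def by auto
    have \<eta>cof: "cof_ge {..<\<eta>} \<kappa>"
      unfolding cof_ge_def
    proof (intro allI impI, elim conjE)
      fix X assume X: "X \<subseteq> {..<\<eta>}" "|X| <o \<kappa>"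
      have "q ` X \<subseteq> {..<\<delta>}" using X(1) q(1) a_sub by auto
      then obtain b where b: "b < \<delta>" "\<And>x. x \<in> X \<Longrightarrow> q x < b"
        using cof_geD[OF \<delta> _ card_less_image[OF X(2)], of q] by auto
      obtain b' where b': "b' \<in> a \<delta>" "b \<le> b'" using a(2) b(1) unfolding cofinal_in_def by auto
      have "x < p b'" if "x \<in> X" for x
      proof -
        have x: "x < \<eta>" using X(1) that by auto
        have "q x < b'" using b(2)[OF that] b'(2) by (rule less_le_trans)
        then show ?thesis using p_iff[OF q(1)[OF x] b'(1)] q(2)[OF x] by simp
      qed
      then show "\<exists>b\<in>{..<\<eta>}. \<forall>x\<in>X. x < b" using p_less[OF b'(1)] by auto
    qed
    define m where "m y = (LEAST x. x \<in> a \<delta> \<and> y \<le> x)" for y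
    have m: "m y \<in> a \<delta>" "y \<le> m y" if y: "y < \<delta>" for y
    proof -
      obtain c where "c \<in> a \<delta>" "y \<le> c" using a(2) y unfolding cofinal_in_def by auto
      then have "m y \<in> a \<delta> \<and> y \<le> m y" unfolding m_def
        by (intro LeastI[of "\<lambda>x. x \<in> a \<delta> \<and> y \<le> x"] conjI)
      then show "m y \<in> a \<delta>" "y \<le> m y" by auto
    qed
    have m_le: "m y \<le> x" if "x \<in> a \<delta>" "y \<le> x" for x y
      unfolding m_def by (rule Least_le) (use that in simp)
    have Gq: "G (q z) < \<delta>" if "z < \<eta>" for z
      using G a_sub[OF q(1)[OF that]] unfolding mono_self_def by auto
    define F where "F z = p (m (G (q z)))" for z
    have "mono_self {..<\<eta>} F"
      unfolding mono_self_def
    proof (intro conjI ballI impI)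
      fix x assume "x \<in> {..<\<eta>}"
      then show "F x \<in> {..<\<eta>}" unfolding F_def using p_less[OF m(1)[OF Gq]] by auto
    next
      fix x y assume xy: "x \<in> {..<\<eta>}" "y \<in> {..<\<eta>}" "x \<le> y"
      then have l: "x < \<eta>" "y < \<eta>" by auto
      have "q x \<le> q y" using p_le[OF q(1)[OF l(1)] q(1)[OF l(2)]] q(2) l xy(3) by simp
      then have "G (q x) \<le> G (q y)"
        using G a_sub[OF q(1)[OF l(1)]] a_sub[OF q(1)[OF l(2)]] unfolding mono_self_def by simp
      then have "m (G (q x)) \<le> m (G (q y))"
        using m[OF Gq[OF l(2)]] by (intro m_le) auto
      then show "F x \<le> F y" unfolding F_def
        using p_le[OF m(1)[OF Gq[OF l(1)]] m(1)[OF Gq[OF l(2)]]] by simp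
    qed
    from g[OF \<eta>cof this] obtain \<epsilon>' where \<epsilon>': "\<epsilon>' < \<eta>" "\<And>k. g \<eta> \<epsilon>' k < \<eta>"
      "\<And>k. F (g \<eta> \<epsilon>' k) \<le> g \<eta> \<epsilon>' (Suc k)" by auto
    define c where "c k = q (g \<eta> \<epsilon>' k)" for k
    have c: "c k \<in> a \<delta>" "p (c k) = g \<eta> \<epsilon>' k" for k unfolding c_def using q \<epsilon>'(2) by auto
    have Gc: "G (c k) \<le> c (Suc k)" for k
    proof -
      have "p (m (G (c k))) \<le> p (c (Suc k))"
        using \<epsilon>'(3)[of k] unfolding F_def c(2) by (simp add: c_def)
      moreover have l: "G (c k) < \<delta>" unfolding c_def by (rule Gq[OF \<epsilon>'(2)])
      ultimately have "m (G (c k)) \<le> c (Suc k)" using p_le[OF m(1)[OF l] c(1)] by blast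
      then show ?thesis using m(2)[OF l] by simp
    qed
    have "range c \<subseteq> {..<\<delta>}" using c(1) a_sub by auto
    then obtain b where b: "b < \<delta>" "\<And>k. c k < b"
      using cof_geD[OF \<delta> _ countable_image_ordLess[OF \<kappa>0, of c UNIV]] by auto
    have "\<exists>\<epsilon>\<in>C. b \<le> \<epsilon>" and "C \<subseteq> {..<\<delta>}" using C(1) b(1) unfolding cofinal_in_def by auto
    then obtain \<epsilon> where \<epsilon>: "\<epsilon> \<in> C" "b \<le> \<epsilon>" "\<epsilon> < \<delta>" by blast
    have a\<epsilon>: "a \<epsilon> = a \<delta> \<inter> {..<\<epsilon>}" by (rule C(2)[OF \<epsilon>(1)])
    have c\<epsilon>: "c k < \<epsilon>" for k using b(2) \<epsilon>(2) by (rule less_le_trans)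
    have otp\<epsilon>: "otp (a \<epsilon> \<inter> {..<x}) = p x" if "x < \<epsilon>" for x
    proof -
      have "a \<epsilon> \<inter> {..<x} = a \<delta> \<inter> {..<x}" unfolding a\<epsilon> using that by auto
      then show ?thesis unfolding p_def by simp
    qed
    have Pc: "P \<epsilon> (\<eta>, \<epsilon>') k = c k" for k
      unfolding P_def
    proof (rule the_equality)
      show "c k \<in> a \<epsilon> \<and> otp (a \<epsilon> \<inter> {..<c k}) = g (fst (\<eta>, \<epsilon>')) (snd (\<eta>, \<epsilon>')) k"
        using c[of k] c\<epsilon>[of k] otp\<epsilon>[OF c\<epsilon>[of k]] unfolding a\<epsilon> by simp
      fix x assume x: "x \<in> a \<epsilon> \<and> otp (a \<epsilon> \<inter> {..<x}) = g (fst (\<eta>, \<epsilon>')) (snd (\<eta>, \<epsilon>')) k"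
      then have "x < \<epsilon>" "x \<in> a \<delta>" unfolding a\<epsilon> by auto
      moreover from x have "p x = p (c k)" using otp\<epsilon>[OF \<open>x < \<epsilon>\<close>] c(2) by simp
      ultimately show "x = c k" using p c(1) unfolding bij_betw_def inj_on_def by blast
    qed
    have "\<epsilon>' < L" using \<epsilon>'(1) \<eta> by (rule less_trans)
    have "\<forall>k. P \<epsilon> (\<eta>, \<epsilon>') k < \<delta> \<and> G (P \<epsilon> (\<eta>, \<epsilon>') k) \<le> P \<epsilon> (\<eta>, \<epsilon>') (Suc k)"
      unfolding Pc using Gc c(1) a_sub by blast
    moreover have "(\<eta>, \<epsilon>') \<in> {..<L} \<times> {..<L}" using \<eta> \<open>\<epsilon>' < L\<close> by simp
    ultimately show ?thesis using \<epsilon>(3) by blast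
  qed
  show ?thesis
    by (intro exI[of _ P] allI impI) (rule main; (assumption | erule bspec, assumption))
qed

section \<open>Colouring a reflecting stationary set uniformly\<close>

lemma limit_ex: "limit_of C x \<Longrightarrow> y < x \<Longrightarrow> \<exists>d\<in>C. y < d \<and> d < x"
  unfolding limit_of_def by blast

lemma club_above:
  assumes "cof_ge I \<mu>" "natLeq <o \<mu>" "initial I" "g \<in> I"
  shows "club I {x\<in>I. g < x}"
  unfolding club_def cofinal_in_def
proof (intro conjI ballI impI)
  fix x assume "x \<in> I"
  then have "max x g \<in> I" using assms(4) by (simp add: max_def)
  then obtain y where "y \<in> I" "max x g < y" using no_max[OF assms(1,2)] by blast
  then show "\<exists>c\<in>{x\<in>I. g < x}. x \<le> c" by (intro bexI[of _ y]) auto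
next
  fix x assume x: "x \<in> I" "limit_of {x\<in>I. g < x} x"
  then obtain y where "y < x" unfolding limit_of_def by blast
  from limit_ex[OF x(2) this] obtain d where "g < d" "d < x" by blast
  then have "g < x" by (rule less_trans)
  then show "x \<in> {x\<in>I. g < x}" using x(1) by blast
qed blast

text \<open>
  For some \<open>\<zeta>\<close> the map taking \<open>\<alpha>\<close> to \<open>c \<alpha> \<zeta>\<close> is unbounded on stationary sets: otherwise, there
  being fewer than \<open>\<mu>\<close> many \<open>\<zeta>\<close>, a single bound would hold for all \<open>\<zeta>\<close> and all \<open>\<alpha>\<close> in the
  intersection of \<open>S\<close> with a club, contrary to cofinality of \<open>c \<alpha>\<close>. This map is regressive, so
  Fodor's lemma bounds it on stationary subsets. The least bound \<open>G x\<close> above a given \<open>x\<close> is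
  monotone in \<open>x\<close>.
\<close>
lemma stationary_interval_map:
  assumes I: "initial I" "cof_ge I \<mu>" and \<mu>: "natLeq <o \<mu>"
    and B: "cofinal_in I B" "\<And>x. x \<in> I \<Longrightarrow> |B \<inter> {..<x}| <o \<mu>"
    and S: "stationary I S" and Z: "|Z| <o \<mu>"
    and c: "\<And>\<alpha> \<zeta>. \<alpha> \<in> S \<Longrightarrow> \<zeta> \<in> Z \<Longrightarrow> c \<alpha> \<zeta> < \<alpha>"
    and cof: "\<And>\<alpha> x. \<alpha> \<in> S \<Longrightarrow> x < \<alpha> \<Longrightarrow> \<exists>\<zeta>\<in>Z. x \<le> c \<alpha> \<zeta>"
  shows "\<exists>\<zeta>\<in>Z. \<exists>G. mono_self I G \<and> (\<forall>x\<in>I. stationary I {\<alpha>\<in>S. x \<le> c \<alpha> \<zeta> \<and> c \<alpha> \<zeta> < G x})"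
proof -
  have SI: "S \<subseteq> I" using S unfolding stationary_def by blast
  have "\<exists>\<zeta>\<in>Z. \<forall>x\<in>I. stationary I {\<alpha>\<in>S. x \<le> c \<alpha> \<zeta>}"
  proof (rule ccontr)
    assume "\<not> ?thesis"
    then have "\<forall>\<zeta>. \<exists>x. \<zeta> \<in> Z \<longrightarrow> x \<in> I \<and> \<not> stationary I {\<alpha>\<in>S. x \<le> c \<alpha> \<zeta>}" by blast
    then obtain g where g: "\<And>\<zeta>. \<zeta> \<in> Z \<Longrightarrow> g \<zeta> \<in> I \<and> \<not> stationary I {\<alpha>\<in>S. g \<zeta> \<le> c \<alpha> \<zeta>}" by metis
    then have "g ` Z \<subseteq> I" by blast
    from cof_geD[OF I(2) this card_less_image[OF Z]]
    obtain b where b: "b \<in> I" "\<And>\<zeta>. \<zeta> \<in> Z \<Longrightarrow> g \<zeta> < b" by blast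
    have "stationary I (S \<inter> {x\<in>I. b < x})"
      by (rule stationary_Int_club[OF I \<mu> S club_above[OF I(2) \<mu> I(1) b(1)]])
    moreover have "\<exists>\<zeta>\<in>Z. b \<le> c \<alpha> \<zeta>" if "\<alpha> \<in> S \<inter> {x\<in>I. b < x}" for \<alpha>
      using cof[of \<alpha> b] that by blast
    ultimately obtain \<zeta> where \<zeta>: "\<zeta> \<in> Z" "stationary I {\<alpha>\<in>S \<inter> {x\<in>I. b < x}. b \<le> c \<alpha> \<zeta>}"
      using stationary_UN[OF I \<mu> _ Z, of _ "\<lambda>\<zeta> \<alpha>. b \<le> c \<alpha> \<zeta>"] by blast
    have "g \<zeta> \<le> b" using b(2)[OF \<zeta>(1)] by simp
    then have "{\<alpha>\<in>S \<inter> {x\<in>I. b < x}. b \<le> c \<alpha> \<zeta>} \<subseteq> {\<alpha>\<in>S. g \<zeta> \<le> c \<alpha> \<zeta>}" by auto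
    from stationary_mono[OF \<zeta>(2) this] SI have "stationary I {\<alpha>\<in>S. g \<zeta> \<le> c \<alpha> \<zeta>}" by auto
    then show False using g[OF \<zeta>(1)] by blast
  qed
  then obtain \<zeta> where \<zeta>: "\<zeta> \<in> Z" "\<And>x. x \<in> I \<Longrightarrow> stationary I {\<alpha>\<in>S. x \<le> c \<alpha> \<zeta>}" by blast
  define W where "W x y \<longleftrightarrow> stationary I {\<alpha>\<in>S. x \<le> c \<alpha> \<zeta> \<and> c \<alpha> \<zeta> < y}" for x y
  have ex: "\<exists>y\<in>I. W x y" if x: "x \<in> I" for x
  proof -
    have "\<exists>b\<in>I. stationary I {\<alpha>\<in>{\<alpha>\<in>S. x \<le> c \<alpha> \<zeta>}. \<exists>y<b. y = c \<alpha> \<zeta>}"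
      by (rule fodor_bounded[OF I \<mu> B \<zeta>(2)[OF x]]) (use c \<zeta>(1) in auto)
    then obtain b where b: "b \<in> I" "stationary I {\<alpha>\<in>{\<alpha>\<in>S. x \<le> c \<alpha> \<zeta>}. \<exists>y<b. y = c \<alpha> \<zeta>}" by blast
    have "{\<alpha>\<in>{\<alpha>\<in>S. x \<le> c \<alpha> \<zeta>}. \<exists>y<b. y = c \<alpha> \<zeta>} = {\<alpha>\<in>S. x \<le> c \<alpha> \<zeta> \<and> c \<alpha> \<zeta> < b}" by auto
    then show ?thesis using b unfolding W_def by auto
  qed
  define G where "G x = (LEAST y. W x y)" for x
  have G: "W x (G x)" "G x \<in> I" if x: "x \<in> I" for x
  proof -
    obtain y where y: "y \<in> I" "W x y" using ex[OF x] by blast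
    show "W x (G x)" unfolding G_def by (rule LeastI[of "W x" y]) (rule y(2))
    have "G x \<le> y" unfolding G_def by (rule Least_le) (rule y(2))
    then show "G x \<in> I" using initialD[OF I(1) y(1)] by blast
  qed
  have "mono_self I G"
    unfolding mono_self_def
  proof (intro conjI ballI impI)
    fix x y assume xy: "x \<in> I" "y \<in> I" "x \<le> y"
    then have "{\<alpha>\<in>S. y \<le> c \<alpha> \<zeta> \<and> c \<alpha> \<zeta> < G y} \<subseteq> {\<alpha>\<in>S. x \<le> c \<alpha> \<zeta> \<and> c \<alpha> \<zeta> < G y}" by auto
    then have "W x (G y)" using G(1)[OF xy(2)] SI unfolding W_def by (elim stationary_mono) auto
    then show "G x \<le> G y" unfolding G_def[of x] by (rule Least_le)
  qed (rule G(2))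
  then show ?thesis using \<zeta>(1) G(1) unfolding W_def by blast
qed

lemma stationary_nonempty: "stationary I S \<Longrightarrow> initial I \<Longrightarrow> \<exists>x. x \<in> S"
  using stationary_meets[OF _ club_self] by blast

text \<open>
  Each \<open>\<delta>\<close> needs some \<open>\<zeta>\<close> and a sequence from the list \<open>P\<close> adapted to the map \<open>G\<close> of
  \<open>stationary_interval_map\<close>. The parameters \<open>\<zeta>\<close> and \<open>j\<close> can be made constant on a stationary set
  because there are few of them, and \<open>\<epsilon>\<close> because it is regressive. The colour of \<open>\<alpha>\<close> is the number
  of the interval of the sequence that contains \<open>c \<alpha> \<zeta>\<close>.
\<close>
lemma uniform_colouring:
  fixes P :: "'a \<Rightarrow> 'j \<Rightarrow> nat \<Rightarrow> 'a" and Z :: "'z set"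
  assumes K: "initial K" "cof_ge K \<mu>" and \<mu>: "natLeq <o \<mu>" and small: "\<And>x. x \<in> K \<Longrightarrow> |{..<x}| <o \<mu>"
    and T: "stationary K T"
    and \<kappa>: "natLeq <o \<kappa>" and \<delta>cof: "\<And>\<delta>. \<delta> \<in> T \<Longrightarrow> cof_ge {..<\<delta>} \<kappa>"
    and \<delta>B: "\<And>\<delta>. \<delta> \<in> T \<Longrightarrow> \<exists>B. cofinal_in {..<\<delta>} B \<and> (\<forall>x<\<delta>. |B \<inter> {..<x}| <o \<kappa>)"
    and \<delta>S: "\<And>\<delta>. \<delta> \<in> T \<Longrightarrow> stationary {..<\<delta>} (S \<inter> {..<\<delta>})"
    and Z: "|Z| <o \<kappa>" "|Z| <o \<mu>"
    and c: "\<And>\<alpha> \<zeta>. \<alpha> \<in> S \<Longrightarrow> \<zeta> \<in> Z \<Longrightarrow> c \<alpha> \<zeta> < \<alpha>"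
    and cof: "\<And>\<alpha> x. \<alpha> \<in> S \<Longrightarrow> x < \<alpha> \<Longrightarrow> \<exists>\<zeta>\<in>Z. x \<le> c \<alpha> \<zeta>"
    and J: "|J| <o \<mu>"
    and P: "\<And>\<delta> G. \<delta> \<in> T \<Longrightarrow> mono_self {..<\<delta>} G \<Longrightarrow>
      \<exists>\<epsilon><\<delta>. \<exists>j\<in>J. \<forall>k. P \<epsilon> j k < \<delta> \<and> G (P \<epsilon> j k) \<le> P \<epsilon> j (Suc k)"
  shows "\<exists>(col :: 'a \<Rightarrow> nat) T'. T' \<subseteq> T \<and> stationary K T' \<and>
    (\<forall>\<delta>\<in>T'. \<forall>n. stationary {..<\<delta>} {\<alpha>\<in>S. \<alpha> < \<delta> \<and> col \<alpha> = n})"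
proof -
  define R where "R \<zeta> j \<epsilon> \<delta> \<longleftrightarrow> (\<forall>k. P \<epsilon> j k \<le> P \<epsilon> j (Suc k) \<and>
    stationary {..<\<delta>} {\<alpha>\<in>S. \<alpha> < \<delta> \<and> P \<epsilon> j k \<le> c \<alpha> \<zeta> \<and> c \<alpha> \<zeta> < P \<epsilon> j (Suc k)})" for \<zeta> j \<epsilon> \<delta>
  have ex: "\<exists>\<zeta>\<in>Z. \<exists>j\<in>J. \<exists>\<epsilon><\<delta>. R \<zeta> j \<epsilon> \<delta>" if \<delta>: "\<delta> \<in> T" for \<delta>
  proof -
    obtain B where B: "cofinal_in {..<\<delta>} B" "\<And>x. x < \<delta> \<Longrightarrow> |B \<inter> {..<x}| <o \<kappa>" using \<delta>B[OF \<delta>] by blast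
    have "\<exists>\<zeta>\<in>Z. \<exists>G. mono_self {..<\<delta>} G \<and>
      (\<forall>x\<in>{..<\<delta>}. stationary {..<\<delta>} {\<alpha>\<in>S \<inter> {..<\<delta>}. x \<le> c \<alpha> \<zeta> \<and> c \<alpha> \<zeta> < G x})"
      by (rule stationary_interval_map[OF initial_lessThan \<delta>cof[OF \<delta>] \<kappa> B(1) _ \<delta>S[OF \<delta>] Z(1)])
        (use B(2) c cof in auto)
    then obtain \<zeta> G where G: "\<zeta> \<in> Z" "mono_self {..<\<delta>} G"
      "\<And>x. x < \<delta> \<Longrightarrow> stationary {..<\<delta>} {\<alpha>\<in>S \<inter> {..<\<delta>}. x \<le> c \<alpha> \<zeta> \<and> c \<alpha> \<zeta> < G x}" by blast
    obtain \<epsilon> j where j: "\<epsilon> < \<delta>" "j \<in> J" "\<And>k. P \<epsilon> j k < \<delta>" "\<And>k. G (P \<epsilon> j k) \<le> P \<epsilon> j (Suc k)"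
      using P[OF \<delta> G(2)] by blast
    have "R \<zeta> j \<epsilon> \<delta>"
      unfolding R_def
    proof (intro allI conjI)
      fix k
      let ?X = "{\<alpha>\<in>S \<inter> {..<\<delta>}. P \<epsilon> j k \<le> c \<alpha> \<zeta> \<and> c \<alpha> \<zeta> < G (P \<epsilon> j k)}"
      note X = G(3)[OF j(3)[of k]]
      obtain \<alpha> where "\<alpha> \<in> ?X" using stationary_nonempty[OF X initial_lessThan] by blast
      then have "P \<epsilon> j k < G (P \<epsilon> j k)" using le_less_trans by blast
      then show "P \<epsilon> j k \<le> P \<epsilon> j (Suc k)" using j(4)[of k] by simp
      have "?X \<subseteq> {\<alpha>\<in>S. \<alpha> < \<delta> \<and> P \<epsilon> j k \<le> c \<alpha> \<zeta> \<and> c \<alpha> \<zeta> < P \<epsilon> j (Suc k)}"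
        using less_le_trans[OF _ j(4)[of k]] by blast
      then show "stationary {..<\<delta>} {\<alpha>\<in>S. \<alpha> < \<delta> \<and> P \<epsilon> j k \<le> c \<alpha> \<zeta> \<and> c \<alpha> \<zeta> < P \<epsilon> j (Suc k)}"
        by (rule stationary_mono[OF X]) blast
    qed
    then show ?thesis using G(1) j(1,2) by blast
  qed
  obtain \<zeta> where \<zeta>: "stationary K {\<delta>\<in>T. \<exists>j\<in>J. \<exists>\<epsilon><\<delta>. R \<zeta> j \<epsilon> \<delta>}"
    using stationary_UN[OF K \<mu> T Z(2), of "\<lambda>\<zeta> \<delta>. \<exists>j\<in>J. \<exists>\<epsilon><\<delta>. R \<zeta> j \<epsilon> \<delta>"] ex by blast
  have "\<exists>j\<in>J. stationary K {\<delta>\<in>{\<delta>\<in>T. \<exists>j\<in>J. \<exists>\<epsilon><\<delta>. R \<zeta> j \<epsilon> \<delta>}. \<exists>\<epsilon><\<delta>. R \<zeta> j \<epsilon> \<delta>}"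
    by (rule stationary_UN[OF K \<mu> \<zeta> J]) blast
  then obtain j where j: "stationary K {\<delta>\<in>{\<delta>\<in>T. \<exists>j\<in>J. \<exists>\<epsilon><\<delta>. R \<zeta> j \<epsilon> \<delta>}. \<exists>\<epsilon><\<delta>. R \<zeta> j \<epsilon> \<delta>}" (is "stationary K ?T1")
    by blast
  have KK: "cofinal_in K K" unfolding cofinal_in_def by auto
  have Ks: "|K \<inter> {..<x}| <o \<mu>" if "x \<in> K" for x by (rule card_less_subset[OF _ small[OF that]]) blast
  have "\<exists>b\<in>K. stationary K {\<delta>\<in>?T1. \<exists>\<epsilon><b. R \<zeta> j \<epsilon> \<delta>}"
    by (rule fodor_bounded[OF K \<mu> KK Ks j]) (assumption, drule CollectD, elim conjE, assumption)
  then obtain b where b: "b \<in> K" "stationary K {\<delta>\<in>?T1. \<exists>\<epsilon><b. R \<zeta> j \<epsilon> \<delta>}" by blast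
  have "\<exists>\<epsilon>\<in>{..<b}. stationary K {\<delta>\<in>{\<delta>\<in>?T1. \<exists>\<epsilon><b. R \<zeta> j \<epsilon> \<delta>}. R \<zeta> j \<epsilon> \<delta>}"
    by (rule stationary_UN[OF K \<mu> b(2) small[OF b(1)]]) blast
  then obtain \<epsilon> where \<epsilon>: "stationary K {\<delta>\<in>{\<delta>\<in>?T1. \<exists>\<epsilon><b. R \<zeta> j \<epsilon> \<delta>}. R \<zeta> j \<epsilon> \<delta>}" (is "stationary K ?T2")
    by blast
  define col where "col \<alpha> = (LEAST k. c \<alpha> \<zeta> < P \<epsilon> j (Suc k))" for \<alpha>
  have colT: "stationary {..<\<delta>} {\<alpha>\<in>S. \<alpha> < \<delta> \<and> col \<alpha> = n}" if \<delta>: "\<delta> \<in> ?T2" for \<delta> n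
  proof -
    have Rd: "R \<zeta> j \<epsilon> \<delta>" using \<delta> by blast
    have inc: "P \<epsilon> j k \<le> P \<epsilon> j (k + m)" for k m
    proof (induction m)
      case (Suc m)
      have "P \<epsilon> j (k + m) \<le> P \<epsilon> j (Suc (k + m))" using Rd unfolding R_def by blast
      then show ?case using Suc order.trans by simp
    qed simp
    have "col \<alpha> = n" if \<alpha>: "P \<epsilon> j n \<le> c \<alpha> \<zeta>" "c \<alpha> \<zeta> < P \<epsilon> j (Suc n)" for \<alpha>
      unfolding col_def
    proof (rule order_class.Least_equality)
      fix k assume k: "c \<alpha> \<zeta> < P \<epsilon> j (Suc k)"
      show "n \<le> k"
      proof (rule ccontr)
        assume "\<not> n \<le> k"
        then obtain m where "n = Suc k + m" using Nat.le_Suc_ex[of "Suc k" n] by auto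
        then have "P \<epsilon> j (Suc k) \<le> P \<epsilon> j n" using inc[of "Suc k" m] by simp
        then have "P \<epsilon> j (Suc k) \<le> c \<alpha> \<zeta>" using \<alpha>(1) by (rule order.trans)
        then show False using k by simp
      qed
    qed (rule \<alpha>(2))
    then have "{\<alpha>\<in>S. \<alpha> < \<delta> \<and> P \<epsilon> j n \<le> c \<alpha> \<zeta> \<and> c \<alpha> \<zeta> < P \<epsilon> j (Suc n)} \<subseteq> {\<alpha>\<in>S. \<alpha> < \<delta> \<and> col \<alpha> = n}"
      by blast
    moreover have "stationary {..<\<delta>} {\<alpha>\<in>S. \<alpha> < \<delta> \<and> P \<epsilon> j n \<le> c \<alpha> \<zeta> \<and> c \<alpha> \<zeta> < P \<epsilon> j (Suc n)}"
      using Rd unfolding R_def by blast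
    moreover have "{\<alpha>\<in>S. \<alpha> < \<delta> \<and> col \<alpha> = n} \<subseteq> {..<\<delta>}" by auto
    ultimately show ?thesis using stationary_mono by blast
  qed
  show ?thesis
  proof (intro exI conjI ballI allI)
    show "?T2 \<subseteq> T" by blast
    show "stationary K ?T2" by (rule \<epsilon>)
    fix \<delta> n assume "\<delta> \<in> ?T2"
    then show "stationary {..<\<delta>} {\<alpha>\<in>S. \<alpha> < \<delta> \<and> col \<alpha> = n}" by (rule colT)
  qed
qed

section \<open>Coherent ladder systems\<close>

lemma Cinfinite_of_natLeq_ordLess: "Card_order \<kappa> \<Longrightarrow> natLeq <o \<kappa> \<Longrightarrow> Cinfinite \<kappa>"
  using cinfinite_mono[OF ordLess_imp_ordLeq natLeq_cinfinite] by blast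

lemma small_club_exists:
  assumes \<kappa>: "Card_order \<kappa>" "natLeq <o \<kappa>" and X: "cofinal_in {..<\<delta>} X" "|X| \<le>o \<kappa>"
  shows "\<exists>C. club {..<\<delta>} C \<and> |C| \<le>o \<kappa>"
proof -
  obtain B where B: "B \<subseteq> X" "cofinal_in {..<\<delta>} B" "\<And>x. x < \<delta> \<Longrightarrow> |B \<inter> {..<x}| <o \<kappa>"
    using cofinal_records[OF \<kappa>(1) X] by auto
  let ?C = "lim_closure \<delta> B"
  have Bs: "x < \<delta>" if "x \<in> B" for x using B(2) that unfolding cofinal_in_def by auto
  have "|B| \<le>o \<kappa>" by (rule ordLeq_transitive[OF card_of_mono1[OF B(1)] X(2)])
  moreover have "|insert x (?C \<inter> {..<x})| \<le>o \<kappa>" if "x \<in> B" for x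
    by (intro ordLess_imp_ordLeq card_less_insert[OF \<kappa>] lim_closure_small[OF \<kappa> B(2,3)] Bs[OF that])
  ultimately have "|\<Union>x\<in>B. insert x (?C \<inter> {..<x})| \<le>o \<kappa>"
    using UNION_Cinfinite_bound[OF _ _ Cinfinite_of_natLeq_ordLess[OF \<kappa>], of B "\<lambda>x. insert x (?C \<inter> {..<x})"] by blast
  moreover have "?C \<subseteq> (\<Union>x\<in>B. insert x (?C \<inter> {..<x}))"
  proof
    fix y assume y: "y \<in> ?C"
    then have "y < \<delta>" unfolding lim_closure_def by blast
    then obtain x where x: "x \<in> B" "y \<le> x" using B(2) unfolding cofinal_in_def by auto
    have "y \<in> insert x (?C \<inter> {..<x})" using x(2) y by (cases "y = x") auto
    then show "y \<in> (\<Union>x\<in>B. insert x (?C \<inter> {..<x}))" using x(1) by blast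
  qed
  ultimately have "|?C| \<le>o \<kappa>" using ordLeq_transitive[OF card_of_mono1] by blast
  then show ?thesis using club_lim_closure[OF B(2)] by blast
qed

lemma regular_cof_ge:
  assumes I: "stable |I|" "\<And>x. x \<in> I \<Longrightarrow> |{..<x}| <o |I|" "natLeq <o |I|"
  shows "cof_ge I |I|"
  unfolding cof_ge_def
proof (intro allI impI, elim conjE)
  fix X assume X: "X \<subseteq> I" "|X| <o |I|"
  show "\<exists>b\<in>I. \<forall>x\<in>X. x < b"
  proof (rule ccontr)
    assume n: "\<not> ?thesis"
    have "|insert x {..<x}| <o |I|" if "x \<in> X" for x
      by (rule card_less_insert[OF card_of_Card_order I(3) I(2)]) (use X(1) that in auto)
    then have "|\<Union>x\<in>X. insert x {..<x}| <o |I|"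
      by (intro stable_UNION[OF I(1) X(2)])
    moreover have "I \<subseteq> (\<Union>x\<in>X. insert x {..<x})"
    proof
      fix b assume b: "b \<in> I"
      then obtain x where x: "x \<in> X" "\<not> x < b" using n by blast
      have "b \<in> insert x {..<x}" using x(2) by (cases "x = b") auto
      then show "b \<in> (\<Union>x\<in>X. insert x {..<x})" using x(1) by blast
    qed
    ultimately have "|I| <o |I|" by (rule card_less_subset[rotated])
    then show False using ordLess_irreflexive by blast
  qed
qed

lemma inj_initial_small:
  assumes L: "\<And>x. x < L \<Longrightarrow> |{..<x}| <o |{..<L}|"
    and f: "inj_on f {..<\<gamma>}" and "i < L"
  shows "|{\<beta>. \<beta> < \<gamma> \<and> f \<beta> < i}| <o |{..<L}|"
proof -
  have "inj_on f {\<beta>. \<beta> < \<gamma> \<and> f \<beta> < i}" by (rule inj_on_subset[OF f]) auto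
  moreover have "f ` {\<beta>. \<beta> < \<gamma> \<and> f \<beta> < i} \<subseteq> {..<i}" by auto
  ultimately have "|{\<beta>. \<beta> < \<gamma> \<and> f \<beta> < i}| \<le>o |{..<i}|" using card_of_ordLeq by blast
  then show ?thesis using L[OF assms(3)] by (rule ordLeq_ordLess_trans)
qed

text \<open>
  The condition on \<open>i\<close> relates the injections of fewer than \<open>L\<close> many \<open>\<alpha>\<close> to that of \<open>\<delta>\<close>, and by
  regularity of \<open>L\<close> it can be closed off below \<open>L\<close>: an index below \<open>x\<close> under one injection is
  below some \<open>y\<close> under the other.
\<close>
lemma coherent_index:
  assumes L: "stable |{..<L}|" "\<And>x. x < L \<Longrightarrow> |{..<x}| <o |{..<L}|" "natLeq <o |{..<L}|"
    and f: "\<And>\<gamma>. \<gamma> \<le> \<delta> \<Longrightarrow> inj_on (f \<gamma>) {..<\<gamma>} \<and> f \<gamma> ` {..<\<gamma>} \<subseteq> {..<L}"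
    and C: "C \<subseteq> {..<\<delta>}" "|C| <o |{..<L}|"
  shows "\<exists>i<L. C \<subseteq> {\<beta>. \<beta> < \<delta> \<and> f \<delta> \<beta> < i} \<and>
    (\<forall>\<alpha>\<in>C. {\<beta>. \<beta> < \<alpha> \<and> f \<alpha> \<beta> < i} = {\<beta>. \<beta> < \<delta> \<and> f \<delta> \<beta> < i} \<inter> {..<\<alpha>})"
proof -
  have reg: "cof_ge {..<L} |{..<L}|" by (rule regular_cof_ge[OF L(1) _ L(3)]) (simp add: L(2))
  have fL: "f \<gamma> \<beta> < L" if "\<gamma> \<le> \<delta>" "\<beta> < \<gamma>" for \<gamma> \<beta> using f[OF that(1)] that(2) by auto
  have C\<delta>: "\<alpha> < \<delta>" if "\<alpha> \<in> C" for \<alpha> using C(1) that by auto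
  have "f \<delta> ` C \<subseteq> {..<L}" using fL C\<delta> by auto
  from cof_geD[OF reg this card_less_image[OF C(2)]]
  obtain i0 where i0: "i0 < L" "\<And>\<alpha>. \<alpha> \<in> C \<Longrightarrow> f \<delta> \<alpha> < i0" by auto
  define Q where "Q x y \<longleftrightarrow> (\<forall>\<alpha>\<in>C. \<forall>\<beta><\<alpha>. (f \<delta> \<beta> < x \<longrightarrow> f \<alpha> \<beta> < y) \<and> (f \<alpha> \<beta> < x \<longrightarrow> f \<delta> \<beta> < y))" for x y
  have step: "\<exists>y\<in>{..<L}. x < y \<and> Q x y" if x: "x \<in> {..<L}" for x
  proof -
    let ?U = "\<Union>\<alpha>\<in>C. f \<alpha> ` ({\<beta>. \<beta> < \<delta> \<and> f \<delta> \<beta> < x} \<inter> {..<\<alpha>})"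
    let ?V = "\<Union>\<alpha>\<in>C. f \<delta> ` {\<beta>. \<beta> < \<alpha> \<and> f \<alpha> \<beta> < x}"
    have xL: "x < L" using x by simp
    have U: "|?U| <o |{..<L}|"
    proof (rule stable_UNION[OF L(1) C(2)])
      fix \<alpha> assume "\<alpha> \<in> C"
      have "|{\<beta>. \<beta> < \<delta> \<and> f \<delta> \<beta> < x}| <o |{..<L}|"
        by (rule inj_initial_small[OF L(2) _ xL]) (use f[of \<delta>] in auto)
      then show "|f \<alpha> ` ({\<beta>. \<beta> < \<delta> \<and> f \<delta> \<beta> < x} \<inter> {..<\<alpha>})| <o |{..<L}|"
        by (intro card_less_image) (erule card_less_subset[rotated], blast)
    qed
    have V: "|?V| <o |{..<L}|"
    proof (rule stable_UNION[OF L(1) C(2)])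
      fix \<alpha> assume "\<alpha> \<in> C"
      then have "\<alpha> \<le> \<delta>" using C\<delta> less_imp_le by blast
      have "|{\<beta>. \<beta> < \<alpha> \<and> f \<alpha> \<beta> < x}| <o |{..<L}|"
        by (rule inj_initial_small[OF L(2) _ xL]) (use f[OF \<open>\<alpha> \<le> \<delta>\<close>] in auto)
      then show "|f \<delta> ` {\<beta>. \<beta> < \<alpha> \<and> f \<alpha> \<beta> < x}| <o |{..<L}|" by (rule card_less_image)
    qed
    have lt: "\<beta> < \<delta>" if "\<alpha> \<in> C" "\<beta> < \<alpha>" for \<alpha> \<beta> using that(2) C\<delta>[OF that(1)] by (rule less_trans)
    have "?U \<subseteq> {..<L}" using fL C\<delta> less_imp_le by auto
    from cof_geD[OF reg this U] obtain y1 where y1: "y1 < L" "\<forall>z\<in>?U. z < y1" by auto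
    have "?V \<subseteq> {..<L}" using fL lt by auto
    from cof_geD[OF reg this V] obtain y2 where y2: "y2 < L" "\<forall>z\<in>?V. z < y2" by auto
    have "max x (max y1 y2) \<in> {..<L}" using xL y1(1) y2(1) by simp
    note no_max[OF reg L(3) this]
    then obtain y where y: "y < L" "x < y" "y1 < y" "y2 < y" by auto
    have "Q x y" unfolding Q_def
    proof (intro ballI allI impI conjI)
      fix \<alpha> \<beta> assume a: "\<alpha> \<in> C" "\<beta> < \<alpha>"
      { assume "f \<delta> \<beta> < x"
        then have "f \<alpha> \<beta> \<in> ?U" using a lt[OF a] by (intro UN_I[OF a(1)] imageI) simp
        then have "f \<alpha> \<beta> < y1" using y1(2) by blast
        then show "f \<alpha> \<beta> < y" using y(3) by (rule less_trans) }
      { assume "f \<alpha> \<beta> < x"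
        then have "f \<delta> \<beta> \<in> ?V" using a by (intro UN_I[OF a(1)] imageI) simp
        then have "f \<delta> \<beta> < y2" using y2(2) by blast
        then show "f \<delta> \<beta> < y" using y(4) by (rule less_trans) }
    qed
    then show ?thesis using y by auto
  qed
  have "i0 \<in> {..<L}" using i0(1) by simp
  obtain s x where s: "s \<in> {..<L}" "x 0 = i0" "\<And>k. x k < x (Suc k)" "\<And>k. Q (x k) (x (Suc k))"
    "\<And>k::nat. x k < s" "\<And>y. y < s \<Longrightarrow> \<exists>k. y < x k"
    by (rule omega_chain[OF initial_lessThan reg L(3) step \<open>i0 \<in> {..<L}\<close>]) (assumption, rule that, assumption+)
  have iff: "f \<alpha> \<beta> < s \<longleftrightarrow> f \<delta> \<beta> < s" if a: "\<alpha> \<in> C" "\<beta> < \<alpha>" for \<alpha> \<beta>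
  proof
    assume "f \<alpha> \<beta> < s"
    then obtain k where "f \<alpha> \<beta> < x k" using s(6) by blast
    then have "f \<delta> \<beta> < x (Suc k)" using s(4)[of k] a unfolding Q_def by blast
    then show "f \<delta> \<beta> < s" using s(5) by (rule less_trans)
  next
    assume "f \<delta> \<beta> < s"
    then obtain k where "f \<delta> \<beta> < x k" using s(6) by blast
    then have "f \<alpha> \<beta> < x (Suc k)" using s(4)[of k] a unfolding Q_def by blast
    then show "f \<alpha> \<beta> < s" using s(5) by (rule less_trans)
  qed
  have "C \<subseteq> {\<beta>. \<beta> < \<delta> \<and> f \<delta> \<beta> < s}"
  proof
    fix \<alpha> assume a: "\<alpha> \<in> C"
    have "f \<delta> \<alpha> < s" using i0(2)[OF a] s(5)[of 0] unfolding s(2) by (rule less_trans)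
    then show "\<alpha> \<in> {\<beta>. \<beta> < \<delta> \<and> f \<delta> \<beta> < s}" using C\<delta>[OF a] by simp
  qed
  moreover have "{\<beta>. \<beta> < \<alpha> \<and> f \<alpha> \<beta> < s} = {\<beta>. \<beta> < \<delta> \<and> f \<delta> \<beta> < s} \<inter> {..<\<alpha>}" if a: "\<alpha> \<in> C" for \<alpha>
    using iff[OF a] less_trans[OF _ C\<delta>[OF a]] by blast
  ultimately show ?thesis using s(1) by blast
qed

lemma club_restrict:
  assumes "initial K" "club K D" "\<delta> \<in> K" "limit_of D \<delta>"
  shows "club {..<\<delta>} (D \<inter> {..<\<delta>})"
  unfolding club_def cofinal_in_def
proof (intro conjI ballI impI)
  fix x assume "x \<in> {..<\<delta>}"
  then obtain d where "d \<in> D" "x < d" "d < \<delta>" using limit_ex[OF assms(4), of x] by auto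
  then show "\<exists>c\<in>D \<inter> {..<\<delta>}. x \<le> c" by (intro bexI[of _ d]) auto
next
  fix x assume x: "x \<in> {..<\<delta>}" "limit_of (D \<inter> {..<\<delta>}) x"
  then have "limit_of D x" using limit_of_mono[OF x(2)] by blast
  moreover have "x \<in> K" using initialD[OF assms(1,3)] x(1) by simp
  ultimately show "x \<in> D \<inter> {..<\<delta>}" using assms(2) x(1) unfolding club_def by simp
qed auto

text \<open>
  If for each number of steps the points of \<open>A\<close> that need exactly this number were bounded in \<open>\<delta>\<close>,
  the countably many bounds would have a common bound, contradicting \<open>walk_reaches\<close>.
\<close>
lemma one_length_suffices:
  assumes lad: "is_ladder K e" and \<delta>: "\<delta> \<in> K" "cof_ge {..<\<delta>} \<kappa>" and \<kappa>: "natLeq <o \<kappa>"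
    and A: "limit_of A \<delta>"
  shows "\<exists>n. cofinal_in {..<\<delta>} {\<beta>\<in>A. \<beta> < \<delta> \<and> \<beta> \<in> walk e (Suc n) \<delta> \<and> \<beta> \<notin> walk e n \<delta>}"
proof (rule ccontr)
  let ?A = "\<lambda>n. {\<beta>\<in>A. \<beta> < \<delta> \<and> \<beta> \<in> walk e (Suc n) \<delta> \<and> \<beta> \<notin> walk e n \<delta>}"
  assume n: "\<not> (\<exists>n. cofinal_in {..<\<delta>} (?A n))"
  have "\<forall>n. \<exists>b. b < \<delta> \<and> (\<forall>\<beta>\<in>?A n. \<beta> < b)"
  proof
    fix m
    have "\<not> cofinal_in {..<\<delta>} (?A m)" using n by blast
    moreover have "?A m \<subseteq> {..<\<delta>}" by blast
    ultimately obtain b where "b < \<delta>" "\<forall>\<beta>\<in>?A m. \<not> b \<le> \<beta>" unfolding cofinal_in_def by blast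
    then show "\<exists>b. b < \<delta> \<and> (\<forall>\<beta>\<in>?A m. \<beta> < b)" by (intro exI[of _ b]) (simp add: not_le)
  qed
  from choice[OF this] obtain b where "\<forall>m. b m < \<delta> \<and> (\<forall>\<beta>\<in>?A m. \<beta> < b m)" by blast
  then have b: "\<And>m. b m < \<delta>" "\<And>m \<beta>. \<beta> \<in> ?A m \<Longrightarrow> \<beta> < b m" by auto
  have "range b \<subseteq> {..<\<delta>}" using b(1) by auto
  from cof_geD[OF \<delta>(2) this countable_image_ordLess[OF \<kappa>]]
  obtain b' where b': "b' < \<delta>" "\<And>m. b m < b'" by auto
  obtain \<beta> where \<beta>: "\<beta> \<in> A" "b' < \<beta>" "\<beta> < \<delta>" using limit_ex[OF A b'(1)] by blast
  define m where "m = (LEAST m. \<beta> \<in> walk e m \<delta>)"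
  have "\<exists>m. \<beta> \<in> walk e m \<delta>" using walk_reaches[OF lad \<delta>(1)] \<beta>(3) less_imp_le by blast
  then have m: "\<beta> \<in> walk e m \<delta>" unfolding m_def by (rule wellorder_class.LeastI_ex)
  have "m \<noteq> 0" using m \<beta>(3) by (cases m) auto
  then obtain k where k: "m = Suc k" by (cases m) auto
  have "\<beta> \<notin> walk e k \<delta>" using wellorder_class.not_less_Least[of k "\<lambda>m. \<beta> \<in> walk e m \<delta>"] k unfolding m_def by simp
  then have "\<beta> < b k" using b(2)[of \<beta> k] \<beta> m k by simp
  then show False using b'(2)[of k] \<beta>(2) by (metis less_trans less_irrefl)
qed

text \<open>
  In terms of the order, \<open>\<alpha> = sup (A \<inter> nacc (E \<inter> \<alpha>))\<close>.
\<close>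
definition captures :: "'a set \<Rightarrow> 'a set \<Rightarrow> 'a \<Rightarrow> bool" where
  "captures E A \<alpha> \<longleftrightarrow> (\<forall>x<\<alpha>. \<exists>\<beta>\<in>A \<inter> E. x < \<beta> \<and> \<beta> < \<alpha> \<and> (\<exists>\<eta><\<beta>. \<forall>y\<in>E. \<not> (\<eta> < y \<and> y < \<beta>)))"

text \<open>
  Coherence at \<open>\<alpha>\<close> makes the walks from \<open>\<alpha>\<close> and from \<open>\<delta>\<close> agree below \<open>\<alpha>\<close>, so that the points of
  \<open>A\<close> isolated in the set for \<open>\<delta>\<close> stay isolated in the set for \<open>\<alpha>\<close>.
\<close>
lemma captures_transfer:
  assumes lad: "is_ladder K e" and small: "\<And>\<gamma> b. \<gamma> \<in> K \<Longrightarrow> b < \<gamma> \<Longrightarrow> |e \<gamma> \<inter> {..<b}| <o \<mu>"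
    and \<delta>: "\<delta> \<in> K" "\<alpha> < \<delta>" and e: "e \<alpha> = e \<delta> \<inter> {..<\<alpha>}"
    and A: "\<And>\<beta>. \<beta> \<in> A \<Longrightarrow> cof_ge {..<\<beta>} \<mu>"
    and lim: "limit_of {\<beta>\<in>A. \<beta> < \<delta> \<and> \<beta> \<in> walk e (Suc n) \<delta> \<and> \<beta> \<notin> walk e n \<delta>} \<alpha>"
  shows "captures (walk e (Suc n) \<alpha>) A \<alpha>"
  unfolding captures_def
proof (intro allI impI)
  fix x assume "x < \<alpha>"
  from limit_ex[OF lim this] obtain \<beta> where \<beta>: "\<beta> \<in> A" "\<beta> \<in> walk e (Suc n) \<delta>" "\<beta> \<notin> walk e n \<delta>"
    "x < \<beta>" "\<beta> < \<alpha>" by blast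
  have "\<alpha> \<in> K" using initialD[OF _ \<delta>(1) less_imp_le[OF \<delta>(2)]] lad unfolding is_ladder_def by blast
  note coh = walk_coherent[OF lad this \<delta> e]
  obtain \<eta> where \<eta>: "\<eta> < \<beta>" "\<And>y. y \<in> walk e (Suc n) \<delta> \<Longrightarrow> \<not> (\<eta> < y \<and> y < \<beta>)"
    using walk_isolated[OF lad small A[OF \<beta>(1)] \<delta>(1) \<beta>(2,3)] by blast
  have "\<not> (\<eta> < y \<and> y < \<beta>)" if y: "y \<in> walk e (Suc n) \<alpha>" for y
  proof
    assume yb: "\<eta> < y \<and> y < \<beta>"
    then have "y < \<alpha>" using \<beta>(5) less_trans by blast
    then have "y \<in> walk e (Suc n) \<delta>" using coh y by blast
    then show False using \<eta>(2) yb by blast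
  qed
  moreover have "\<beta> \<in> A \<inter> walk e (Suc n) \<alpha>" using coh[OF \<beta>(5)] \<beta>(1,2) by blast
  ultimately show "\<exists>\<beta>\<in>A \<inter> walk e (Suc n) \<alpha>. x < \<beta> \<and> \<beta> < \<alpha> \<and>
    (\<exists>\<eta><\<beta>. \<forall>y\<in>walk e (Suc n) \<alpha>. \<not> (\<eta> < y \<and> y < \<beta>))"
    using \<beta>(4,5) \<eta>(1) by (intro bexI[of _ \<beta>] conjI exI[of _ \<eta>] ballI)
qed

text \<open>
  The index \<open>i\<close> of \<open>coherent_index\<close> is one of at most \<open>\<lambda>\<close> values, so it can be made constant on a
  stationary set. The set \<open>a \<gamma>\<close> consists of the points with index below this \<open>i\<close>. At limits \<open>\<alpha>\<close> of
  \<open>C\<close> it is cofinal, and there the ladder is its closure.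
\<close>
lemma coherent_ladders:
  assumes K: "initial K" "cof_ge K \<mu>" and \<mu>: "natLeq <o \<mu>"
    and L: "stable |{..<L}|" "\<forall>x<L. |{..<x}| <o |{..<L}|" "natLeq <o |{..<L}|"
    and L\<mu>: "|{..<L}| <o \<mu>" and KL: "\<forall>x\<in>K. |{..<x}| \<le>o |{..<L}|"
    and T: "stationary K T" and C: "\<forall>\<delta>\<in>T. \<exists>C. club {..<\<delta>} C \<and> |C| <o |{..<L}|"
  obtains e a T' where "is_ladder K e" "\<forall>\<gamma>\<in>K. \<forall>b<\<gamma>. |e \<gamma> \<inter> {..<b}| <o |{..<L}|"
    "\<forall>\<gamma>\<in>K. |a \<gamma>| <o |{..<L}|" "T' \<subseteq> T" "stationary K T'"
    "\<forall>\<delta>\<in>T'. cofinal_in {..<\<delta>} (a \<delta>) \<and> (\<exists>C. club {..<\<delta>} C \<and>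
      (\<forall>\<alpha>\<in>C. a \<alpha> = a \<delta> \<inter> {..<\<alpha>}) \<and> (\<forall>\<alpha>\<in>C. limit_of C \<alpha> \<longrightarrow> e \<alpha> = e \<delta> \<inter> {..<\<alpha>}))"
proof -
  have TK: "T \<subseteq> K" using T unfolding stationary_def by blast
  have "\<forall>\<gamma>. \<exists>f. \<gamma> \<in> K \<longrightarrow> inj_on f {..<\<gamma>} \<and> f ` {..<\<gamma>} \<subseteq> {..<L}"
    using KL card_of_ordLeq[of "{..<\<gamma>}" "{..<L}" for \<gamma>] by simp
  from choice[OF this] obtain f where f: "\<And>\<gamma>. \<gamma> \<in> K \<Longrightarrow> inj_on (f \<gamma>) {..<\<gamma>} \<and> f \<gamma> ` {..<\<gamma>} \<subseteq> {..<L}"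
    by blast
  define s where "s i \<gamma> = {\<beta>. \<beta> < \<gamma> \<and> f \<gamma> \<beta> < i}" for i \<gamma>
  define R where "R i \<delta> \<longleftrightarrow> (\<exists>C. club {..<\<delta>} C \<and> C \<subseteq> s i \<delta> \<and> (\<forall>\<alpha>\<in>C. s i \<alpha> = s i \<delta> \<inter> {..<\<alpha>}))" for i \<delta>
  have "\<exists>i\<in>{..<L}. R i \<delta>" if \<delta>: "\<delta> \<in> T" for \<delta>
  proof -
    obtain C where C: "club {..<\<delta>} C" "|C| <o |{..<L}|" using C \<delta> by blast
    have f': "inj_on (f \<gamma>) {..<\<gamma>} \<and> f \<gamma> ` {..<\<gamma>} \<subseteq> {..<L}" if "\<gamma> \<le> \<delta>" for \<gamma>
      by (rule f[OF initialD[OF K(1) _ that]]) (use \<delta> TK in blast)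
    have "C \<subseteq> {..<\<delta>}" using C(1) unfolding club_def cofinal_in_def by blast
    then obtain i where "i < L" "C \<subseteq> s i \<delta>" "\<forall>\<alpha>\<in>C. s i \<alpha> = s i \<delta> \<inter> {..<\<alpha>}"
      using coherent_index[OF L(1) L(2)[rule_format] L(3) f' _ C(2)] unfolding s_def by blast
    then show ?thesis using C(1) unfolding R_def by blast
  qed
  then obtain i where i: "i < L" "stationary K {\<delta>\<in>T. R i \<delta>}"
    using stationary_UN[OF K \<mu> T L\<mu>, of R] by blast
  define a where "a = s i"
  have a_sub: "a \<gamma> \<subseteq> {..<\<gamma>}" for \<gamma> unfolding a_def s_def by auto
  have a_small: "|a \<gamma>| <o |{..<L}|" if "\<gamma> \<in> K" for \<gamma>
    unfolding a_def s_def
    by (rule inj_initial_small[OF L(2)[rule_format] _ i(1)]) (use f[OF that] in auto)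
  have "\<forall>\<gamma>. \<exists>E. \<gamma> \<in> K \<longrightarrow> club {..<\<gamma>} E \<and> (\<forall>b<\<gamma>. |E \<inter> {..<b}| <o |{..<L}| ) \<and>
    (cofinal_in {..<\<gamma>} (a \<gamma>) \<longrightarrow> E = lim_closure \<gamma> (a \<gamma>))"
    using ladder_exists[OF L(3) KL[rule_format] a_sub a_small] by simp
  from choice[OF this] obtain e where e: "\<And>\<gamma>. \<gamma> \<in> K \<Longrightarrow> club {..<\<gamma>} (e \<gamma>)"
    "\<And>\<gamma> b. \<gamma> \<in> K \<Longrightarrow> b < \<gamma> \<Longrightarrow> |e \<gamma> \<inter> {..<b}| <o |{..<L}|"
    "\<And>\<gamma>. \<gamma> \<in> K \<Longrightarrow> cofinal_in {..<\<gamma>} (a \<gamma>) \<Longrightarrow> e \<gamma> = lim_closure \<gamma> (a \<gamma>)" by blast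
  have good: "cofinal_in {..<\<delta>} (a \<delta>) \<and> (\<exists>C. club {..<\<delta>} C \<and>
      (\<forall>\<alpha>\<in>C. a \<alpha> = a \<delta> \<inter> {..<\<alpha>}) \<and> (\<forall>\<alpha>\<in>C. limit_of C \<alpha> \<longrightarrow> e \<alpha> = e \<delta> \<inter> {..<\<alpha>}))"
    if \<delta>: "\<delta> \<in> {\<delta>\<in>T. R i \<delta>}" for \<delta>
  proof -
    have \<delta>K: "\<delta> \<in> K" using \<delta> TK by blast
    obtain C where C: "club {..<\<delta>} C" "C \<subseteq> a \<delta>" "\<And>\<alpha>. \<alpha> \<in> C \<Longrightarrow> a \<alpha> = a \<delta> \<inter> {..<\<alpha>}"
      using \<delta> unfolding R_def a_def by blast
    have cofa: "cofinal_in {..<\<delta>} (a \<delta>)"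
      using C(1,2) a_sub[of \<delta>] unfolding club_def cofinal_in_def by blast
    have "e \<alpha> = e \<delta> \<inter> {..<\<alpha>}" if \<alpha>: "\<alpha> \<in> C" "limit_of C \<alpha>" for \<alpha>
    proof -
      have "\<alpha> < \<delta>" using \<alpha>(1) C(2) a_sub[of \<delta>] by blast
      then have \<alpha>K: "\<alpha> \<in> K" using initialD[OF K(1) \<delta>K less_imp_le] by blast
      have "\<exists>c\<in>a \<alpha>. x \<le> c" if x: "x < \<alpha>" for x
      proof -
        obtain d where d: "d \<in> C" "x < d" "d < \<alpha>" using limit_ex[OF \<alpha>(2) x] by blast
        then have "d \<in> a \<alpha>" unfolding C(3)[OF \<alpha>(1)] using C(2) by blast
        then show ?thesis using d(2) less_imp_le by blast
      qed
      then have "cofinal_in {..<\<alpha>} (a \<alpha>)" using a_sub unfolding cofinal_in_def by blast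
      then have "e \<alpha> = lim_closure \<alpha> (a \<alpha>)" by (rule e(3)[OF \<alpha>K])
      also have "\<dots> = lim_closure \<delta> (a \<delta>) \<inter> {..<\<alpha>}"
        by (rule lim_closure_restrict[OF less_imp_le[OF \<open>\<alpha> < \<delta>\<close>] C(3)[OF \<alpha>(1)]])
      finally show ?thesis using e(3)[OF \<delta>K cofa] by simp
    qed
    then show ?thesis using cofa C(1,3) by blast
  qed
  show thesis
  proof (rule that[of e a "{\<delta>\<in>T. R i \<delta>}"])
    show "is_ladder K e" using K(1) e(1) unfolding is_ladder_def by blast
  qed (insert e(2) a_small i(2), (rule ballI, erule good | blast)+)
qed

section \<open>The combinatorial core\<close>

text \<open>
  At a point \<open>\<delta>\<close> of the stationary set provided by coherence and colouring, \<open>one_length_suffices\<close>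
  yields the number of steps that \<open>A\<close> asks for; points of \<open>S\<close> of the corresponding colour are
  stationary in \<open>\<delta>\<close>, so one of them lies in the club where coherence holds, in the given club \<open>D\<close>,
  and at a limit of the chosen points of \<open>A\<close>.
\<close>
theorem guessing_core:
  fixes \<kappa> :: "'k rel" and Z :: "'z set" and \<mu> :: "'m rel"
  assumes K: "initial K" "cof_ge K \<mu>" and \<mu>: "natLeq <o \<mu>"
    and L: "stable |{..<L}|" "\<And>x. x < L \<Longrightarrow> |{..<x}| <o |{..<L}|" "natLeq <o |{..<L}|"
    and L\<mu>: "|{..<L}| <o \<mu>" and KL: "\<And>x. x \<in> K \<Longrightarrow> |{..<x}| \<le>o |{..<L}|"
    and \<kappa>: "Card_order \<kappa>" "natLeq <o \<kappa>" "\<kappa> <o |{..<L}|" and Z: "|Z| <o \<kappa>"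
    and S: "\<And>\<alpha>. \<alpha> \<in> S \<Longrightarrow> (\<exists>y. y < \<alpha>) \<and> (\<exists>X. cofinal_in {..<\<alpha>} X \<and> |X| \<le>o |Z| )"
    and T: "stationary K T"
    and \<delta>cof: "\<And>\<delta>. \<delta> \<in> T \<Longrightarrow> cof_ge {..<\<delta>} \<kappa>"
    and \<delta>X: "\<And>\<delta>. \<delta> \<in> T \<Longrightarrow> \<exists>X. cofinal_in {..<\<delta>} X \<and> |X| \<le>o \<kappa>"
    and \<delta>S: "\<And>\<delta>. \<delta> \<in> T \<Longrightarrow> stationary {..<\<delta>} (S \<inter> {..<\<delta>})"
    and card_hyp: "cardSuc natLeq <o \<kappa> \<or> |UNIV :: (nat \<Rightarrow> nat) set| \<le>o |{..<L}|"
  shows "\<exists>e (col :: 'a \<Rightarrow> nat). is_ladder K e \<and> (\<forall>\<gamma>\<in>K. \<forall>b<\<gamma>. |e \<gamma> \<inter> {..<b}| <o |{..<L}| ) \<and>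
    (\<forall>A. cofinal_in K A \<longrightarrow> (\<forall>\<beta>\<in>A. cof_ge {..<\<beta>} |{..<L}| ) \<longrightarrow>
      stationary K {\<alpha>\<in>S \<inter> K. captures (walk e (Suc (col \<alpha>)) \<alpha>) A \<alpha>})"
proof -
  have H: "\<forall>\<delta>\<in>T. \<exists>C. club {..<\<delta>} C \<and> |C| <o |{..<L}|"
  proof
    fix \<delta> assume "\<delta> \<in> T"
    then obtain X where "cofinal_in {..<\<delta>} X" "|X| \<le>o \<kappa>" using \<delta>X by blast
    then obtain C where "club {..<\<delta>} C" "|C| \<le>o \<kappa>" using small_club_exists[OF \<kappa>(1,2)] by blast
    then show "\<exists>C. club {..<\<delta>} C \<and> |C| <o |{..<L}|" using ordLeq_ordLess_trans[OF _ \<kappa>(3)] by blast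
  qed
  have H': "\<forall>x<L. |{..<x}| <o |{..<L}|" "\<forall>x\<in>K. |{..<x}| \<le>o |{..<L}|" using L(2) KL by blast+
  obtain e a T1 where lad: "is_ladder K e"
    and small': "\<forall>\<gamma>\<in>K. \<forall>b<\<gamma>. |e \<gamma> \<inter> {..<b}| <o |{..<L}|"
    and a: "\<forall>\<gamma>\<in>K. |a \<gamma>| <o |{..<L}|" and T1: "T1 \<subseteq> T" "stationary K T1"
    and coh': "\<forall>\<delta>\<in>T1. cofinal_in {..<\<delta>} (a \<delta>) \<and> (\<exists>C. club {..<\<delta>} C \<and>
      (\<forall>\<alpha>\<in>C. a \<alpha> = a \<delta> \<inter> {..<\<alpha>}) \<and> (\<forall>\<alpha>\<in>C. limit_of C \<alpha> \<longrightarrow> e \<alpha> = e \<delta> \<inter> {..<\<alpha>}))"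
    by (rule coherent_ladders[OF K \<mu> L(1) H'(1) L(3) L\<mu> H'(2) T H])
  note small = small'[rule_format] and coh = bspec[OF coh']
  have T1K: "T1 \<subseteq> K" using T1(2) unfolding stationary_def by blast
  have "\<forall>\<alpha>. \<exists>g. \<alpha> \<in> S \<longrightarrow> cofinal_in {..<\<alpha>} (g ` Z)"
  proof
    fix \<alpha>
    show "\<exists>g. \<alpha> \<in> S \<longrightarrow> cofinal_in {..<\<alpha>} (g ` Z)"
    proof (cases "\<alpha> \<in> S")
      case True
      from S[OF this] obtain y X where X: "y < \<alpha>" "cofinal_in {..<\<alpha>} X" "|X| \<le>o |Z|" by blast
      then have "X \<noteq> {}" unfolding cofinal_in_def by auto
      from card_of_ordLeq2[OF this, of Z] X(3) obtain g where "g ` Z = X" by blast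
      then show ?thesis using X(2) by blast
    qed simp
  qed
  from choice[OF this] obtain c where c: "\<And>\<alpha>. \<alpha> \<in> S \<Longrightarrow> cofinal_in {..<\<alpha>} (c \<alpha> ` Z)" by blast
  have c1: "c \<alpha> \<zeta> < \<alpha>" if "\<alpha> \<in> S" "\<zeta> \<in> Z" for \<alpha> \<zeta>
    using c[OF that(1)] that(2) unfolding cofinal_in_def by auto
  have c2: "\<exists>\<zeta>\<in>Z. x \<le> c \<alpha> \<zeta>" if "\<alpha> \<in> S" "x < \<alpha>" for \<alpha> x
    using c[OF that(1)] that(2) unfolding cofinal_in_def by auto
  have Ks: "|{..<x}| <o \<mu>" if "x \<in> K" for x by (rule ordLeq_ordLess_trans[OF KL[OF that] L\<mu>])
  have \<delta>B: "\<exists>B. cofinal_in {..<\<delta>} B \<and> (\<forall>x<\<delta>. |B \<inter> {..<x}| <o \<kappa>)" if \<delta>: "\<delta> \<in> T1" for \<delta>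
  proof -
    obtain X where X: "cofinal_in {..<\<delta>} X" "|X| \<le>o \<kappa>" using \<delta>X \<delta> T1(1) by blast
    show ?thesis using cofinal_records[OF \<kappa>(1) X] by auto
  qed
  have Z\<mu>: "|Z| <o \<mu>" by (rule ordLess_transitive[OF Z ordLess_transitive[OF \<kappa>(3) L\<mu>]])
  have \<delta>1: "cof_ge {..<\<delta>} \<kappa>" "stationary {..<\<delta>} (S \<inter> {..<\<delta>})" if "\<delta> \<in> T1" for \<delta>
    using \<delta>cof \<delta>S T1(1) that by blast+
  have "\<exists>(col :: 'a \<Rightarrow> nat) T'. T' \<subseteq> T1 \<and> stationary K T' \<and>
    (\<forall>\<delta>\<in>T'. \<forall>n. stationary {..<\<delta>} {\<alpha>\<in>S. \<alpha> < \<delta> \<and> col \<alpha> = n})"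
    using card_hyp
  proof
    assume \<kappa>1: "cardSuc natLeq <o \<kappa>"
    obtain P where P: "\<forall>\<delta> C G. cof_ge {..<\<delta>} \<kappa> \<longrightarrow> |a \<delta>| <o |{..<L}| \<longrightarrow>
      cofinal_in {..<\<delta>} (a \<delta>) \<longrightarrow> cofinal_in {..<\<delta>} C \<longrightarrow> (\<forall>\<alpha>\<in>C. a \<alpha> = a \<delta> \<inter> {..<\<alpha>}) \<longrightarrow>
      mono_self {..<\<delta>} G \<longrightarrow>
      (\<exists>\<epsilon><\<delta>. \<exists>j\<in>{..<L}\<times>{..<L}. \<forall>k. P \<epsilon> j k < \<delta> \<and> G (P \<epsilon> j k) \<le> P \<epsilon> j (Suc k))"
      using coherent_position_guess[OF \<kappa>1] by blast
    have "Cinfinite |{..<L}|" by (rule Cinfinite_of_natLeq_ordLess[OF card_of_Card_order L(3)])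
    then have "\<not> finite {..<L}" unfolding cinfinite_def by (simp add: Field_card_of)
    then have "|{..<L} \<times> {..<L}| =o |{..<L}|" by (rule card_of_Times_same_infinite)
    then have J: "|{..<L} \<times> {..<L}| <o \<mu>" using L\<mu> ordIso_ordLess_trans by blast
    show ?thesis
    proof (rule uniform_colouring[OF K \<mu> Ks T1(2) \<kappa>(2) \<delta>1(1) \<delta>B \<delta>1(2) Z Z\<mu> c1 c2 J])
      fix \<delta> G assume \<delta>: "\<delta> \<in> T1" and G: "mono_self {..<\<delta>} G"
      obtain C where C: "club {..<\<delta>} C" "\<forall>\<alpha>\<in>C. a \<alpha> = a \<delta> \<inter> {..<\<alpha>}" using coh[OF \<delta>] by blast
      have "cofinal_in {..<\<delta>} C" using C(1) unfolding club_def by blast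
      moreover have "|a \<delta>| <o |{..<L}|" using a \<delta> T1K by blast
      moreover have "cofinal_in {..<\<delta>} (a \<delta>)" using coh[OF \<delta>] by blast
      ultimately show "\<exists>\<epsilon><\<delta>. \<exists>j\<in>{..<L}\<times>{..<L}. \<forall>k. P \<epsilon> j k < \<delta> \<and> G (P \<epsilon> j k) \<le> P \<epsilon> j (Suc k)"
        using P \<delta>1(1)[OF \<delta>] C(2) G by simp
    qed
  next
    assume nn: "|UNIV :: (nat \<Rightarrow> nat) set| \<le>o |{..<L}|"
    have J: "|UNIV :: (nat \<Rightarrow> nat) set| <o \<mu>" by (rule ordLeq_ordLess_trans[OF nn L\<mu>])
    show ?thesis
    proof (rule uniform_colouring[OF K \<mu> Ks T1(2) \<kappa>(2) \<delta>1(1) \<delta>B \<delta>1(2) Z Z\<mu> c1 c2 J])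
      fix \<delta> G assume \<delta>: "\<delta> \<in> T1" and G: "mono_self {..<\<delta>} G"
      show "\<exists>\<epsilon><\<delta>. \<exists>h\<in>UNIV. \<forall>k. ladder \<epsilon> (h k) < \<delta> \<and> G (ladder \<epsilon> (h k)) \<le> ladder \<epsilon> (h (Suc k))"
        using ladder_subsequence_guess[OF \<delta>1(1)[OF \<delta>] \<kappa>(2) G] by simp
    qed
  qed
  then obtain col :: "'a \<Rightarrow> nat" and T2 where T2: "T2 \<subseteq> T1" "stationary K T2"
    and col: "\<And>\<delta> n. \<delta> \<in> T2 \<Longrightarrow> stationary {..<\<delta>} {\<alpha>\<in>S. \<alpha> < \<delta> \<and> col \<alpha> = n}" by blast
  have "stationary K {\<alpha>\<in>S \<inter> K. captures (walk e (Suc (col \<alpha>)) \<alpha>) A \<alpha>}"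
    if A: "cofinal_in K A" "\<And>\<beta>. \<beta> \<in> A \<Longrightarrow> cof_ge {..<\<beta>} |{..<L}|" for A
    unfolding stationary_def
  proof (intro conjI allI impI)
    show "{\<alpha>\<in>S \<inter> K. captures (walk e (Suc (col \<alpha>)) \<alpha>) A \<alpha>} \<subseteq> K" by blast
    fix D assume D: "club K D"
    have Dc: "cofinal_in K D" using D unfolding club_def by blast
    have "club K ({x\<in>K. limit_of A x} \<inter> {x\<in>K. limit_of D x})"
      by (intro club_Int[OF K \<mu>] club_limits[OF K \<mu>] A(1) Dc)
    from stationary_meets[OF T2(2) this] obtain \<delta> where \<delta>: "\<delta> \<in> T2" "\<delta> \<in> K" "limit_of A \<delta>" "limit_of D \<delta>" by blast
    have \<delta>T1: "\<delta> \<in> T1" using \<delta>(1) T2(1) by blast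
    note \<delta>c = \<delta>1(1)[OF \<delta>T1]
    obtain C where C: "club {..<\<delta>} C" "\<And>\<alpha>. \<alpha> \<in> C \<Longrightarrow> limit_of C \<alpha> \<Longrightarrow> e \<alpha> = e \<delta> \<inter> {..<\<alpha>}"
      using coh[OF \<delta>T1] by blast
    obtain n where n: "cofinal_in {..<\<delta>} {\<beta>\<in>A. \<beta> < \<delta> \<and> \<beta> \<in> walk e (Suc n) \<delta> \<and> \<beta> \<notin> walk e n \<delta>}"
      (is "cofinal_in _ ?A") using one_length_suffices[OF lad \<delta>(2) \<delta>c \<kappa>(2) \<delta>(3)] by blast
    have Cc: "cofinal_in {..<\<delta>} C" using C(1) unfolding club_def by blast
    have "club {..<\<delta>} ((D \<inter> {..<\<delta>}) \<inter> ({x\<in>{..<\<delta>}. limit_of ?A x} \<inter> {x\<in>{..<\<delta>}. limit_of C x}))"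
      by (intro club_Int[OF initial_lessThan \<delta>c \<kappa>(2)] club_limits[OF initial_lessThan \<delta>c \<kappa>(2)] n Cc
          club_restrict[OF K(1) D \<delta>(2,4)])
    from stationary_meets[OF col[OF \<delta>(1), of n] this]
    obtain \<alpha> where \<alpha>: "\<alpha> \<in> S" "\<alpha> < \<delta>" "col \<alpha> = n" "\<alpha> \<in> D" "limit_of ?A \<alpha>" "limit_of C \<alpha>" by blast
    have "\<alpha> \<in> C" using C(1) \<alpha>(2,6) unfolding club_def by simp
    then have "e \<alpha> = e \<delta> \<inter> {..<\<alpha>}" using C(2) \<alpha>(6) by blast
    from captures_transfer[OF lad small \<delta>(2) \<alpha>(2) this A(2) \<alpha>(5)]
    have "captures (walk e (Suc (col \<alpha>)) \<alpha>) A \<alpha>" using \<alpha>(3) by simp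
    moreover have "\<alpha> \<in> K" using initialD[OF K(1) \<delta>(2) less_imp_le[OF \<alpha>(2)]] .
    ultimately show "{\<alpha>\<in>S \<inter> K. captures (walk e (Suc (col \<alpha>)) \<alpha>) A \<alpha>} \<inter> D \<noteq> {}"
      using \<alpha>(1,4) by blast
  qed
  then show ?thesis using lad small by (intro exI[of _ e] exI[of _ col]) blast
qed

end

section \<open>Ordinal products and powers, extension of well-orders\<close>

text \<open>
  If \<open>s\<close> were at most \<open>r\<close>, composing \<open>f\<close> with an embedding \<open>h\<close> of \<open>s\<close> into \<open>r\<close> would give a
  strictly increasing map of \<open>r\<close> into itself that moves \<open>h b\<close> down; a least point moved down is
  impossible.
\<close>
lemma strict_embedding_ordLess:
  assumes r: "Well_order r" and s: "Well_order s"
    and f: "\<And>x y. (x, y) \<in> r \<Longrightarrow> x \<noteq> y \<Longrightarrow> (f x, f y) \<in> s \<and> f x \<noteq> f y"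
    and b: "\<And>x. x \<in> Field r \<Longrightarrow> (f x, b) \<in> s \<and> f x \<noteq> b" "b \<in> Field s"
  shows "r <o s"
proof (rule ccontr)
  assume "\<not> r <o s"
  then have "s \<le>o r" using r s not_ordLess_iff_ordLeq by blast
  then obtain h where h: "embed s r h" unfolding ordLeq_def by blast
  have h_str: "(h u, h v) \<in> r \<and> h u \<noteq> h v" if "(u, v) \<in> s" "u \<noteq> v" for u v
  proof -
    have "(h u, h v) \<in> r"
      using embed_compat[OF h] that(1) unfolding compat_def by blast
    moreover have "inj_on h (Field s)" by (rule embed_inj_on[OF s h])
    ultimately show ?thesis using that FieldI1 FieldI2 unfolding inj_on_def by metis
  qed
  have wf: "wf (r - Id)" using r unfolding well_order_on_def by blast
  define B where "B = {x. (h (f x), x) \<in> r - Id}"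
  have "h b \<in> Field r" using embed_in_Field[OF h b(2)] .
  then have "(h (f (h b)), h b) \<in> r - Id" using h_str b(1)[of "h b"] by blast
  then have "h b \<in> B" unfolding B_def by blast
  from wfE_min[OF wf this] obtain x where x: "x \<in> B" "\<And>y. (y, x) \<in> r - Id \<Longrightarrow> y \<notin> B" by blast
  then have x': "(h (f x), x) \<in> r" "h (f x) \<noteq> x" unfolding B_def by auto
  then have "(f (h (f x)), f x) \<in> s \<and> f (h (f x)) \<noteq> f x" by (rule f)
  then have "h (f x) \<in> B" unfolding B_def using h_str by blast
  then show False using x(2) x' by blast
qed

lemma Field_eqI: "refl_on A R \<Longrightarrow> R \<subseteq> A \<times> A \<Longrightarrow> Field R = A"
  unfolding refl_on_def Field_def by blast

lemma
  assumes r: "Well_order r" and s: "Well_order s"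
  shows Well_order_ord_prod: "Well_order (ord_prod r s)" and Field_ord_prod: "Field (ord_prod r s) = Field r \<times> Field s"
proof -
  note wr = r[unfolded well_order_on_def linear_order_on_def partial_order_on_def preorder_on_def]
  note ws = s[unfolded well_order_on_def linear_order_on_def partial_order_on_def preorder_on_def]
  have refl: "Refl r" "Refl s" and trans: "trans r" "trans s" and anti: "antisym r" "antisym s"
    and total: "Total r" "Total s" and wf: "wf (r - Id)" "wf (s - Id)" using wr ws by auto
  have ro: "refl_on (Field r \<times> Field s) (ord_prod r s)"
    using refl unfolding ord_prod_def refl_on_def by auto
  have sub: "ord_prod r s \<subseteq> (Field r \<times> Field s) \<times> (Field r \<times> Field s)"
    unfolding ord_prod_def by auto
  show F: "Field (ord_prod r s) = Field r \<times> Field s"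
    by (rule Field_eqI[OF ro sub])
  have "trans (ord_prod r s)"
  proof (rule transI)
    fix x y z assume "(x, y) \<in> ord_prod r s" "(y, z) \<in> ord_prod r s"
    then show "(x, z) \<in> ord_prod r s"
      unfolding ord_prod_def
      by (auto dest: transD[OF trans(1)] transD[OF trans(2)] antisymD[OF anti(2)])
  qed
  moreover have "antisym (ord_prod r s)"
    by (rule antisymI) (auto simp: ord_prod_def dest: antisymD[OF anti(1)] antisymD[OF anti(2)])
  moreover have "total_on (Field r \<times> Field s) (ord_prod r s)"
    using total refl unfolding total_on_def ord_prod_def refl_on_def by auto
  moreover have "wf (ord_prod r s - Id)"
  proof (rule wf_subset)
    show "wf (inv_image ((s - Id) <*lex*> (r - Id)) (\<lambda>(a, b). (b, a)))" using wf by auto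
    show "ord_prod r s - Id \<subseteq> inv_image ((s - Id) <*lex*> (r - Id)) (\<lambda>(a, b). (b, a))"
      unfolding ord_prod_def inv_image_def by auto
  qed
  ultimately show "Well_order (ord_prod r s)"
    using ro sub by (simp add: well_order_on_def linear_order_on_def partial_order_on_def preorder_on_def F)
qed

text \<open>
  The field of \<open>ord_exp r natLeq\<close>.
\<close>
definition digits :: "'a rel \<Rightarrow> (nat \<Rightarrow> 'a) set" where
  "digits r = {f. (\<forall>x. f x \<in> Field r) \<and> finite {x. f x \<noteq> wo_rel.minim r (Field r)}}"

lemma ord_exp_natLeq:
  "ord_exp r natLeq = {(f, g). f \<in> digits r \<and> g \<in> digits r \<and>
    (f = g \<or> (\<exists>m. f m \<noteq> g m \<and> (f m, g m) \<in> r \<and> (\<forall>x>m. f x = g x)))}"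
proof -
  have "{f \<in> Func (Field natLeq) (Field r). finite {x \<in> Field natLeq. f x \<noteq> wo_rel.minim r (Field r)}}
    = digits r" unfolding digits_def Func_def Field_natLeq by auto
  moreover have "(x \<noteq> m \<and> (m, x) \<in> natLeq) = (m < x)" for m x :: nat unfolding natLeq_def by auto
  ultimately show ?thesis unfolding ord_exp_def Let_def Field_natLeq by simp
qed

text \<open>
  Well-foundedness is inherited from lists: a function of finite support is written as the list of
  its digits, leading digit first and without leading zeros. Comparing at the largest difference
  then means comparing first by length and then lexicographically.
\<close>
lemma
  assumes r: "Well_order r"
  shows Well_order_ord_exp: "Well_order (ord_exp r natLeq)" and Field_ord_exp: "Field (ord_exp r natLeq) = digits r"
proof -
  note wr = r[unfolded well_order_on_def linear_order_on_def partial_order_on_def preorder_on_def]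
  have trans: "trans r" and anti: "antisym r" and total: "Total r" and wf: "wf (r - Id)" using wr by auto
  have wo: "wo_rel r" using r unfolding wo_rel_def .
  define z where "z = wo_rel.minim r (Field r)"
  let ?E = "ord_exp r natLeq"
  have ro: "refl_on (digits r) ?E" unfolding ord_exp_natLeq refl_on_def by blast
  have sub: "?E \<subseteq> digits r \<times> digits r" unfolding ord_exp_natLeq by blast
  show F: "Field ?E = digits r" by (rule Field_eqI[OF ro sub])
  have "trans ?E"
  proof (rule transI)
    fix f g h assume fg: "(f, g) \<in> ?E" and gh: "(g, h) \<in> ?E"
    show "(f, h) \<in> ?E"
    proof (cases "f = g \<or> g = h")
      case False
      then obtain m n where m: "f m \<noteq> g m" "(f m, g m) \<in> r" "\<forall>x>m. f x = g x"
        and n: "g n \<noteq> h n" "(g n, h n) \<in> r" "\<forall>x>n. g x = h x"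
        using fg gh unfolding ord_exp_natLeq by blast
      have "f (max m n) \<noteq> h (max m n) \<and> (f (max m n), h (max m n)) \<in> r"
      proof (cases m n rule: linorder_cases)
        case less
        then show ?thesis using m(3) n by (simp add: max_def)
      next
        case equal
        then have "(f m, h m) \<in> r" using m(2) n(2) transD[OF trans] by blast
        moreover have "f m \<noteq> h m" using m n equal antisymD[OF anti] by metis
        ultimately show ?thesis using equal by simp
      next
        case greater
        then have "g m = h m" using n(3) by blast
        then show ?thesis using m greater by (simp add: max_def)
      qed
      moreover have "\<forall>x>max m n. f x = h x" using m(3) n(3) by simp
      ultimately show ?thesis using fg gh unfolding ord_exp_natLeq by blast
    qed (use fg gh in auto)
  qed
  moreover have "antisym ?E"
  proof (rule antisymI, rule ccontr)
    fix f g assume fg: "(f, g) \<in> ?E" and gf: "(g, f) \<in> ?E" and "f \<noteq> g"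
    then obtain m n where m: "f m \<noteq> g m" "(f m, g m) \<in> r" "\<forall>x>m. f x = g x"
      and n: "g n \<noteq> f n" "(g n, f n) \<in> r" "\<forall>x>n. g x = f x"
      unfolding ord_exp_natLeq by blast
    have "m = n" using m n by (metis linorder_neqE_nat)
    then show False using m n antisymD[OF anti] by blast
  qed
  moreover have "total_on (digits r) ?E"
  proof (rule total_onI)
    fix f g assume f: "f \<in> digits r" and g: "g \<in> digits r" and "f \<noteq> g"
    have "{x. f x \<noteq> g x} \<subseteq> {x. f x \<noteq> z} \<union> {x. g x \<noteq> z}" by auto
    then have fin: "finite {x. f x \<noteq> g x}"
      using f g unfolding digits_def z_def[symmetric] by (auto intro: finite_subset)
    have ne: "{x. f x \<noteq> g x} \<noteq> {}" using \<open>f \<noteq> g\<close> by auto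
    define m where "m = Max {x. f x \<noteq> g x}"
    have m: "f m \<noteq> g m" using Max_in[OF fin ne] unfolding m_def by simp
    have above: "\<forall>x>m. f x = g x"
    proof (intro allI impI, rule ccontr)
      fix x assume "m < x" "f x \<noteq> g x"
      then have "x \<le> m" using Max_ge[OF fin, of x] unfolding m_def by simp
      then show False using \<open>m < x\<close> by simp
    qed
    have "f m \<in> Field r" "g m \<in> Field r" using f g unfolding digits_def by auto
    then have "(f m, g m) \<in> r \<or> (g m, f m) \<in> r" using total m unfolding total_on_def by blast
    then show "(f, g) \<in> ?E \<or> (g, f) \<in> ?E"
    proof
      assume "(f m, g m) \<in> r"
      then have "(f, g) \<in> ?E" unfolding ord_exp_natLeq using f g m above by blast
      then show ?thesis ..
    next
      assume "(g m, f m) \<in> r"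
      moreover have "g m \<noteq> f m" "\<forall>x>m. g x = f x" using m above by auto
      ultimately have "(g, f) \<in> ?E" unfolding ord_exp_natLeq using f g by blast
      then show ?thesis ..
    qed
  qed
  moreover have "wf (?E - Id)"
  proof -
    define N where "N f = (LEAST n. \<forall>x\<ge>n. f x = z)" for f :: "nat \<Rightarrow> 'a"
    have N: "f x = z" if f: "f \<in> digits r" and x: "x \<ge> N f" for f x
    proof -
      have "finite {x. f x \<noteq> z}" using f unfolding digits_def z_def by blast
      then obtain n where "\<forall>x\<in>{x. f x \<noteq> z}. x < n" using finite_nat_set_iff_bounded by blast
      then have "\<forall>x\<ge>n. f x = z" by force
      then have "\<forall>x\<ge>N f. f x = z" unfolding N_def by (rule LeastI)
      then show ?thesis using x by blast
    qed
    have N_pred: "f n \<noteq> z" if "f \<in> digits r" "N f = Suc n" for f n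
    proof
      assume "f n = z"
      then have "\<forall>x\<ge>n. f x = z" using N[OF that(1)] that(2) by (metis le_less not_less_eq_eq Suc_leI)
      then have "N f \<le> n" unfolding N_def by (rule Least_le)
      then show False using that(2) by simp
    qed
    \<comment> \<open>\<open>N f\<close> is the number of digits of \<open>f\<close> that remain when leading zeros are dropped.\<close>
    define \<phi> where "\<phi> f = map f (rev [0..<N f])" for f :: "nat \<Rightarrow> 'a"
    have "(\<phi> f, \<phi> g) \<in> lenlex (r - Id)" if fg: "(f, g) \<in> ?E - Id" for f g
    proof -
      have f: "f \<in> digits r" and g: "g \<in> digits r" using fg unfolding ord_exp_natLeq by auto
      obtain m where m: "f m \<noteq> g m" "(f m, g m) \<in> r" "\<forall>x>m. f x = g x"
        using fg unfolding ord_exp_natLeq by blast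
      have le: "N f \<le> N g"
      proof (rule ccontr)
        \<comment> \<open>The leading digit of \<open>f\<close> would be the place of the largest difference, with \<open>g\<close> vanishing there.\<close>
        assume "\<not> N f \<le> N g"
        then obtain n where n: "N f = Suc n" "N g \<le> n" by (metis Suc_leI Suc_le_D not_le Suc_le_mono)
        have fn: "f n \<noteq> z" and gn: "g n = z" using N_pred[OF f n(1)] N[OF g n(2)] by auto
        have "\<not> n < m"
        proof
          assume "n < m"
          then have "f m = z" "g m = z" using N[OF f] N[OF g] n by auto
          then show False using m(1) by simp
        qed
        moreover have "\<not> m < n" using m(3) fn gn by auto
        ultimately have "m = n" by simp
        then have 1: "(f n, z) \<in> r" using m(2) gn by simp
        have "(z, f n) \<in> r" unfolding z_def
          by (rule wo_rel.minim_least[OF wo]) (use f in \<open>auto simp: digits_def\<close>)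
        then show False using 1 fn antisymD[OF anti] by blast
      qed
      show ?thesis
      proof (cases "N f = N g")
        case False
        then have "length (\<phi> f) < length (\<phi> g)" using le unfolding \<phi>_def by simp
        then show ?thesis unfolding lenlex_conv by simp
      next
        case True
        have mN: "m < N g"
        proof (rule ccontr)
          assume "\<not> m < N g"
          then have "f m = z" "g m = z" using N[OF f] N[OF g] True by auto
          then show False using m(1) by simp
        qed
        have split: "rev [0..<N g] = rev [Suc m..<N g] @ m # rev [0..<m]"
        proof -
          have "[0..<N g] = [0..<m] @ [m..<N g]"
            using upt_add_eq_append[of 0 m "N g - m"] mN by simp
          also have "[m..<N g] = m # [Suc m..<N g]" using mN by (rule upt_conv_Cons)
          finally show ?thesis by simp
        qed
        have pre: "map f (rev [Suc m..<N g]) = map g (rev [Suc m..<N g])" using m(3) by simp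
        have "\<phi> f = map g (rev [Suc m..<N g]) @ f m # map f (rev [0..<m])"
          unfolding \<phi>_def True split by (simp add: pre[simplified])
        moreover have "\<phi> g = map g (rev [Suc m..<N g]) @ g m # map g (rev [0..<m])"
          unfolding \<phi>_def split by simp
        ultimately have "(\<phi> f, \<phi> g) \<in> lex (r - Id)"
          unfolding lex_conv using m(1,2) by (intro CollectI case_prodI conjI exI) auto
        moreover have "length (\<phi> f) = length (\<phi> g)" using True unfolding \<phi>_def by simp
        ultimately show ?thesis unfolding lenlex_conv by simp
      qed
    qed
    then have "?E - Id \<subseteq> inv_image (lenlex (r - Id)) \<phi>" unfolding inv_image_def by blast
    then show ?thesis using wf_subset[OF wf_inv_image[OF wf_lenlex[OF wf]]] by blast
  qed
  ultimately show "Well_order ?E"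
    using ro sub by (simp add: well_order_on_def linear_order_on_def partial_order_on_def preorder_on_def F)
qed

text \<open>
  Placing the elements outside the field of \<open>r\<close> on top, in any well-order, makes the type
  well-ordered with the field of \<open>r\<close> as an initial segment.
\<close>
lemma extend_well_order:
  assumes r: "Well_order r"
  shows "\<exists>le lt. class.wellorder le lt \<and> (\<forall>x y. (x, y) \<in> r \<longleftrightarrow> x \<in> Field r \<and> y \<in> Field r \<and> le x y) \<and>
    (\<forall>x\<in>Field r. \<forall>y. lt y x \<longrightarrow> y \<in> Field r)"
proof -
  obtain w :: "'a rel" where w': "Well_order w" "Field w = UNIV" using well_ordering[where ?'a = 'a]
    by (elim exE conjE) (rule that)
  then have w: "well_order_on UNIV w" by simp
  note wr = r[unfolded well_order_on_def linear_order_on_def partial_order_on_def preorder_on_def]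
  note ww = w[unfolded well_order_on_def linear_order_on_def partial_order_on_def preorder_on_def]
  let ?F = "Field r"
  define le where "le x y \<longleftrightarrow> (x, y) \<in> r \<or> x \<in> ?F \<and> y \<notin> ?F \<or> x \<notin> ?F \<and> y \<notin> ?F \<and> (x, y) \<in> w" for x y
  define lt where "lt x y \<longleftrightarrow> le x y \<and> \<not> le y x" for x y
  have refl: "Refl r" "refl w" and trans: "trans r" "trans w" and anti: "antisym r" "antisym w"
    and total: "Total r" "total w" and wf: "wf (r - Id)" "wf (w - Id)" using wr ww by auto
  have rF: "x \<in> ?F \<and> y \<in> ?F" if "(x, y) \<in> r" for x y using that unfolding Field_def by blast
  have le_refl: "le x x" for x
    using refl unfolding le_def refl_on_def by (cases "x \<in> ?F") simp_all
  have lt_r: "(y, x) \<in> r - Id" if "lt y x" "x \<in> ?F" for x y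
  proof -
    have "y \<noteq> x" using that(1) le_refl unfolding lt_def by blast
    moreover have "(y, x) \<in> r" using that unfolding lt_def le_def by simp
    ultimately show ?thesis by simp
  qed
  have lt_w: "y \<in> ?F \<or> (y, x) \<in> w - Id" if "lt y x" "x \<notin> ?F" for x y
  proof -
    have "y \<noteq> x" using that(1) le_refl unfolding lt_def by blast
    moreover have "(y, x) \<in> r \<or> y \<in> ?F \<or> (y, x) \<in> w" using that unfolding lt_def le_def by blast
    ultimately show ?thesis using rF by auto
  qed
  have "class.wellorder le lt"
  proof unfold_locales
    fix x y z
    show "lt x y \<longleftrightarrow> le x y \<and> \<not> le y x" by (rule lt_def)
    show "le x x" by (rule le_refl)
    show "le x z" if "le x y" "le y z"
      using that rF[of x y] rF[of y z] transD[OF trans(1), of x y z] transD[OF trans(2), of x y z]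
      unfolding le_def by auto
    show "x = y" if "le x y" "le y x"
      using that rF[of x y] rF[of y x] antisymD[OF anti(1), of x y] antisymD[OF anti(2), of x y]
      unfolding le_def by auto
    have "x \<in> ?F \<Longrightarrow> y \<in> ?F \<Longrightarrow> x \<noteq> y \<Longrightarrow> (x, y) \<in> r \<or> (y, x) \<in> r"
      and "x \<noteq> y \<Longrightarrow> (x, y) \<in> w \<or> (y, x) \<in> w"
      using total unfolding total_on_def by auto
    then show "le x y \<or> le y x"
      using le_refl[of x] unfolding le_def by auto
  next
    fix P a assume step: "\<And>x. (\<And>y. lt y x \<Longrightarrow> P y) \<Longrightarrow> P x"
    have in_F: "x \<in> ?F \<longrightarrow> P x" for x
    proof (induction x rule: wf_induct_rule[OF wf(1)])
      case (1 x)
      show ?case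
      proof
        assume x: "x \<in> ?F"
        show "P x"
        proof (rule step)
          fix y assume "lt y x"
          from lt_r[OF this x] have "(y, x) \<in> r - Id" .
          moreover from this have "y \<in> ?F" using rF by blast
          ultimately show "P y" using 1 by blast
        qed
      qed
    qed
    show "P a"
    proof (induction a rule: wf_induct_rule[OF wf(2)])
      case (1 x)
      show ?case
      proof (cases "x \<in> ?F")
        case False
        show ?thesis
        proof (rule step)
          fix y assume "lt y x"
          from lt_w[OF this False] show "P y" using 1 in_F by blast
        qed
      qed (use in_F in blast)
    qed
  qed
  moreover have "\<forall>x y. (x, y) \<in> r \<longleftrightarrow> x \<in> ?F \<and> y \<in> ?F \<and> le x y" using rF unfolding le_def by blast
  moreover have "\<forall>x\<in>?F. \<forall>y. lt y x \<longrightarrow> y \<in> ?F" using lt_r rF by blast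
  ultimately show ?thesis by blast
qed

lemma nat_functions_le_continuum: "|UNIV :: (nat \<Rightarrow> nat) set| \<le>o ctwo ^c natLeq"
proof -
  have "|UNIV :: (nat \<Rightarrow> nat) set| \<le>o natLeq ^c natLeq"
    unfolding cexp_def Field_natLeq Func_def by (simp add: card_of_mono1)
  also have "natLeq ^c natLeq \<le>o (ctwo ^c natLeq) ^c natLeq"
    by (intro cexp_mono1 ordLess_imp_ordLeq ordLess_ctwo_cexp natLeq_Card_order)
  also have "(ctwo ^c natLeq) ^c natLeq =o ctwo ^c (natLeq *c natLeq)"
    by (rule cexp_cprod[OF Card_order_ctwo])
  also have "ctwo ^c (natLeq *c natLeq) =o ctwo ^c natLeq"
    by (rule cexp_cong2[OF cprod_infinite[OF natLeq_Cinfinite] Card_order_ctwo Card_order_cprod])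
  finally show ?thesis .
qed

section \<open>From well-ordered types to well-order relations\<close>

context wellorder
begin

lemma le_on_iff: "(x, y) \<in> le_on X \<longleftrightarrow> x \<in> X \<and> y \<in> X \<and> x \<le> y"
  unfolding le_on_def by simp

lemma unbounded_in_le_on: "unbounded_in (le_on I) X \<longleftrightarrow> cofinal_in I X"
proof -
  have "(a, b) \<in> le_on I \<longleftrightarrow> a \<le> b" if "X \<subseteq> I" "a \<in> I" "b \<in> X" for a b
    using that unfolding le_on_def by auto
  then show ?thesis unfolding unbounded_in_def cofinal_in_def Field_le_on by blast
qed

lemma supr_le_on:
  assumes "X \<subseteq> I" "s \<in> I" "\<And>x. x \<in> X \<Longrightarrow> x \<le> s" "\<And>b. b \<in> I \<Longrightarrow> \<forall>x\<in>X. x \<le> b \<Longrightarrow> s \<le> b"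
  shows "wo_rel.supr (le_on I) X = s"
proof -
  have wo: "wo_rel (le_on I)" unfolding wo_rel_def by (rule Well_order_le_on)
  have Ab: "Above (le_on I) X = {b\<in>I. \<forall>x\<in>X. x \<le> b}"
    using assms(1) unfolding Above_def Field_le_on unfolding le_on_def by blast
  have "s = wo_rel.minim (le_on I) (Above (le_on I) X)"
    unfolding Ab by (rule wo_rel.equals_minim[OF wo]) (use assms in \<open>auto simp: le_on_iff\<close>)
  then show ?thesis unfolding wo_rel.supr_def[OF wo] by simp
qed

lemma Above_le_on: "X \<subseteq> I \<Longrightarrow> Above (le_on I) X = {b\<in>I. \<forall>x\<in>X. x \<le> b}"
  unfolding Above_def Field_le_on unfolding le_on_def by blast

lemma limit_supr:
  assumes "X \<subseteq> I" "x \<in> I" "\<And>y. y \<in> X \<Longrightarrow> y \<le> x" "limit_of X x"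
  shows "wo_rel.supr (le_on I) X = x"
proof (rule supr_le_on[OF assms(1,2,3)])
  fix b assume b: "b \<in> I" "\<forall>y\<in>X. y \<le> b"
  show "x \<le> b"
  proof (rule ccontr)
    assume "\<not> x \<le> b"
    then have "b < x" by simp
    from limit_ex[OF assms(4) this] obtain d where "d \<in> X" "b < d" by blast
    then show False using b(2) by auto
  qed
qed

lemma club_in_le_on:
  assumes I: "initial I"
  shows "club_in (le_on I) C \<longleftrightarrow> club I C"
proof -
  have "(\<forall>X. X \<subseteq> C \<and> X \<noteq> {} \<and> Above (le_on I) X \<noteq> {} \<longrightarrow> wo_rel.supr (le_on I) X \<in> C) \<longleftrightarrow>
    (\<forall>x\<in>I. limit_of C x \<longrightarrow> x \<in> C)" (is "?L \<longleftrightarrow> ?R") if C: "C \<subseteq> I"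
  proof
    assume L: ?L
    show ?R
    proof (intro ballI impI)
      fix x assume x: "x \<in> I" "limit_of C x"
      let ?X = "C \<inter> {..<x}"
      have XI: "?X \<subseteq> I" using C by blast
      have "limit_of ?X x" using x(2) limit_of_cong[of x C ?X] by simp
      then have "wo_rel.supr (le_on I) ?X = x"
        by (intro limit_supr) (use C x(1) in auto)
      moreover obtain y where "y < x" using x(2) unfolding limit_of_def by blast
      then obtain d where "d \<in> C" "d < x" using limit_ex[OF x(2)] by blast
      then have "?X \<noteq> {}" by blast
      moreover have "x \<in> Above (le_on I) ?X"
        unfolding Above_le_on[OF XI] using x(1) by auto
      ultimately show "x \<in> C" using L by (metis Int_lower1 empty_iff)
    qed
  next
    assume R: ?R
    show ?L
    proof (intro allI impI, elim conjE)
      fix X assume X: "X \<subseteq> C" "X \<noteq> {}" "Above (le_on I) X \<noteq> {}"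
      have XI: "X \<subseteq> I" using X(1) C by blast
      obtain b where b: "b \<in> I" "\<forall>x\<in>X. x \<le> b" using X(3) unfolding Above_le_on[OF XI] by blast
      define s where "s = (LEAST s. \<forall>x\<in>X. x \<le> s)"
      have ub: "\<forall>x\<in>X. x \<le> s" unfolding s_def by (rule LeastI[of "\<lambda>s. \<forall>x\<in>X. x \<le> s" b]) (rule b(2))
      have least: "s \<le> c" if "\<forall>x\<in>X. x \<le> c" for c unfolding s_def by (rule Least_le) (rule that)
      have sI: "s \<in> I" using initialD[OF I b(1) least[OF b(2)]] .
      have sup: "wo_rel.supr (le_on I) X = s" by (rule supr_le_on[OF XI sI]) (use ub least in blast)+
      have "s \<in> C"
      proof (cases "s \<in> X")
        case False
        have "limit_of C s" unfolding limit_of_def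
        proof (intro conjI allI impI)
          obtain x where x: "x \<in> X" using X(2) by blast
          then have "x < s" using ub False by (metis le_less)
          then show "\<exists>y. y < s" by blast
          fix y assume "y < s"
          then have "\<not> s \<le> y" by simp
          then have "\<not> (\<forall>x\<in>X. x \<le> y)" using least[of y] by blast
          then obtain d where d: "d \<in> X" "\<not> d \<le> y" by blast
          have "d \<le> s" "d \<noteq> s" using ub d(1) False by auto
          then have "d < s" by simp
          then show "\<exists>d\<in>C. y < d \<and> d < s" using d X(1) by (intro bexI[of _ d]) auto
        qed
        then show ?thesis using R sI by blast
      qed (use X(1) in blast)
      then show "wo_rel.supr (le_on I) X \<in> C" using sup by simp
    qed
  qed
  then show ?thesis unfolding club_in_def club_def unbounded_in_le_on
    by (metis cofinal_in_def)
qed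

lemma stationary_in_le_on:
  assumes "initial I"
  shows "stationary_in (le_on I) S \<longleftrightarrow> stationary I S"
  unfolding stationary_in_def stationary_def Field_le_on club_in_le_on[OF assms] ..

lemma underS_le_on_initial: "initial K \<Longrightarrow> \<delta> \<in> K \<Longrightarrow> underS (le_on K) \<delta> = {..<\<delta>}"
  using underS_le_on[of \<delta> K] unfolding initial_def by blast

lemma seg_le_on: "initial K \<Longrightarrow> \<delta> \<in> K \<Longrightarrow> seg (le_on K) \<delta> = le_on {..<\<delta>}"
  unfolding seg_def underS_le_on_initial Restr_le_on
  by (rule arg_cong[of _ _ le_on]) (auto simp: initial_def)

lemma cof_le_on:
  assumes "cof (le_on I) =o \<kappa>"
  shows "cof_ge I \<kappa>" and "\<exists>X. cofinal_in I X \<and> |X| =o \<kappa>"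
proof -
  obtain X where X: "cofinal_in I X" "cof (le_on I) = |X|" "\<And>Y. cofinal_in I Y \<Longrightarrow> |X| \<le>o |Y|"
    using cof_witness[OF Well_order_le_on[of I]] unfolding unbounded_in_le_on by blast
  have iso: "|X| =o \<kappa>" using assms unfolding X(2) .
  then show "\<exists>X. cofinal_in I X \<and> |X| =o \<kappa>" using X(1) by blast
  show "cof_ge I \<kappa>"
    unfolding cof_ge_def
  proof (intro allI impI, elim conjE)
    fix Y assume Y: "Y \<subseteq> I" "|Y| <o \<kappa>"
    have "\<not> cofinal_in I Y"
    proof
      assume "cofinal_in I Y"
      then have "|X| \<le>o |Y|" by (rule X(3))
      also have "|Y| <o \<kappa>" by (rule Y(2))
      finally have "|X| <o \<kappa>" .
      then show False using iso not_ordLess_ordIso by blast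
    qed
    then obtain b where "b \<in> I" "\<forall>y\<in>Y. \<not> b \<le> y" using Y(1) unfolding cofinal_in_def by blast
    then show "\<exists>b\<in>I. \<forall>y\<in>Y. y < b" by (intro bexI[of _ b]) (auto simp: not_le)
  qed
qed

text \<open>
  A point of \<open>W\<close> with no other points of \<open>W\<close> just below it is not the supremum of the preceding
  ones, so it is not an accumulation point.
\<close>
lemma captures_supr:
  assumes K: "initial K" and \<alpha>: "\<alpha> \<in> K" "\<exists>y. y < \<alpha>" and cap: "captures W A \<alpha>"
  shows "\<alpha> = wo_rel.supr (le_on K) (A \<inter> nacc (le_on K) (W \<inter> {..<\<alpha>}))"
proof -
  let ?E = "W \<inter> {..<\<alpha>}"
  let ?X = "A \<inter> nacc (le_on K) ?E"
  have EK: "?E \<subseteq> K" using K \<alpha>(1) unfolding initial_def by blast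
  have iso: "\<beta> \<in> nacc (le_on K) ?E"
    if \<beta>: "\<beta> \<in> ?E" "\<eta> < \<beta>" "\<forall>y\<in>W. \<not> (\<eta> < y \<and> y < \<beta>)" for \<beta> \<eta>
  proof -
    have \<beta>K: "\<beta> \<in> K" using \<beta>(1) EK by blast
    have "\<beta> \<noteq> wo_rel.supr (le_on K) (?E \<inter> {..<\<beta>})"
    proof
      assume s: "\<beta> = wo_rel.supr (le_on K) (?E \<inter> {..<\<beta>})"
      have XK: "?E \<inter> {..<\<beta>} \<subseteq> K" using EK by blast
      have ub: "x \<le> \<eta>" if "x \<in> ?E \<inter> {..<\<beta>}" for x
      proof -
        have "x \<in> W" "x < \<beta>" using that by auto
        then have "\<not> \<eta> < x" using \<beta>(3) by blast
        then show ?thesis by simp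
      qed
      have wo: "wo_rel (le_on K)" unfolding wo_rel_def by (rule Well_order_le_on)
      have \<eta>K: "\<eta> \<in> K" using K \<beta>K \<beta>(2) unfolding initial_def by blast
      have "\<eta> \<in> Above (le_on K) (?E \<inter> {..<\<beta>})" unfolding Above_le_on[OF XK] using ub \<eta>K by blast
      then have "(wo_rel.supr (le_on K) (?E \<inter> {..<\<beta>}), \<eta>) \<in> le_on K"
        unfolding wo_rel.supr_def[OF wo]
        by (intro wo_rel.minim_least[OF wo]) (auto simp: Above_le_on[OF XK])
      then have "\<beta> \<le> \<eta>" using s unfolding le_on_def by simp
      then show False using \<beta>(2) by simp
    qed
    then show ?thesis
      unfolding nacc_def acc_def using \<beta>(1) by (simp add: underS_le_on_initial[OF K \<beta>K])
  qed
  have "limit_of ?X \<alpha>"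
    unfolding limit_of_def
  proof (intro conjI allI impI)
    show "\<exists>y. y < \<alpha>" by (rule \<alpha>(2))
    fix x assume "x < \<alpha>"
    then obtain \<beta> \<eta> where \<beta>: "\<beta> \<in> A \<inter> W" "x < \<beta>" "\<beta> < \<alpha>" "\<eta> < \<beta>" "\<forall>y\<in>W. \<not> (\<eta> < y \<and> y < \<beta>)"
      using cap unfolding captures_def by blast
    then have "\<beta> \<in> ?E" by simp
    from iso[OF this \<beta>(4,5)] show "\<exists>d\<in>?X. x < d \<and> d < \<alpha>" using \<beta> by blast
  qed
  moreover have "?X \<subseteq> {..<\<alpha>}" unfolding nacc_def by blast
  ultimately show ?thesis
    using limit_supr[of ?X K \<alpha>] \<alpha>(1) EK unfolding nacc_def by (simp add: subset_iff less_imp_le)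
qed

lemma walk_club:
  assumes lad: "is_ladder K e" and \<delta>: "\<delta> \<in> K"
  shows "club {..<\<delta>} (walk e (Suc n) \<delta> \<inter> {..<\<delta>})"
  unfolding club_def cofinal_in_def
proof (intro conjI ballI impI)
  fix x assume "x \<in> {..<\<delta>}"
  then have x: "x < \<delta>" by simp
  note nx = nxt[OF lad \<delta> x]
  have "nxt e \<delta> (nxt e \<delta> x) = nxt e \<delta> x" by (rule nxt_eqI) (use nx in auto)
  then have "nxt e \<delta> x \<in> walk e (Suc n) \<delta>" using nx(3) by simp
  then show "\<exists>c\<in>walk e (Suc n) \<delta> \<inter> {..<\<delta>}. x \<le> c" using nx by blast
next
  fix x assume x: "x \<in> {..<\<delta>}" "limit_of (walk e (Suc n) \<delta> \<inter> {..<\<delta>}) x"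
  have "limit_of (walk e (Suc n) \<delta>) x" by (rule limit_of_mono[OF x(2)]) blast
  then have "x \<in> walk e (Suc n) \<delta>" using walk_closed[OF lad \<delta>, of x "Suc n"] x(1) by simp
  then show "x \<in> walk e (Suc n) \<delta> \<inter> {..<\<delta>}" using x(1) by blast
qed blast

text \<open>
  The codes of the points of \<open>E\<close> have only \<open>2 * n\<close> digits, so they lie below \<open>top\<close>, which has a
  nonzero digit at the place \<open>2 * n\<close>. A single copy of \<open>\<lambda>\<^sup>\<omega>\<close>, at a position \<open>c\<close> in the product
  with \<open>\<kappa>\<close>, suffices for them.
\<close>
lemma walk_order_type:
  fixes lam :: "'l rel" and \<kappa> :: "'k rel"
  assumes lad: "is_ladder K e" and small: "\<And>\<gamma> b. \<gamma> \<in> K \<Longrightarrow> b < \<gamma> \<Longrightarrow> |e \<gamma> \<inter> {..<b}| <o |{..<L}|"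
    and L: "le_on {..<L} =o lam" "b < u" "u < L" and lam: "Well_order lam"
    and \<kappa>: "Well_order \<kappa>" "c \<in> Field \<kappa>" and \<delta>: "\<delta> \<in> K" and E: "E \<subseteq> walk e n \<delta>" "E \<subseteq> K"
  shows "Restr (le_on K) E <o ord_prod (ord_exp lam natLeq) \<kappa>"
proof -
  define z where "z = (LEAST x::'a. True)"
  have z_le: "z \<le> x" for x unfolding z_def by (rule Least_le) simp
  have zu: "z < u" by (rule le_less_trans[OF z_le L(2)])
  have zL: "z < L" by (rule less_trans[OF zu L(3)])
  obtain \<phi> where "iso (le_on {..<L}) lam \<phi>" using L(1) unfolding ordIso_def by blast
  then have bij: "bij_betw \<phi> {..<L} (Field lam)"
    and ord: "\<And>x y. x < L \<Longrightarrow> y < L \<Longrightarrow> x \<le> y \<Longrightarrow> (\<phi> x, \<phi> y) \<in> lam"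
    unfolding iso_iff2 Field_le_on by (auto simp: le_on_def)
  have \<phi>F: "\<phi> x \<in> Field lam" if "x < L" for x using bij that unfolding bij_betw_def by auto
  have \<phi>inj: "\<phi> x \<noteq> \<phi> y" if "x < L" "y < L" "x \<noteq> y" for x y
    using bij that unfolding bij_betw_def inj_on_def by auto
  have wl: "wo_rel lam" using lam unfolding wo_rel_def .
  have zmin: "\<phi> z = wo_rel.minim lam (Field lam)"
  proof (rule wo_rel.equals_minim[OF wl])
    show "\<phi> z \<in> Field lam" by (rule \<phi>F[OF zL])
    fix y assume "y \<in> Field lam"
    then obtain x where "x < L" "y = \<phi> x" using bij unfolding bij_betw_def by auto
    then show "(\<phi> z, y) \<in> lam" using ord[OF zL _ z_le] by simp
  qed blast
  have dig: "(\<lambda>m. \<phi> (f m)) \<in> digits lam" if "\<And>m. f m < L" "\<And>m. N \<le> m \<Longrightarrow> f m = z" for f and N :: nat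
  proof -
    have "x < N" if "\<phi> (f x) \<noteq> \<phi> z" for x
      using that \<open>\<And>m. N \<le> m \<Longrightarrow> f m = z\<close>[of x] by (cases "x < N") auto
    then have "{x. \<phi> (f x) \<noteq> \<phi> z} \<subseteq> {..<N}" by auto
    then have "finite {x. \<phi> (f x) \<noteq> \<phi> z}" by (rule finite_subset) simp
    then show ?thesis unfolding digits_def zmin[symmetric] using \<phi>F that(1) by simp
  qed
  have lex: "((\<lambda>m. \<phi> (f m)), (\<lambda>m. \<phi> (g m))) \<in> ord_exp lam natLeq \<and> (\<lambda>m. \<phi> (f m)) \<noteq> (\<lambda>m. \<phi> (g m))"
    if fg: "\<And>m. f m < L" "\<And>m. g m < L" "lexless f g"
      "(\<lambda>m. \<phi> (f m)) \<in> digits lam" "(\<lambda>m. \<phi> (g m)) \<in> digits lam" for f g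
  proof -
    obtain m where m: "f m < g m" "\<forall>x>m. f x = g x" using fg(3) unfolding lexless_def by blast
    have "\<phi> (f m) \<noteq> \<phi> (g m)" "(\<phi> (f m), \<phi> (g m)) \<in> lam"
      using \<phi>inj[OF fg(1,2)] ord[OF fg(1,2)] m(1) by auto
    moreover have "\<forall>x>m. \<phi> (f x) = \<phi> (g x)" using m(2) by simp
    ultimately show ?thesis unfolding ord_exp_natLeq using fg(4,5) by (auto dest: fun_cong)
  qed
  define F where "F \<beta> = (\<lambda>m. \<phi> (digit_code e z u n \<delta> \<beta> m))" for \<beta>
  define top where "top = (\<lambda>m. \<phi> (((\<lambda>_. z)(2 * n := u)) m))"
  have cL: "digit_code e z u n \<delta> \<beta> m < L" if "\<beta> \<in> E" for \<beta> m
    using digit_code_range[OF lad small zL L(3) \<delta>] E(1) that by blast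
  have tL: "((\<lambda>_. z)(2 * n := u)) m < L" for m using zL L(3) by simp
  have Fd: "F \<beta> \<in> digits lam" if "\<beta> \<in> E" for \<beta>
    unfolding F_def by (rule dig[OF cL[OF that] digit_code_high])
  have td: "top \<in> digits lam"
    unfolding top_def by (rule dig[OF tL, of "Suc (2 * n)"]) auto
  have FF: "(F x, F y) \<in> ord_exp lam natLeq \<and> F x \<noteq> F y" if xy: "x \<in> E" "y \<in> E" "x < y" for x y
    unfolding F_def
  proof (rule lex)
    show "lexless (digit_code e z u n \<delta> x) (digit_code e z u n \<delta> y)"
      using digit_code_mono[OF lad small zu \<delta>] E(1) xy by blast
  qed (use cL xy Fd[unfolded F_def] in auto)
  have Ft: "(F x, top) \<in> ord_exp lam natLeq \<and> F x \<noteq> top" if x: "x \<in> E" for x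
    unfolding F_def top_def
  proof (rule lex)
    show "lexless (digit_code e z u n \<delta> x) ((\<lambda>_. z)(2 * n := u))" by (rule digit_code_bound[OF zu])
  qed (use cL tL x Fd[unfolded F_def] td[unfolded top_def] in auto)
  have R: "Restr (le_on K) E = le_on E" unfolding Restr_le_on using E(2) by (simp add: Int_absorb1)
  have We: "Well_order (ord_exp lam natLeq)" "Field (ord_exp lam natLeq) = digits lam"
    by (rule Well_order_ord_exp[OF lam] Field_ord_exp[OF lam])+
  have cc: "(c, c) \<in> \<kappa>" using \<kappa> unfolding order_on_defs refl_on_def by blast
  have pr: "((f, c), (g, c)) \<in> ord_prod (ord_exp lam natLeq) \<kappa>" if "(f, g) \<in> ord_exp lam natLeq" for f g
    using that \<kappa>(2) FieldI1[OF that] FieldI2[OF that] unfolding ord_prod_def by simp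
  show ?thesis unfolding R
  proof (rule strict_embedding_ordLess[OF Well_order_le_on Well_order_ord_prod[OF We(1) \<kappa>(1)],
        where f = "\<lambda>\<beta>. (F \<beta>, c)" and b = "(top, c)"])
    fix x y assume "(x, y) \<in> le_on E" "x \<noteq> y"
    then have "x \<in> E" "y \<in> E" "x < y" unfolding le_on_def by auto
    from FF[OF this] show "((F x, c), (F y, c)) \<in> ord_prod (ord_exp lam natLeq) \<kappa> \<and> (F x, c) \<noteq> (F y, c)"
      using pr by simp
  next
    fix x assume "x \<in> Field (le_on E)"
    then have "x \<in> E" by simp
    from Ft[OF this] show "((F x, c), (top, c)) \<in> ord_prod (ord_exp lam natLeq) \<kappa> \<and> (F x, c) \<noteq> (top, c)"
      using pr by simp
  next
    show "(top, c) \<in> Field (ord_prod (ord_exp lam natLeq) \<kappa>)"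
      unfolding Field_ord_prod[OF We(1) \<kappa>(1)] We(2) using td \<kappa>(2) by simp
  qed
qed

text \<open>
  The hypotheses of \<open>guessing_core\<close> are read off from the cardinals: \<open>\<lambda>\<close> is identified with the
  initial segment below a point \<open>L\<close> of \<open>\<lambda>\<^sup>+\<close>, and the index set of the cofinal sequences is the
  field of \<open>\<theta>\<close>. The guessing set is \<open>S\<close> itself.
\<close>
lemma club_guessing_le_on:
  fixes lam :: "'l rel" and \<kappa> :: "'k rel" and \<theta> :: "'t rel" and S :: "'a set"
  assumes lam: "Card_order lam" "cof lam =o lam" and \<kappa>: "Card_order \<kappa>" "\<kappa> <o lam"
    and \<theta>: "Card_order \<theta>" "natLeq \<le>o \<theta>" "\<theta> <o \<kappa>"
    and K: "initial K" "le_on K =o cardSuc lam"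
    and S: "S \<subseteq> cof_set (le_on K) \<theta>" "stationary_in (le_on K) S"
    and T: "stationary_in (le_on K) {\<delta> \<in> Field (le_on K). cof (seg (le_on K) \<delta>) =o \<kappa> \<and>
      stationary_in (seg (le_on K) \<delta>) (S \<inter> underS (le_on K) \<delta>)}"
    and card_hyp: "cardSuc natLeq \<le>o \<theta> \<or> ctwo ^c natLeq \<le>o lam"
  shows "\<exists>S' E. S' \<subseteq> S \<and> stationary_in (le_on K) S' \<and>
    (\<forall>\<delta> \<in> S'. club_in (seg (le_on K) \<delta>) (E \<delta>) \<and>
               Restr (le_on K) (E \<delta>) <o ord_prod (ord_exp lam natLeq) \<kappa>) \<and>
    (\<forall>A. unbounded_in (le_on K) A \<and> A \<subseteq> cof_set (le_on K) lam \<longrightarrow>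
         stationary_in (le_on K) {\<delta> \<in> S'. \<delta> = wo_rel.supr (le_on K) (A \<inter> nacc (le_on K) (E \<delta>))})"
proof -
  note seg = seg_le_on[OF K(1)] and stK = stationary_in_le_on[OF K(1)]
  have \<kappa>0: "natLeq <o \<kappa>" by (rule ordLeq_ordLess_trans[OF \<theta>(2,3)])
  have lam0: "natLeq <o lam" by (rule ordLess_transitive[OF \<kappa>0 \<kappa>(2)])
  have lamC: "Cinfinite lam" by (rule Cinfinite_of_natLeq_ordLess[OF lam(1) lam0])
  have wlam: "Well_order lam" "Well_order \<kappa>" using lam(1) \<kappa>(1) card_order_on_well_order_on by blast+
  have "|K| =o |Field (cardSuc lam)|" using card_of_cong[OF K(2)] by simp
  then have Kiso: "|K| =o cardSuc lam"
    using card_of_Field_ordIso[OF cardSuc_Card_order[OF lam(1)]] ordIso_transitive by blast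
  have lamK: "lam <o |K|"
    by (rule ordLess_ordIso_trans[OF cardSuc_greater[OF lam(1)] ordIso_symmetric[OF Kiso]])
  have lamr: "lam <o le_on K"
    by (rule ordLess_ordIso_trans[OF cardSuc_greater[OF lam(1)] ordIso_symmetric[OF K(2)]])
  then have "\<exists>x\<in>K. lam =o le_on (K \<inter> {..<x})" unfolding ordLess_le_on_iff by blast
  then obtain L where LK: "L \<in> K" and "lam =o le_on (K \<inter> {..<L})" by blast
  moreover have "K \<inter> {..<L} = {..<L}" using K(1) LK unfolding initial_def by blast
  ultimately have Liso: "lam =o le_on {..<L}" by simp
  have "|Field lam| =o |{..<L}|" using card_of_cong[OF Liso] by simp
  then have Lc: "lam =o |{..<L}|"
    using card_of_Field_ordIso[OF lam(1)] ordIso_symmetric ordIso_transitive by blast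
  have L0: "natLeq <o |{..<L}|" by (rule ordLess_ordIso_trans[OF lam0 Lc])
  have below: "|{..<x}| <o |I|" if I: "initial I" "le_on I =o |I|" "x \<in> I" for x I
  proof -
    have "Card_order (le_on I)" by (rule Card_order_ordIso[OF card_of_Card_order I(2)])
    from card_of_underS[OF this, of x] have "|underS (le_on I) x| <o le_on I" using I(3) by simp
    then have "|{..<x}| <o le_on I" unfolding underS_le_on_initial[OF I(1,3)] .
    then show ?thesis using I(2) by (rule ordLess_ordIso_trans)
  qed
  have LL: "|{..<x}| <o |{..<L}|" if "x < L" for x
    by (rule below[OF initial_lessThan ordIso_transitive[OF ordIso_symmetric[OF Liso] Lc]]) (use that in simp)
  have KK: "|{..<x}| <o |K|" if "x \<in> K" for x
    by (rule below[OF K(1) ordIso_transitive[OF K(2) ordIso_symmetric[OF Kiso]] that])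
  have "regularCard lam" using cof_eq_iff_regularCard[OF lam(1)] lam(2) lamC unfolding cinfinite_def by blast
  then have "stable lam" using regularCard_stable[OF lam(1)] lamC unfolding cinfinite_def by blast
  then have Lst: "stable |{..<L}|" by (rule stable_ordIso1[OF _ ordIso_symmetric[OF Lc]])
  have sucC: "Cinfinite (cardSuc lam)" by (rule Cinfinite_cardSuc[OF lamC])
  then have "stable (cardSuc lam)"
    using regularCard_stable[of "cardSuc lam"] regularCard_cardSuc[OF lamC] unfolding cinfinite_def by blast
  then have Kst: "stable |K|" by (rule stable_ordIso1[OF _ Kiso])
  have K0: "natLeq <o |K|" by (rule ordLess_transitive[OF lam0 lamK])
  have Kcof: "cof_ge K |K|" by (rule regular_cof_ge[OF Kst KK K0])
  have LK': "|{..<L}| <o |K|" by (rule ordIso_ordLess_trans[OF ordIso_symmetric[OF Lc] lamK])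
  have KL: "|{..<x}| \<le>o |{..<L}|" if "x \<in> K" for x
  proof -
    have "|{..<x}| <o cardSuc lam" by (rule ordLess_ordIso_trans[OF KK[OF that] Kiso])
    then have "|{..<x}| \<le>o lam" using cardSuc_ordLeq_ordLess[OF lam(1) card_of_Card_order] by blast
    then show ?thesis using Lc by (rule ordLeq_ordIso_trans)
  qed
  have Zc: "|Field \<theta>| =o \<theta>" by (rule card_of_Field_ordIso[OF \<theta>(1)])
  have SK: "S \<subseteq> K" using S(1) unfolding cof_set_def by auto
  have Sc: "(\<exists>y. y < \<alpha>) \<and> (\<exists>X. cofinal_in {..<\<alpha>} X \<and> |X| \<le>o |Field \<theta>| )" if \<alpha>: "\<alpha> \<in> S" for \<alpha>
  proof -
    have "\<alpha> \<in> K" using SK \<alpha> by blast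
    have "cof (seg (le_on K) \<alpha>) =o \<theta>" using S(1) \<alpha> unfolding cof_set_def by blast
    then have "cof (le_on {..<\<alpha>}) =o \<theta>" unfolding seg[OF \<open>\<alpha> \<in> K\<close>] .
    from cof_le_on(2)[OF this] obtain X where X: "cofinal_in {..<\<alpha>} X" "|X| =o \<theta>" by blast
    have "natLeq \<le>o |X|" by (rule ordLeq_ordIso_trans[OF \<theta>(2) ordIso_symmetric[OF X(2)]])
    then have "\<not> finite X" using infinite_iff_natLeq_ordLeq by blast
    then have "X \<noteq> {}" by auto
    then obtain x where "x \<in> X" by blast
    then have "x < \<alpha>" using X(1) unfolding cofinal_in_def by auto
    moreover have "|X| \<le>o |Field \<theta>|"
      by (rule ordIso_imp_ordLeq[OF ordIso_transitive[OF X(2) ordIso_symmetric[OF Zc]]])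
    ultimately show ?thesis using X(1) by blast
  qed
  define T where "T = {\<delta> \<in> Field (le_on K). cof (seg (le_on K) \<delta>) =o \<kappa> \<and>
      stationary_in (seg (le_on K) \<delta>) (S \<inter> underS (le_on K) \<delta>)}"
  have Tst: "stationary K T" using T unfolding T_def stK .
  have Td: "cof (le_on {..<\<delta>}) =o \<kappa>" "stationary {..<\<delta>} (S \<inter> {..<\<delta>})" if "\<delta> \<in> T" for \<delta>
  proof -
    have \<delta>: "\<delta> \<in> K" using that unfolding T_def by simp
    have *: "cof (seg (le_on K) \<delta>) =o \<kappa>" "stationary_in (seg (le_on K) \<delta>) (S \<inter> underS (le_on K) \<delta>)"
      using that unfolding T_def by blast+
    show "cof (le_on {..<\<delta>}) =o \<kappa>" using *(1) unfolding seg[OF \<delta>] .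
    show "stationary {..<\<delta>} (S \<inter> {..<\<delta>})" using *(2)
      unfolding seg[OF \<delta>] underS_le_on_initial[OF K(1) \<delta>] stationary_in_le_on[OF initial_lessThan] .
  qed
  have case': "cardSuc natLeq <o \<kappa> \<or> |UNIV :: (nat \<Rightarrow> nat) set| \<le>o |{..<L}|"
    using card_hyp
  proof
    assume "cardSuc natLeq \<le>o \<theta>"
    then have "cardSuc natLeq <o \<kappa>" using \<theta>(3) by (rule ordLeq_ordLess_trans)
    then show ?thesis ..
  next
    assume "ctwo ^c natLeq \<le>o lam"
    then have "|UNIV :: (nat \<Rightarrow> nat) set| \<le>o lam" by (rule ordLeq_transitive[OF nat_functions_le_continuum])
    then have "|UNIV :: (nat \<Rightarrow> nat) set| \<le>o |{..<L}|" using Lc by (rule ordLeq_ordIso_trans)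
    then show ?thesis ..
  qed
  have \<delta>X: "\<exists>X. cofinal_in {..<\<delta>} X \<and> |X| \<le>o \<kappa>" if "\<delta> \<in> T" for \<delta>
    using cof_le_on(2)[OF Td(1)[OF that]] ordIso_imp_ordLeq by blast
  have Z\<kappa>: "|Field \<theta>| <o \<kappa>" by (rule ordIso_ordLess_trans[OF Zc \<theta>(3)])
  have \<kappa>L: "\<kappa> <o |{..<L}|" by (rule ordLess_ordIso_trans[OF \<kappa>(2) Lc])
  have "\<exists>e (col :: 'a \<Rightarrow> nat). is_ladder K e \<and> (\<forall>\<gamma>\<in>K. \<forall>b<\<gamma>. |e \<gamma> \<inter> {..<b}| <o |{..<L}| ) \<and>
    (\<forall>A. cofinal_in K A \<longrightarrow> (\<forall>\<beta>\<in>A. cof_ge {..<\<beta>} |{..<L}| ) \<longrightarrow>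
      stationary K {\<alpha>\<in>S \<inter> K. captures (walk e (Suc (col \<alpha>)) \<alpha>) A \<alpha>})"
    by (rule guessing_core[OF K(1) Kcof K0 Lst LL L0 LK' KL \<kappa>(1) \<kappa>0 \<kappa>L Z\<kappa> Sc Tst
          cof_le_on(1)[OF Td(1)] \<delta>X Td(2) case'])
  then obtain e :: "'a \<Rightarrow> 'a set" and col :: "'a \<Rightarrow> nat" where lad: "is_ladder K e"
    and small': "\<forall>\<gamma>\<in>K. \<forall>b<\<gamma>. |e \<gamma> \<inter> {..<b}| <o |{..<L}|"
    and guess: "\<forall>A. cofinal_in K A \<longrightarrow> (\<forall>\<beta>\<in>A. cof_ge {..<\<beta>} |{..<L}| ) \<longrightarrow>
      stationary K {\<alpha>\<in>S \<inter> K. captures (walk e (Suc (col \<alpha>)) \<alpha>) A \<alpha>}"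
    by (elim exE conjE) (rule that)
  define E where "E \<alpha> = walk e (Suc (col \<alpha>)) \<alpha> \<inter> {..<\<alpha>}" for \<alpha>
  have "cof_ge {..<L} |{..<L}|" by (rule regular_cof_ge[OF Lst _ L0]) (simp add: LL)
  then obtain b where "b < L" using cof_geD[of "{..<L}" _ "{}"] countable_image_ordLess[OF L0, of "\<lambda>_. undefined" "{}"] by auto
  moreover have "\<exists>u\<in>{..<L}. b < u"
    by (rule no_max[OF \<open>cof_ge {..<L} |{..<L}|\<close> L0]) (use \<open>b < L\<close> in simp)
  ultimately obtain u where u: "b < u" "u < L" by blast
  have "\<not> finite (Field \<kappa>)" using Cinfinite_of_natLeq_ordLess[OF \<kappa>(1) \<kappa>0] unfolding cinfinite_def by blast
  then have "Field \<kappa> \<noteq> {}" by auto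
  then obtain c where c: "c \<in> Field \<kappa>" by blast
  have "club_in (seg (le_on K) \<delta>) (E \<delta>) \<and> Restr (le_on K) (E \<delta>) <o ord_prod (ord_exp lam natLeq) \<kappa>"
    if \<delta>: "\<delta> \<in> S" for \<delta>
  proof
    have \<delta>K: "\<delta> \<in> K" using SK \<delta> by blast
    show "club_in (seg (le_on K) \<delta>) (E \<delta>)"
      unfolding seg[OF \<delta>K] club_in_le_on[OF initial_lessThan] E_def by (rule walk_club[OF lad \<delta>K])
    show "Restr (le_on K) (E \<delta>) <o ord_prod (ord_exp lam natLeq) \<kappa>"
      by (rule walk_order_type[OF lad small'[rule_format] ordIso_symmetric[OF Liso] u wlam(1,2) c \<delta>K, of _ "Suc (col \<delta>)"])
        (use K(1) \<delta>K in \<open>auto simp: E_def initial_def\<close>)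
  qed
  moreover have "stationary_in (le_on K) {\<delta> \<in> S. \<delta> = wo_rel.supr (le_on K) (A \<inter> nacc (le_on K) (E \<delta>))}"
    if A: "unbounded_in (le_on K) A" "A \<subseteq> cof_set (le_on K) lam" for A
  proof -
    have "cof_ge {..<\<beta>} |{..<L}|" if \<beta>: "\<beta> \<in> A" for \<beta>
    proof -
      have \<beta>K: "\<beta> \<in> K" "cof (seg (le_on K) \<beta>) =o lam" using A(2) \<beta> unfolding cof_set_def by auto
      have "cof (le_on {..<\<beta>}) =o |{..<L}|"
        using ordIso_transitive[OF \<beta>K(2) Lc] unfolding seg[OF \<beta>K(1)] .
      then show ?thesis by (rule cof_le_on(1))
    qed
    then have "stationary K {\<alpha>\<in>S \<inter> K. captures (walk e (Suc (col \<alpha>)) \<alpha>) A \<alpha>}"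
      using guess A(1) unfolding unbounded_in_le_on by blast
    then have "stationary K {\<delta> \<in> S. \<delta> = wo_rel.supr (le_on K) (A \<inter> nacc (le_on K) (E \<delta>))}"
    proof (rule stationary_mono)
      show "{\<alpha>\<in>S \<inter> K. captures (walk e (Suc (col \<alpha>)) \<alpha>) A \<alpha>}
        \<subseteq> {\<delta> \<in> S. \<delta> = wo_rel.supr (le_on K) (A \<inter> nacc (le_on K) (E \<delta>))}"
      proof
        fix \<alpha> assume "\<alpha> \<in> {\<alpha>\<in>S \<inter> K. captures (walk e (Suc (col \<alpha>)) \<alpha>) A \<alpha>}"
        then have \<alpha>: "\<alpha> \<in> S" "\<alpha> \<in> K" "captures (walk e (Suc (col \<alpha>)) \<alpha>) A \<alpha>" by auto
        have "\<exists>y. y < \<alpha>" using Sc[OF \<alpha>(1)] by blast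
        from captures_supr[OF K(1) \<alpha>(2) this \<alpha>(3)] \<alpha>(1)
        show "\<alpha> \<in> {\<delta> \<in> S. \<delta> = wo_rel.supr (le_on K) (A \<inter> nacc (le_on K) (E \<delta>))}"
          unfolding E_def by blast
      qed
      show "{\<delta> \<in> S. \<delta> = wo_rel.supr (le_on K) (A \<inter> nacc (le_on K) (E \<delta>))} \<subseteq> K" using SK by blast
    qed
    then show ?thesis unfolding stK .
  qed
  ultimately show ?thesis using S(2) by (intro exI[of _ S] exI[of _ E]) blast
qed

end

section \<open>Guessing unbounded sets of points of cofinality lambda\<close>

theorem theorem2p1:
  fixes lam :: "'a rel" and \<kappa> :: "'b rel" and \<theta> :: "'c rel" and Sstar :: "'a set set"
  assumes "Card_order lam" and "Card_order \<kappa>" and "Card_order \<theta>"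
    and "cof lam =o lam" and "cof \<kappa> =o \<kappa>" and "cof \<theta> =o \<theta>"
    and "\<kappa> <o lam" and "\<theta> <o \<kappa>"
    and "Sstar \<subseteq> cof_set (cardSuc lam) \<theta>"
    and "stationary_in (cardSuc lam) Sstar"
    and "stationary_in (cardSuc lam)
           {\<delta> \<in> Field (cardSuc lam). cof (seg (cardSuc lam) \<delta>) =o \<kappa> \<and>
              stationary_in (seg (cardSuc lam) \<delta>) (Sstar \<inter> underS (cardSuc lam) \<delta>)}"
  shows "(cardSuc natLeq \<le>o \<theta> \<longrightarrow> club_guessing lam \<kappa> Sstar) \<and>
         (natLeq \<le>o \<theta> \<and> ctwo ^c natLeq \<le>o lam \<longrightarrow> club_guessing lam \<kappa> Sstar)"
proof -
  have suc: "Card_order (cardSuc lam)" by (rule cardSuc_Card_order[OF assms(1)])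
  then have wo: "Well_order (cardSuc lam)" by (rule card_order_on_well_order_on)
  obtain le lt where le: "class.wellorder le lt"
    and rel: "\<forall>x y. (x, y) \<in> cardSuc lam \<longleftrightarrow>
      x \<in> Field (cardSuc lam) \<and> y \<in> Field (cardSuc lam) \<and> le x y"
    and init: "\<forall>x\<in>Field (cardSuc lam). \<forall>y. lt y x \<longrightarrow> y \<in> Field (cardSuc lam)"
    using extend_well_order[OF wo] by (elim exE conjE) (rule that)
  interpret w: wellorder le lt by (rule le)
  define K where "K = Field (cardSuc lam)"
  have r: "cardSuc lam = w.le_on K"
    unfolding w.le_on_def K_def using rel by auto
  have K: "w.initial K" unfolding w.initial_def K_def using init by blast
  have iso: "w.le_on K =o cardSuc lam" unfolding r[symmetric] by (rule ordIso_reflexive[OF wo])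
  have "club_guessing lam \<kappa> Sstar"
    if "natLeq \<le>o \<theta>" "cardSuc natLeq \<le>o \<theta> \<or> ctwo ^c natLeq \<le>o lam"
    unfolding club_guessing_def Let_def r
    by (rule w.club_guessing_le_on[OF assms(1,4,2,7,3) that(1) assms(8) K iso
          assms(9,10,11)[unfolded r] that(2)])
  moreover have "natLeq \<le>o \<theta>" if "cardSuc natLeq \<le>o \<theta>"
    using cardSuc_ordLeq[OF natLeq_Card_order] that by (rule ordLeq_transitive)
  ultimately show ?thesis by blast
qed

end
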